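(* Let $D_0\subset D_1\subset D_2\subset\mathbb{R}^d$, $d\ge2$, be bounded simply connected Lipschitz domains with $\overline{D_0}\subset D_1$, $\overline{D_1}\subset D_2$, and set $\Omega_i:=D_i\setminus\overline{D_0}$ for $i=1,2$, so that $\partial\Omega_i=\partial D_i\sqcup\Gamma$ with $\Gamma:=\partial D_0$. Consider on each $\Omega_i$ the partial Dirichlet-to-Neumann map on $\Gamma$ with eigenvalues $\sigma^{(\Lambda)}_{\Gamma,k}(\Omega_i)$. (i) If the Dirichlet condition is imposed on $\partial D_i$ (i.e. $\Gamma_{\mathrm{Dir}}=\partial D_i$, $\Gamma_{\mathrm{Neu}}=\varnothing$) for $i=1,2$, and $\Lambda<\lambda^{\mathrm{Dir}}_1(\Omega_2)$, then $\sigma^{(\Lambda)}_{\Gamma,k}(\Omega_1)\ge\sigma^{(\Lambda)}_{\Gamma,k}(\Omega_2)$ for all $k\in\mathbb{N}$. (ii) If the Neumann condition is imposed on $\partial D_i$ (i.e. $\Gamma_{\mathrm{Neu}}=\partial D_i$, $\Gamma_{\mathrm{Dir}}=\varnothing$) for $i=1,2$, and $\Lambda<0$, then $\sigma^{(\Lambda)}_{\Gamma,k}(\Omega_1)\le\sigma^{(\Lambda)}_{\Gamma,k}(\Omega_2)$ for all $k\in\mathbb{N}$.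
   Context: Partial Dirichlet-to-Neumann map: for a bounded Lipschitz domain $\Omega$ with $\partial\Omega$ split into disjoint parts $\Gamma$ and $\Gamma_{\mathrm{Dir}}$ or $\Gamma_{\mathrm{Neu}}$ (here whole boundary components), and $\Lambda$ not an eigenvalue of the Laplacian with Dirichlet condition on $\Gamma\cup\Gamma_{\mathrm{Dir}}$ and Neumann condition on $\Gamma_{\mathrm{Neu}}$, the operator $\mathcal{D}_{\Lambda,\Gamma}:H^{1/2}(\Gamma)\to H^{-1/2}(\Gamma)$ maps $u$ to $(\partial_nU)|_\Gamma$, where $U\in H^1(\Omega)$ solves $-\Delta U=\Lambda U$ in $\Omega$, $U=u$ on $\Gamma$, $U=0$ on $\Gamma_{\mathrm{Dir}}$, $\partial_nU=0$ on $\Gamma_{\mathrm{Neu}}$ ($\partial_n$ exterior normal derivative). It is self-adjoint in $L^2(\Gamma)$, bounded below with discrete spectrum $\sigma^{(\Lambda)}_{\Gamma,1}\le\sigma^{(\Lambda)}_{\Gamma,2}\le\dots$ (with multiplicity), characterised by $\sigma^{(\Lambda)}_{\Gamma,k}=\min_{\mathcal L}\max_{U\in\mathcal L\setminus\{0\}}\frac{\|\nabla U\|^2_{L^2(\Omega)}-\Lambda\|U\|^2_{L^2(\Omega)}}{\|U|_\Gamma\|^2_{L^2(\Gamma)}}$ over $k$-dimensional subspaces $\mathcal L$ of $\{U\in H^1(\Omega):-\Delta U=\Lambda U,\ U|_{\Gamma_{\mathrm{Dir}}}=0\}$. $\lambda^{\mathrm{Dir}}_1(\Omega_2)$ is the first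 Dirichlet Laplacian eigenvalue of $\Omega_2$. *)

theory Defs
  imports "HOL-Analysis.Analysis"
begin

definition hausdorff_const :: "real \<Rightarrow> real" where
  "hausdorff_const s = pi powr (s / 2) / Gamma (s / 2 + 1) / 2 powr s"

definition hausdorff_outer :: "real \<Rightarrow> 'a::euclidean_space set \<Rightarrow> ennreal" where
  "hausdorff_outer s A =
     (SUP \<delta>\<in>{0<..}. INF C\<in>{C::nat \<Rightarrow> 'a set. A \<subseteq> (\<Union>n. C n) \<and>
                                  (\<forall>n. bounded (C n) \<and> diameter (C n) < \<delta>)}.
        (\<Sum>n. ennreal (hausdorff_const s * diameter (C n) powr s)))"

definition surf :: "'a::euclidean_space set \<Rightarrow> 'a measure" where
  "surf G = measure_of G {G \<inter> B | B. B \<in> sets borel}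
              (hausdorff_outer (real DIM('a) - 1))"

definition L2_surf :: "'a::euclidean_space set \<Rightarrow> ('a \<Rightarrow> real) \<Rightarrow> bool" where
  "L2_surf G f \<longleftrightarrow> f \<in> borel_measurable (surf G) \<and> integrable (surf G) (\<lambda>x. (f x)\<^sup>2)"

definition lipschitz_domain :: "'a::euclidean_space set \<Rightarrow> bool" where
  "lipschitz_domain D \<longleftrightarrow> open D \<and> connected D \<and> bounded D \<and> D \<noteq> {} \<and>
     (\<forall>x\<in>frontier D. \<exists>r>0. \<exists>e::'a. \<exists>g::'a \<Rightarrow> real. \<exists>C.
        norm e = 1 \<and> C-lipschitz_on UNIV g \<and>
        ball x r \<inter> D = {y \<in> ball x r. y \<bullet> e > g (y - (y \<bullet> e) *\<^sub>R e)})"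

definition tsupp :: "('a::euclidean_space \<Rightarrow> real) \<Rightarrow> 'a set" where
  "tsupp \<phi> = closure {x. \<phi> x \<noteq> 0}"

definition C1c :: "('a::euclidean_space \<Rightarrow> real) \<Rightarrow> ('a \<Rightarrow> 'a) \<Rightarrow> bool" where
  "C1c \<phi> g \<longleftrightarrow> (\<forall>x. (\<phi> has_derivative (\<lambda>h. g x \<bullet> h)) (at x)) \<and> continuous_on UNIV g \<and>
                 compact (tsupp \<phi>)"

definition L2_dom :: "'a::euclidean_space set \<Rightarrow> ('a \<Rightarrow> real) \<Rightarrow> bool" where
  "L2_dom \<Omega> u \<longleftrightarrow> u \<in> borel_measurable (lebesgue_on \<Omega>) \<and>
                    integrable (lebesgue_on \<Omega>) (\<lambda>x. (u x)\<^sup>2)"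

definition weak_grad :: "'a::euclidean_space set \<Rightarrow> ('a \<Rightarrow> real) \<Rightarrow> ('a \<Rightarrow> 'a) \<Rightarrow> bool" where
  "weak_grad \<Omega> u G \<longleftrightarrow> G \<in> borel_measurable (lebesgue_on \<Omega>) \<and>
     integrable (lebesgue_on \<Omega>) (\<lambda>x. (norm (G x))\<^sup>2) \<and>
     (\<forall>\<phi> g. C1c \<phi> g \<and> tsupp \<phi> \<subseteq> \<Omega> \<longrightarrow>
        integral\<^sup>L (lebesgue_on \<Omega>) (\<lambda>x. u x *\<^sub>R g x) =
        - integral\<^sup>L (lebesgue_on \<Omega>) (\<lambda>x. \<phi> x *\<^sub>R G x))"

definition H1 :: "'a::euclidean_space set \<Rightarrow> ('a \<Rightarrow> real) \<Rightarrow> bool" where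
  "H1 \<Omega> u \<longleftrightarrow> L2_dom \<Omega> u \<and> (\<exists>G. weak_grad \<Omega> u G)"

definition wgrad :: "'a::euclidean_space set \<Rightarrow> ('a \<Rightarrow> real) \<Rightarrow> 'a \<Rightarrow> 'a" where
  "wgrad \<Omega> u = (SOME G. weak_grad \<Omega> u G)"

definition L2norm2 :: "'a::euclidean_space set \<Rightarrow> ('a \<Rightarrow> real) \<Rightarrow> real" where
  "L2norm2 \<Omega> u = integral\<^sup>L (lebesgue_on \<Omega>) (\<lambda>x. (u x)\<^sup>2)"

definition dirichlet_energy :: "'a::euclidean_space set \<Rightarrow> ('a \<Rightarrow> real) \<Rightarrow> real" where
  "dirichlet_energy \<Omega> u = integral\<^sup>L (lebesgue_on \<Omega>) (\<lambda>x. (norm (wgrad \<Omega> u x))\<^sup>2)"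

definition H1dist2 :: "'a::euclidean_space set \<Rightarrow> ('a \<Rightarrow> real) \<Rightarrow> ('a \<Rightarrow> real) \<Rightarrow> real" where
  "H1dist2 \<Omega> u v = L2norm2 \<Omega> (\<lambda>x. u x - v x) + dirichlet_energy \<Omega> (\<lambda>x. u x - v x)"

definition H10 :: "'a::euclidean_space set \<Rightarrow> ('a \<Rightarrow> real) \<Rightarrow> bool" where
  "H10 \<Omega> u \<longleftrightarrow> H1 \<Omega> u \<and> (\<exists>w gw. (\<forall>n. C1c (w n) (gw n) \<and> tsupp (w n) \<subseteq> \<Omega>) \<and>
                                   (\<lambda>n. H1dist2 \<Omega> (w n) u) \<longlonglongrightarrow> 0)"

text \<open>f is the trace on G (a part of the boundary) of u \<in> H^1(\<Omega>): the trace operator is the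
  continuous extension of the restriction map from C^1(closure \<Omega>) (restrictions of
  compactly supported C^1 functions on R^d) to H^1(\<Omega>).\<close>
definition trace_on :: "'a::euclidean_space set \<Rightarrow> 'a set \<Rightarrow> ('a \<Rightarrow> real) \<Rightarrow> ('a \<Rightarrow> real) \<Rightarrow> bool" where
  "trace_on \<Omega> G u f \<longleftrightarrow> H1 \<Omega> u \<and> L2_surf G f \<and>
     (\<exists>w gw. (\<forall>n. C1c (w n) (gw n)) \<and>
        (\<lambda>n. H1dist2 \<Omega> (w n) u) \<longlonglongrightarrow> 0 \<and>
        (\<lambda>n. integral\<^sup>L (surf G) (\<lambda>x. (w n x - f x)\<^sup>2)) \<longlonglongrightarrow> 0)"

definition trace :: "'a::euclidean_space set \<Rightarrow> 'a set \<Rightarrow> ('a \<Rightarrow> real) \<Rightarrow> 'a \<Rightarrow> real" where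
  "trace \<Omega> G u = (SOME f. trace_on \<Omega> G u f)"

text \<open>Solutions U \<in> H^1(\<Omega>) of -\<Delta>U = \<Lambda>U in \<Omega>, \<partial>_n U = 0 on GNeu, U = 0 on GDir,
  in the weak sense: tested against C^1 functions whose support avoids G \<union> GDir
  (so the Neumann condition on the remaining boundary part is imposed weakly).\<close>
definition dtn_space :: "'a::euclidean_space set \<Rightarrow> 'a set \<Rightarrow> 'a set \<Rightarrow> real \<Rightarrow> ('a \<Rightarrow> real) set" where
  "dtn_space \<Omega> G GDir \<Lambda> = {U. H1 \<Omega> U \<and> trace_on \<Omega> GDir U (\<lambda>_. 0) \<and>
     (\<forall>\<phi> g. C1c \<phi> g \<and> tsupp \<phi> \<inter> (G \<union> GDir) = {} \<longrightarrow>
        integral\<^sup>L (lebesgue_on \<Omega>) (\<lambda>x. wgrad \<Omega> U x \<bullet> g x) =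
        \<Lambda> * integral\<^sup>L (lebesgue_on \<Omega>) (\<lambda>x. U x * \<phi> x))}"

definition dtn_rayleigh :: "'a::euclidean_space set \<Rightarrow> 'a set \<Rightarrow> real \<Rightarrow> ('a \<Rightarrow> real) \<Rightarrow> real" where
  "dtn_rayleigh \<Omega> G \<Lambda> U =
     (dirichlet_energy \<Omega> U - \<Lambda> * L2norm2 \<Omega> U) /
     integral\<^sup>L (surf G) (\<lambda>x. (trace \<Omega> G U x)\<^sup>2)"

definition lin_indep_ae :: "'a::euclidean_space set \<Rightarrow> nat \<Rightarrow> (nat \<Rightarrow> 'a \<Rightarrow> real) \<Rightarrow> bool" where
  "lin_indep_ae \<Omega> k V \<longleftrightarrow> (\<forall>c::nat \<Rightarrow> real.
      (AE x in lebesgue_on \<Omega>. (\<Sum>i<k. c i * V i x) = 0) \<longrightarrow> (\<forall>i<k. c i = 0))"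

text \<open>k-th eigenvalue (k \<ge> 1, counted with multiplicity) of the partial DtN map
  D_{\<Lambda>,G} on \<Omega> with Dirichlet condition on GDir (and Neumann on the rest):
  min over k-dimensional subspaces L of the solution space of the max over L - {0}
  of the Rayleigh quotient.  A k-dimensional subspace is given by a basis V.\<close>
definition dtn_eig :: "'a::euclidean_space set \<Rightarrow> 'a set \<Rightarrow> 'a set \<Rightarrow> real \<Rightarrow> nat \<Rightarrow> ereal" where
  "dtn_eig \<Omega> G GDir \<Lambda> k =
     (INF V\<in>{V. (\<forall>i<k. V i \<in> dtn_space \<Omega> G GDir \<Lambda>) \<and> lin_indep_ae \<Omega> k V}.
        SUP c\<in>{c::nat \<Rightarrow> real. \<exists>i<k. c i \<noteq> 0}.
          ereal (dtn_rayleigh \<Omega> G \<Lambda> (\<lambda>x. \<Sum>i<k. c i * V i x)))"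

definition dir_eig1 :: "'a::euclidean_space set \<Rightarrow> real" where
  "dir_eig1 \<Omega> = Inf {dirichlet_energy \<Omega> u / L2norm2 \<Omega> u | u.
                        H10 \<Omega> u \<and> \<not> (AE x in lebesgue_on \<Omega>. u x = 0)}"

end

(* Each V admissible for the eigenvalue problem that should have the larger eigenvalues yields an
   admissible W for the other one: extend V by zero (Dirichlet case) or restrict it (Neumann case),
   and subtract its projection, with respect to the energy |grad u|^2 - Lambda u^2, onto the functions
   vanishing on Gamma and on the Dirichlet boundary. This keeps the trace on Gamma and does not
   increase the energy. The bounds on Lambda say that the energy is coercive on these functions, which
   gives the projection and makes V |-> W injective, so the min-max values can be compared.

   The geometry of the outer boundary enters only in the Dirichlet case: a function with zero trace
   there must be a limit of C1 functions vanishing near that boundary, in order to be extended by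
   zero. This follows by cutting off on thin boundary strips, where a Hardy type inequality holds:
   integrate along the direction of the Lipschitz graph, and compare the Hausdorff measure of a piece
   of boundary with the Lebesgue measure of the cylinder over it by covering. *)

theory Submission
  imports Defs
begin

text \<open>\<open>dtn_eig\<close> ranges over solutions only, and neither the zero extension nor
  the restriction of a solution need solve the problem on the other domain: the first may have a
  jump of the normal derivative across \<open>frontier D1\<close>, the second may lose the Neumann
  condition there. Subtracting the projection restores the weak equation, because that equation says
  exactly that the pair (value, gradient) is energy-orthogonal to the admissible tests. Gradients
  and traces are picked by \<open>SOME\<close>, so they are accessible only through approximation.
  Functions are therefore handled as pairs (value, gradient) in L2, together with sequences of C1
  test functions converging to them. One locale serves both cases: \<open>Wa\<close> is the domain
  that should have the smaller eigenvalues, \<open>Wb\<close> the other one, and \<open>E\<close>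
  keeps a pair on the smaller domain \<open>Y\<close> and makes it zero elsewhere. Injectivity uses
  coercivity on \<open>Wb\<close>: if the image of a solution vanishes, the solution is itself a
  limit of admissible tests, hence energy-orthogonal to itself, hence zero.\<close>

section \<open>Square integrable functions\<close>

definition sqint :: "'x measure \<Rightarrow> ('x \<Rightarrow> 'b::euclidean_space) \<Rightarrow> bool" where
  "sqint M f \<longleftrightarrow> f \<in> borel_measurable M \<and> integrable M (\<lambda>x. (norm (f x))\<^sup>2)"

text \<open>Squared, so that \<open>L2norm2\<close> and \<open>dirichlet_energy\<close> are
  instances and \<open>H1dist2\<close> is a sum of two of them. The price is the factor 2 in
  \<open>sqint_add\<close>, which replaces the triangle inequality.\<close>

definition N2 :: "'x measure \<Rightarrow> ('x \<Rightarrow> 'b::euclidean_space) \<Rightarrow> real" where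
  "N2 M f = (\<integral>x. (norm (f x))\<^sup>2 \<partial>M)"

lemma sqint_measurable [measurable_dest]: "sqint M f \<Longrightarrow> f \<in> borel_measurable M"
  by (simp add: sqint_def)

lemma sqint_integrable: "sqint M f \<Longrightarrow> integrable M (\<lambda>x. (norm (f x))\<^sup>2)"
  by (simp add: sqint_def)

lemma N2_nonneg: "0 \<le> N2 M f"
  by (simp add: N2_def)

lemma sqint_bound:
  assumes f: "sqint M f" and g: "g \<in> borel_measurable M"
    and le: "\<And>x. x \<in> space M \<Longrightarrow> norm (g x) \<le> K * norm (f x)"
  shows "sqint M g" "N2 M g \<le> K\<^sup>2 * N2 M f"
proof -
  have le2: "(norm (g x))\<^sup>2 \<le> K\<^sup>2 * (norm (f x))\<^sup>2" if "x \<in> space M" for x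
    using power_mono[OF le[OF that] norm_ge_zero, of 2] by (simp add: power_mult_distrib)
  have int: "integrable M (\<lambda>x. K\<^sup>2 * (norm (f x))\<^sup>2)"
    using f by (simp add: sqint_def)
  have "integrable M (\<lambda>x. (norm (g x))\<^sup>2)"
    by (rule Bochner_Integration.integrable_bound[OF int]) (use g le2 in auto)
  then show s: "sqint M g" using g by (simp add: sqint_def)
  have "N2 M g \<le> (\<integral>x. K\<^sup>2 * (norm (f x))\<^sup>2 \<partial>M)"
    unfolding N2_def by (rule integral_mono[OF sqint_integrable[OF s] int]) (use le2 in auto)
  then show "N2 M g \<le> K\<^sup>2 * N2 M f" by (simp add: N2_def)
qed

lemma norm_add_sq_le: "(norm (x + y))\<^sup>2 \<le> 2 * (norm x)\<^sup>2 + 2 * (norm (y::'b::real_normed_vector))\<^sup>2"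
proof -
  have "(norm (x + y))\<^sup>2 \<le> (norm x + norm y)\<^sup>2"
    by (rule power_mono[OF norm_triangle_ineq norm_ge_zero])
  also have "\<dots> \<le> 2 * (norm x)\<^sup>2 + 2 * (norm y)\<^sup>2"
    using zero_le_power2[of "norm x - norm y"] by (simp add: power2_eq_square algebra_simps)
  finally show ?thesis .
qed

lemma sqint_add:
  assumes f: "sqint M f" and g: "sqint M g"
  shows "sqint M (\<lambda>x. f x + g x)" "N2 M (\<lambda>x. f x + g x) \<le> 2 * N2 M f + 2 * N2 M g"
proof -
  have int: "integrable M (\<lambda>x. 2 * (norm (f x))\<^sup>2 + 2 * (norm (g x))\<^sup>2)"
    using f g by (simp add: sqint_def)
  have m: "(\<lambda>x. f x + g x) \<in> borel_measurable M" using f g by measurable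
  have "integrable M (\<lambda>x. (norm (f x + g x))\<^sup>2)"
    by (rule Bochner_Integration.integrable_bound[OF int]) (use m norm_add_sq_le in auto)
  then show s: "sqint M (\<lambda>x. f x + g x)" using m by (simp add: sqint_def)
  have "N2 M (\<lambda>x. f x + g x) \<le> (\<integral>x. 2 * (norm (f x))\<^sup>2 + 2 * (norm (g x))\<^sup>2 \<partial>M)"
    unfolding N2_def by (rule integral_mono[OF sqint_integrable[OF s] int]) (rule norm_add_sq_le)
  also have "\<dots> = 2 * N2 M f + 2 * N2 M g"
    using f g unfolding N2_def sqint_def by (subst Bochner_Integration.integral_add) auto
  finally show "N2 M (\<lambda>x. f x + g x) \<le> 2 * N2 M f + 2 * N2 M g" .
qed

lemma sqint_scaleR:
  assumes "sqint M f"
  shows "sqint M (\<lambda>x. c *\<^sub>R f x)" "N2 M (\<lambda>x. c *\<^sub>R f x) = c\<^sup>2 * N2 M f"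
  using assms by (auto simp: sqint_def N2_def power_mult_distrib)

lemma N2_minus_commute: "N2 M (\<lambda>x. f x - g x) = N2 M (\<lambda>x. g x - f x)"
  by (simp add: N2_def norm_minus_commute)

lemma sqint_diff:
  assumes f: "sqint M f" and g: "sqint M g"
  shows "sqint M (\<lambda>x. f x - g x)" "N2 M (\<lambda>x. f x - g x) \<le> 2 * N2 M f + 2 * N2 M g"
  using sqint_add[OF f sqint_scaleR(1)[OF g, of "-1"]] sqint_scaleR(2)[OF g, of "-1"] by auto

lemma sqint_zero: "sqint M (\<lambda>x. 0)" "N2 M (\<lambda>x. 0) = 0"
  by (auto simp: sqint_def N2_def)

lemma sqint_inner:
  assumes f: "sqint M f" and g: "sqint M g"
  shows "integrable M (\<lambda>x. f x \<bullet> g x)"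
proof -
  have int: "integrable M (\<lambda>x. (norm (f x))\<^sup>2 + (norm (g x))\<^sup>2)"
    using f g by (simp add: sqint_def)
  show ?thesis
  proof (rule Bochner_Integration.integrable_bound[OF int])
    show "(\<lambda>x. f x \<bullet> g x) \<in> borel_measurable M" using f g by measurable
    have "\<bar>f x \<bullet> g x\<bar> \<le> (norm (f x))\<^sup>2 + (norm (g x))\<^sup>2" for x
    proof -
      have "\<bar>f x \<bullet> g x\<bar> \<le> norm (f x) * norm (g x)" by (rule Cauchy_Schwarz_ineq2)
      also have "\<dots> \<le> (norm (f x))\<^sup>2 + (norm (g x))\<^sup>2"
        using zero_le_power2[of "norm (f x) - norm (g x)"] zero_le_power2[of "norm (f x)"]
          zero_le_power2[of "norm (g x)"]
        by (simp only: power2_diff)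
      finally show ?thesis .
    qed
    then show "AE x in M. norm (f x \<bullet> g x) \<le> norm ((norm (f x))\<^sup>2 + (norm (g x))\<^sup>2)" by auto
  qed
qed

lemma N2_add_scaleR:
  assumes f: "sqint M f" and g: "sqint M g"
  shows "N2 M (\<lambda>x. f x + t *\<^sub>R g x) = N2 M f + 2 * t * (\<integral>x. f x \<bullet> g x \<partial>M) + t\<^sup>2 * N2 M g"
proof -
  have "N2 M (\<lambda>x. f x + t *\<^sub>R g x)
      = (\<integral>x. ((norm (f x))\<^sup>2 + (2 * t) * (f x \<bullet> g x)) + t\<^sup>2 * (norm (g x))\<^sup>2 \<partial>M)"
    unfolding N2_def
  proof (rule Bochner_Integration.integral_cong[OF refl])
    show "(norm (f x + t *\<^sub>R g x))\<^sup>2 = ((norm (f x))\<^sup>2 + (2 * t) * (f x \<bullet> g x)) + t\<^sup>2 * (norm (g x))\<^sup>2" for x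
      using dot_norm[of "f x" "t *\<^sub>R g x"] by (simp add: power_mult_distrib field_simps)
  qed
  also have "\<dots> = N2 M f + 2 * t * (\<integral>x. f x \<bullet> g x \<partial>M) + t\<^sup>2 * N2 M g"
    unfolding N2_def using sqint_integrable[OF f] sqint_integrable[OF g] sqint_inner[OF f g]
    by (subst Bochner_Integration.integral_add, simp, simp, subst Bochner_Integration.integral_add, simp_all)
  finally show ?thesis .
qed

text \<open>Evaluate at the minimum \<open>t = - I / B\<close>; for \<open>B = 0\<close> the
  expression is affine in \<open>t\<close> and can stay nonnegative only if \<open>I = 0\<close>.
  Used for Cauchy-Schwarz and, with \<open>A = 0\<close>, to make the first variation vanish in
  \<open>energy_projection\<close>.\<close>

lemma quadratic_nonneg_imp:
  fixes A B I :: real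
  assumes "\<And>t. 0 \<le> A + 2 * t * I + t\<^sup>2 * B" and "0 \<le> B"
  shows "I\<^sup>2 \<le> A * B"
proof (cases "B = 0")
  case True
  show ?thesis
  proof (rule ccontr)
    assume "\<not> ?thesis"
    then have I: "I \<noteq> 0" using True by auto
    have "0 \<le> A + 2 * (-(\<bar>A\<bar> + 1) / I) * I" using assms(1)[of "-(\<bar>A\<bar> + 1) / I"] True by simp
    also have "\<dots> = A - 2 * (\<bar>A\<bar> + 1)" using I by (simp add: field_simps)
    finally show False by (simp add: abs_if split: if_splits)
  qed
next
  case False
  then have B: "B > 0" using assms(2) by simp
  have "0 \<le> A + 2 * (- I / B) * I + (- I / B)\<^sup>2 * B" by (rule assms(1))
  also have "\<dots> = A - I\<^sup>2 / B" using B by (simp add: field_simps power2_eq_square)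
  finally show ?thesis using B by (simp add: field_simps)
qed

lemma L2_Cauchy_Schwarz:
  assumes f: "sqint M f" and g: "sqint M g"
  shows "\<bar>\<integral>x. f x \<bullet> g x \<partial>M\<bar> \<le> sqrt (N2 M f) * sqrt (N2 M g)"
proof -
  have "(\<integral>x. f x \<bullet> g x \<partial>M)\<^sup>2 \<le> N2 M f * N2 M g"
    by (rule quadratic_nonneg_imp) (simp_all only: N2_add_scaleR[OF f g, symmetric] N2_nonneg)
  then have "sqrt ((\<integral>x. f x \<bullet> g x \<partial>M)\<^sup>2) \<le> sqrt (N2 M f * N2 M g)"
    by (rule real_sqrt_le_mono)
  then show ?thesis by (simp add: real_sqrt_mult)
qed

lemma N2_eq_0_iff:
  assumes "sqint M f"
  shows "N2 M f = 0 \<longleftrightarrow> (AE x in M. f x = 0)"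
  unfolding N2_def using integral_nonneg_eq_0_iff_AE[OF sqint_integrable[OF assms]] by auto

subsection \<open>Convergence in mean square\<close>

definition L2lim :: "'x measure \<Rightarrow> (nat \<Rightarrow> 'x \<Rightarrow> 'b::euclidean_space) \<Rightarrow> ('x \<Rightarrow> 'b) \<Rightarrow> bool" where
  "L2lim M f F \<longleftrightarrow> (\<forall>n. sqint M (f n)) \<and> sqint M F \<and> (\<lambda>n. N2 M (\<lambda>x. f n x - F x)) \<longlonglongrightarrow> 0"

lemma L2limD:
  assumes "L2lim M f F"
  shows "\<And>n. sqint M (f n)" "sqint M F" "(\<lambda>n. N2 M (\<lambda>x. f n x - F x)) \<longlonglongrightarrow> 0"
  using assms by (auto simp: L2lim_def)

lemma L2limI_le:
  assumes "\<And>n. sqint M (f n)" "sqint M F" "\<And>n. N2 M (\<lambda>x. f n x - F x) \<le> u n" "u \<longlonglongrightarrow> 0"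
  shows "L2lim M f F"
  unfolding L2lim_def
  using assms by (auto intro!: tendsto_sandwich[OF _ _ tendsto_const assms(4)] always_eventually N2_nonneg)

lemma L2lim_const: "sqint M F \<Longrightarrow> L2lim M (\<lambda>_. F) F"
  by (auto simp: L2lim_def N2_def)

lemma L2lim_add:
  assumes f: "L2lim M f F" and g: "L2lim M g G"
  shows "L2lim M (\<lambda>n x. f n x + g n x) (\<lambda>x. F x + G x)"
proof (rule L2limI_le)
  note f' = L2limD[OF f] and g' = L2limD[OF g]
  show "sqint M (\<lambda>x. f n x + g n x)" for n using f' g' by (intro sqint_add)
  show "sqint M (\<lambda>x. F x + G x)" using f' g' by (intro sqint_add)
  show "N2 M (\<lambda>x. f n x + g n x - (F x + G x)) \<le> 2 * N2 M (\<lambda>x. f n x - F x) + 2 * N2 M (\<lambda>x. g n x - G x)" for n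
    using sqint_add(2)[OF sqint_diff(1)[OF f'(1)[of n] f'(2)] sqint_diff(1)[OF g'(1)[of n] g'(2)]]
    by (simp add: algebra_simps)
  show "(\<lambda>n. 2 * N2 M (\<lambda>x. f n x - F x) + 2 * N2 M (\<lambda>x. g n x - G x)) \<longlonglongrightarrow> 0"
    using tendsto_add[OF tendsto_mult_left[OF f'(3), of 2] tendsto_mult_left[OF g'(3), of 2]] by simp
qed

lemma L2lim_scaleR:
  assumes f: "L2lim M f F"
  shows "L2lim M (\<lambda>n x. c *\<^sub>R f n x) (\<lambda>x. c *\<^sub>R F x)"
proof (rule L2limI_le)
  note f' = L2limD[OF f]
  show "sqint M (\<lambda>x. c *\<^sub>R f n x)" for n using f' by (intro sqint_scaleR)
  show "sqint M (\<lambda>x. c *\<^sub>R F x)" using f' by (intro sqint_scaleR)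
  show "N2 M (\<lambda>x. c *\<^sub>R f n x - c *\<^sub>R F x) \<le> c\<^sup>2 * N2 M (\<lambda>x. f n x - F x)" for n
    using sqint_scaleR(2)[OF sqint_diff(1)[OF f'(1)[of n] f'(2)], of c]
    by (simp add: algebra_simps)
  show "(\<lambda>n. c\<^sup>2 * N2 M (\<lambda>x. f n x - F x)) \<longlonglongrightarrow> 0"
    using tendsto_mult_left[OF f'(3), of "c\<^sup>2"] by simp
qed

lemma L2lim_diff:
  assumes f: "L2lim M f F" and g: "L2lim M g G"
  shows "L2lim M (\<lambda>n x. f n x - g n x) (\<lambda>x. F x - G x)"
  using L2lim_add[OF f L2lim_scaleR[OF g, of "-1"]] by simp

text \<open>Meant for maps that act pointwise and linearly with norm at most \<open>K\<close>: the
  components of a pair, \<open>energy_map\<close>, multiplication by a cutoff.\<close>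

lemma L2lim_bound:
  assumes f: "L2lim M f F"
    and s: "\<And>n. h n \<in> borel_measurable M" "H \<in> borel_measurable M"
    and le: "\<And>n x. x \<in> space M \<Longrightarrow> norm (h n x) \<le> K * norm (f n x)"
      "\<And>x. x \<in> space M \<Longrightarrow> norm (H x) \<le> K * norm (F x)"
      "\<And>n x. x \<in> space M \<Longrightarrow> norm (h n x - H x) \<le> K * norm (f n x - F x)"
  shows "L2lim M h H"
proof (rule L2limI_le)
  note f' = L2limD[OF f]
  show "sqint M (h n)" for n using sqint_bound(1)[OF f'(1) s(1) le(1)] .
  show "sqint M H" using sqint_bound(1)[OF f'(2) s(2) le(2)] .
  show "N2 M (\<lambda>x. h n x - H x) \<le> K\<^sup>2 * N2 M (\<lambda>x. f n x - F x)" for n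
    by (rule sqint_bound(2)[OF sqint_diff(1)[OF f'(1) f'(2)] borel_measurable_diff[OF s(1) s(2)] le(3)])
  show "(\<lambda>n. K\<^sup>2 * N2 M (\<lambda>x. f n x - F x)) \<longlonglongrightarrow> 0"
    using tendsto_mult_left[OF f'(3), of "K\<^sup>2"] by simp
qed

lemma L2lim_inner:
  assumes f: "L2lim M f F" and g: "L2lim M g G"
  shows "(\<lambda>n. \<integral>x. f n x \<bullet> g n x \<partial>M) \<longlonglongrightarrow> (\<integral>x. F x \<bullet> G x \<partial>M)"
proof -
  note f' = L2limD[OF f] and g' = L2limD[OF g]
  let ?a = "\<lambda>n. sqrt (N2 M (\<lambda>x. f n x - F x))" and ?b = "\<lambda>n. sqrt (N2 M (\<lambda>x. g n x - G x))"
  have a: "?a \<longlonglongrightarrow> 0" using tendsto_real_sqrt[OF f'(3)] by simp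
  have b: "?b \<longlonglongrightarrow> 0" using tendsto_real_sqrt[OF g'(3)] by simp
  have le: "norm ((\<integral>x. f n x \<bullet> g n x \<partial>M) - (\<integral>x. F x \<bullet> G x \<partial>M))
      \<le> ?a n * ?b n + ?a n * sqrt (N2 M G) + sqrt (N2 M F) * ?b n" for n
  proof -
    have d: "sqint M (\<lambda>x. f n x - F x)" "sqint M (\<lambda>x. g n x - G x)"
      using f' g' by (auto intro: sqint_diff)
    have "(\<integral>x. f n x \<bullet> g n x \<partial>M) =
        (\<integral>x. (((f n x - F x) \<bullet> (g n x - G x) + (f n x - F x) \<bullet> G x) + F x \<bullet> (g n x - G x)) + F x \<bullet> G x \<partial>M)"
      by (simp add: inner_simps algebra_simps)
    also have "\<dots> = (\<integral>x. (f n x - F x) \<bullet> (g n x - G x) \<partial>M) + (\<integral>x. (f n x - F x) \<bullet> G x \<partial>M)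
        + (\<integral>x. F x \<bullet> (g n x - G x) \<partial>M) + (\<integral>x. F x \<bullet> G x \<partial>M)"
      using d f'(2) g'(2) by (simp add: sqint_inner)
    finally show ?thesis
      using L2_Cauchy_Schwarz[OF d(1) d(2)] L2_Cauchy_Schwarz[OF d(1) g'(2)] L2_Cauchy_Schwarz[OF f'(2) d(2)]
      by simp
  qed
  have "(\<lambda>n. ?a n * ?b n + ?a n * sqrt (N2 M G) + sqrt (N2 M F) * ?b n) \<longlonglongrightarrow> 0 * 0 + 0 * sqrt (N2 M G) + sqrt (N2 M F) * 0"
    by (intro tendsto_intros a b)
  then have z: "(\<lambda>n. ?a n * ?b n + ?a n * sqrt (N2 M G) + sqrt (N2 M F) * ?b n) \<longlonglongrightarrow> 0" by simp
  have "(\<lambda>n. (\<integral>x. f n x \<bullet> g n x \<partial>M) - (\<integral>x. F x \<bullet> G x \<partial>M)) \<longlonglongrightarrow> 0"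
    by (rule Lim_null_comparison[OF always_eventually[OF allI[OF le]] z])
  then show ?thesis by (rule LIM_zero_cancel)
qed

lemma L2lim_N2:
  assumes f: "L2lim M f F"
  shows "(\<lambda>n. N2 M (f n)) \<longlonglongrightarrow> N2 M F"
  using L2lim_inner[OF f f] by (simp add: N2_def power2_norm_eq_inner)

lemma L2_diagonal:
  assumes F: "sqint M F" and ex: "\<And>e. e > 0 \<Longrightarrow> \<exists>f. Q f \<and> sqint M f \<and> N2 M (\<lambda>x. f x - F x) < e"
  shows "\<exists>f. (\<forall>n. Q (f n)) \<and> L2lim M f F"
proof -
  have "\<forall>n. \<exists>f. Q f \<and> sqint M f \<and> N2 M (\<lambda>x. f x - F x) < inverse (real (Suc n))"
    using ex by simp
  then obtain f where f: "\<And>n. Q (f n)" "\<And>n. sqint M (f n)"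
    "\<And>n. N2 M (\<lambda>x. f n x - F x) < inverse (real (Suc n))" by metis
  have "L2lim M f F"
    by (rule L2limI_le[OF f(2) F less_imp_le[OF f(3)] LIMSEQ_inverse_real_of_nat])
  then show ?thesis using f(1) by blast
qed

subsection \<open>Completeness\<close>

lemma sqint_nn_integral:
  assumes "sqint M f"
  shows "(\<integral>\<^sup>+x. ennreal ((norm (f x))\<^sup>2) \<partial>M) = ennreal (N2 M f)"
  unfolding N2_def using sqint_integrable[OF assms] by (intro nn_integral_eq_integral) auto

lemma sqint_nn_integralI:
  assumes "f \<in> borel_measurable M" "(\<integral>\<^sup>+x. ennreal ((norm (f x))\<^sup>2) \<partial>M) \<le> ennreal c" "0 \<le> c"
  shows "sqint M f" "N2 M f \<le> c"
proof -
  have "integrable M (\<lambda>x. (norm (f x))\<^sup>2)"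
    by (rule integrableI_nonneg) (use assms le_less_trans[OF assms(2) ennreal_less_top] in auto)
  then show s: "sqint M f" using assms by (simp add: sqint_def)
  show "N2 M f \<le> c" using assms(2,3) unfolding sqint_nn_integral[OF s] by simp
qed

lemma (in finite_measure) sqint_const: "sqint M (\<lambda>x. c)"
  by (simp add: sqint_def)

lemma (in finite_measure) sqint_norm_integral:
  assumes "sqint M f"
  shows "integrable M (\<lambda>x. norm (f x))"
    "(\<integral>x. norm (f x) \<partial>M) \<le> sqrt (measure M (space M)) * sqrt (N2 M f)"
proof -
  have n: "sqint M (\<lambda>x. norm (f x))" "N2 M (\<lambda>x. norm (f x)) = N2 M f"
    using assms by (auto simp: sqint_def N2_def)
  have one: "N2 M (\<lambda>x. 1::real) = measure M (space M)" by (simp add: N2_def)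
  show "integrable M (\<lambda>x. norm (f x))" using sqint_inner[OF sqint_const n(1), of 1] by simp
  show "(\<integral>x. norm (f x) \<partial>M) \<le> sqrt (measure M (space M)) * sqrt (N2 M f)"
    using L2_Cauchy_Schwarz[OF sqint_const n(1), of 1] one n(2) by simp
qed

text \<open>A rapidly convergent subsequence converges almost everywhere because its increments are
  summable in the mean; Fatou's lemma then identifies the limit in mean square.\<close>
theorem (in finite_measure) L2_complete:
  fixes f :: "nat \<Rightarrow> 'a \<Rightarrow> 'b::euclidean_space"
  assumes s: "\<And>n. sqint M (f n)"
    and Cauchy: "\<And>e. e > 0 \<Longrightarrow> \<exists>N. \<forall>m\<ge>N. \<forall>n\<ge>N. N2 M (\<lambda>x. f m x - f n x) < e"
  shows "\<exists>F. L2lim M f F"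
proof -
  \<comment> \<open>The square root turns \<open>(1/4)^k\<close> into \<open>(1/2)^k\<close>, which
    makes the L1 norms of the increments summable.\<close>
  have "\<forall>k. \<exists>N. \<forall>m\<ge>N. \<forall>n\<ge>N. N2 M (\<lambda>x. f m x - f n x) < (1/4)^k" using Cauchy by simp
  then obtain N where N: "\<And>k m n. m \<ge> N k \<Longrightarrow> n \<ge> N k \<Longrightarrow> N2 M (\<lambda>x. f m x - f n x) < (1/4)^k" by metis
  \<comment> \<open>Partial sums make the selected indices monotone while keeping
    \<open>N k \<le> r k\<close>.\<close>
  define r where "r k = (\<Sum>i\<le>k. N i)" for k
  have rN: "N k \<le> r k" for k unfolding r_def by (rule member_le_sum) auto
  have rS: "r k \<le> r (Suc k)" for k by (simp add: r_def)
  have m: "f n \<in> borel_measurable M" for n using s by (simp add: sqint_def)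
  have d: "sqint M (\<lambda>x. f m x - f n x)" for m n using s by (intro sqint_diff)
  let ?D = "\<lambda>k x. norm (f (r (Suc k)) x - f (r k) x)"
  let ?C = "sqrt (measure M (space M))"
  have L1: "(\<integral>\<^sup>+x. ennreal (?D k x) \<partial>M) \<le> ennreal (?C * (1/2)^k)" for k
  proof -
    have "N2 M (\<lambda>x. f (r (Suc k)) x - f (r k) x) \<le> (1/4)^k"
      using N[OF order.trans[OF rN rS] rN, of k] by simp
    then have "sqrt (N2 M (\<lambda>x. f (r (Suc k)) x - f (r k) x)) \<le> sqrt ((1/4)^k)" by simp
    also have "\<dots> = (1/2)^k" by (simp add: real_sqrt_power real_sqrt_divide)
    finally have "(\<integral>x. ?D k x \<partial>M) \<le> ?C * (1/2)^k"
      using sqint_norm_integral(2)[OF d[of "r (Suc k)" "r k"]]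
      by (meson measure_nonneg mult_left_mono order.trans real_sqrt_ge_zero)
    moreover have "(\<integral>\<^sup>+x. ennreal (?D k x) \<partial>M) = ennreal (\<integral>x. ?D k x \<partial>M)"
      using sqint_norm_integral(1)[OF d] by (intro nn_integral_eq_integral) auto
    ultimately show ?thesis by (simp add: ennreal_leI)
  qed
  have "(\<integral>\<^sup>+x. (\<Sum>k. ennreal (?D k x)) \<partial>M) = (\<Sum>k. \<integral>\<^sup>+x. ennreal (?D k x) \<partial>M)"
    using m by (intro nn_integral_suminf) measurable
  also have "\<dots> \<le> (\<Sum>k. ennreal (?C * (1/2)^k))" by (intro suminf_le L1) auto
  also have "\<dots> = ennreal (\<Sum>k. ?C * (1/2)^k)"
    by (intro suminf_ennreal2) (auto intro!: summable_mult)
  finally have "(\<integral>\<^sup>+x. (\<Sum>k. ennreal (?D k x)) \<partial>M) \<noteq> \<infinity>" by (auto simp: top_unique)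
  then have "AE x in M. (\<Sum>k. ennreal (?D k x)) \<noteq> \<infinity>"
    by (intro nn_integral_PInf_AE) (use m in measurable)
  then have conv: "AE x in M. convergent (\<lambda>k. f (r k) x)"
  proof (rule AE_mp, intro AE_I2 impI)
    fix x assume "(\<Sum>k. ennreal (?D k x)) \<noteq> \<infinity>"
    then have "summable (\<lambda>k. ?D k x)" by (intro summable_suminf_not_top) auto
    then have "summable (\<lambda>k. f (r (Suc k)) x - f (r k) x)" by (rule summable_norm_cancel)
    then have "convergent (\<lambda>n. \<Sum>k<n. f (r (Suc k)) x - f (r k) x)"
      by (simp add: summable_iff_convergent)
    then have "convergent (\<lambda>n. f (r n) x - f (r 0) x)"
      by (simp only: sum_lessThan_telescope[where f="\<lambda>k. f (r k) x"])
    from convergent_add[OF this convergent_const[of "f (r 0) x"]]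
    show "convergent (\<lambda>k. f (r k) x)" by simp
  qed
  define F where "F x = lim (\<lambda>k. f (r k) x)" for x
  have mF: "F \<in> borel_measurable M" unfolding F_def[abs_def] using m by (intro borel_measurable_lim_metric)
  have lim: "AE x in M. (\<lambda>k. f (r k) x) \<longlonglongrightarrow> F x"
    using conv unfolding F_def by (simp add: convergent_LIMSEQ_iff)
  have est: "(\<integral>\<^sup>+x. ennreal ((norm (F x - f n x))\<^sup>2) \<partial>M) \<le> ennreal e"
    if e: "e > 0" and n: "\<And>k. k \<ge> k0 \<Longrightarrow> N2 M (\<lambda>x. f (r k) x - f n x) \<le> e" for n k0 e
  proof -
    have "(\<integral>\<^sup>+x. ennreal ((norm (F x - f n x))\<^sup>2) \<partial>M)
        = (\<integral>\<^sup>+x. liminf (\<lambda>k. ennreal ((norm (f (r k) x - f n x))\<^sup>2)) \<partial>M)"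
    proof (rule nn_integral_cong_AE, rule AE_mp[OF lim], intro AE_I2 impI)
      fix x assume "(\<lambda>k. f (r k) x) \<longlonglongrightarrow> F x"
      then have "(\<lambda>k. ennreal ((norm (f (r k) x - f n x))\<^sup>2)) \<longlonglongrightarrow> ennreal ((norm (F x - f n x))\<^sup>2)"
        by (intro tendsto_intros)
      then show "ennreal ((norm (F x - f n x))\<^sup>2) = liminf (\<lambda>k. ennreal ((norm (f (r k) x - f n x))\<^sup>2))"
        by (rule lim_imp_Liminf[OF trivial_limit_sequentially, symmetric])
    qed
    also have "\<dots> \<le> liminf (\<lambda>k. \<integral>\<^sup>+x. ennreal ((norm (f (r k) x - f n x))\<^sup>2) \<partial>M)"
      using m by (intro nn_integral_liminf) measurable
    also have "\<dots> = liminf (\<lambda>k. ennreal (N2 M (\<lambda>x. f (r k) x - f n x)))"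
      by (simp add: sqint_nn_integral[OF d])
    also have "\<dots> \<le> liminf (\<lambda>k. ennreal e)"
      using n by (intro Liminf_mono eventually_sequentiallyI[of k0]) (auto intro!: ennreal_leI)
    also have "\<dots> = ennreal e" by (simp add: Liminf_const)
    finally show ?thesis .
  qed
  have ev: "\<exists>n0. \<forall>n\<ge>n0. sqint M (\<lambda>x. F x - f n x) \<and> N2 M (\<lambda>x. F x - f n x) \<le> e" if e: "e > 0" for e
  proof -
    obtain N1 where N1: "\<And>m n. m \<ge> N1 \<Longrightarrow> n \<ge> N1 \<Longrightarrow> N2 M (\<lambda>x. f m x - f n x) < e"
      using Cauchy[OF e] by blast
    obtain j :: nat where j: "(1/4)^j < e" using real_arch_pow_inv[OF e, of "1/4"] by auto
    have "N2 M (\<lambda>x. f (r k) x - f n x) \<le> e" if "n \<ge> N j" "k \<ge> j" for n k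
    proof -
      have "mono r" using rS by (simp add: mono_iff_le_Suc)
      then have "r j \<le> r k" using that(2) by (simp add: mono_def)
      then have "N j \<le> r k" using rN[of j] by linarith
      from N[OF this that(1)] j show ?thesis by linarith
    qed
    then have "(\<integral>\<^sup>+x. ennreal ((norm (F x - f n x))\<^sup>2) \<partial>M) \<le> ennreal e" if "n \<ge> N j" for n
      using est[OF e] that by blast
    moreover have "(\<lambda>x. F x - f n x) \<in> borel_measurable M" for n using mF m by measurable
    ultimately show ?thesis using sqint_nn_integralI[OF _ _ less_imp_le[OF e]] by blast
  qed
  obtain n0 where "sqint M (\<lambda>x. F x - f n0 x)" using ev[of 1] by auto
  from sqint_add(1)[OF this s[of n0]] have sF: "sqint M F" by simp
  have "(\<lambda>n. N2 M (\<lambda>x. f n x - F x)) \<longlonglongrightarrow> 0"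
  proof (rule LIMSEQ_I)
    fix e :: real assume "e > 0"
    then obtain n0 where n0: "\<forall>n\<ge>n0. N2 M (\<lambda>x. F x - f n x) \<le> e / 2" using ev[of "e/2"] by auto
    have "norm (N2 M (\<lambda>x. f n x - F x) - 0) < e" if "n \<ge> n0" for n
    proof -
      have "N2 M (\<lambda>x. F x - f n x) \<le> e / 2" using n0 that by blast
      then show ?thesis
        using \<open>e > 0\<close> N2_minus_commute[of M "f n" F] N2_nonneg[of M "\<lambda>x. f n x - F x"] by simp
    qed
    then show "\<exists>n0. \<forall>n\<ge>n0. norm (N2 M (\<lambda>x. f n x - F x) - 0) < e" by blast
  qed
  then show ?thesis using s sF by (auto simp: L2lim_def)
qed

section \<open>Compactly supported C1 functions\<close>

definition C1 :: "('a::euclidean_space \<Rightarrow> real) \<Rightarrow> ('a \<Rightarrow> 'a) \<Rightarrow> bool" where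
  "C1 \<phi> g \<longleftrightarrow> (\<forall>x. (\<phi> has_derivative (\<lambda>h. g x \<bullet> h)) (at x)) \<and> continuous_on UNIV g"

lemma C1c_iff: "C1c \<phi> g \<longleftrightarrow> C1 \<phi> g \<and> compact (tsupp \<phi>)"
  by (auto simp: C1c_def C1_def)

lemma C1_continuous:
  assumes "C1 \<phi> g"
  shows "continuous_on UNIV \<phi>" "continuous_on UNIV g"
  using assms by (auto simp: C1_def continuous_on_eq_continuous_at intro: has_derivative_continuous)

lemma C1_const: "C1 (\<lambda>_. c) (\<lambda>_. 0)"
  by (auto simp: C1_def)

lemma C1_add: "C1 \<phi> g \<Longrightarrow> C1 \<psi> h \<Longrightarrow> C1 (\<lambda>x. \<phi> x + \<psi> x) (\<lambda>x. g x + h x)"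
  by (auto simp: C1_def inner_add_left intro!: derivative_eq_intros continuous_intros)

lemma C1_scale: "C1 \<phi> g \<Longrightarrow> C1 (\<lambda>x. c * \<phi> x) (\<lambda>x. c *\<^sub>R g x)"
  by (auto simp: C1_def intro!: derivative_eq_intros continuous_intros)

lemma C1_sum: "(\<And>i. i \<in> I \<Longrightarrow> C1 (\<phi> i) (g i)) \<Longrightarrow> C1 (\<lambda>x. \<Sum>i\<in>I. \<phi> i x) (\<lambda>x. \<Sum>i\<in>I. g i x)"
  by (induction I rule: infinite_finite_induct) (auto intro!: C1_add C1_const)

lemma C1_mult:
  assumes "C1 \<phi> g" "C1 \<psi> h"
  shows "C1 (\<lambda>x. \<phi> x * \<psi> x) (\<lambda>x. \<phi> x *\<^sub>R h x + \<psi> x *\<^sub>R g x)"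
  using assms C1_continuous[OF assms(1)] C1_continuous[OF assms(2)]
  by (auto simp: C1_def inner_add_left algebra_simps intro!: derivative_eq_intros continuous_intros)

lemma C1_compose:
  assumes \<phi>: "C1 \<phi> g" and s: "\<And>t. (s has_real_derivative s' t) (at t)" and s': "continuous_on UNIV s'"
  shows "C1 (\<lambda>x. s (\<phi> x)) (\<lambda>x. s' (\<phi> x) *\<^sub>R g x)"
proof -
  have "((\<lambda>x. s (\<phi> x)) has_derivative (\<lambda>h. s' (\<phi> x) *\<^sub>R g x \<bullet> h)) (at x)" for x
  proof -
    have 1: "(\<phi> has_derivative (\<lambda>h. g x \<bullet> h)) (at x)" using \<phi> by (simp add: C1_def)
    have 2: "(s has_derivative (\<lambda>t. s' (\<phi> x) * t)) (at (\<phi> x))"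
      using s by (simp add: has_field_derivative_def)
    show ?thesis using has_derivative_compose[OF 1 2] by simp
  qed
  moreover have "continuous_on UNIV (\<lambda>x. s' (\<phi> x) *\<^sub>R g x)"
    using C1_continuous[OF \<phi>] continuous_on_subset[OF s', of "range \<phi>"]
    by (intro continuous_intros continuous_on_compose2[OF s']) auto
  ultimately show ?thesis by (simp add: C1_def)
qed

lemma closed_tsupp: "closed (tsupp \<phi>)"
  by (simp add: tsupp_def)

lemma tsupp_subset_closed: "closed C \<Longrightarrow> (\<And>x. x \<notin> C \<Longrightarrow> \<phi> x = 0) \<Longrightarrow> tsupp \<phi> \<subseteq> C"
  unfolding tsupp_def by (rule closure_minimal) auto

text \<open>Turns support conditions into statements that hold near a point, which combine directly
  under sums and products.\<close>

lemma not_in_tsupp_iff: "x \<notin> tsupp \<phi> \<longleftrightarrow> eventually (\<lambda>y. \<phi> y = 0) (nhds x)"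
proof
  assume "x \<notin> tsupp \<phi>"
  then have "x \<in> - tsupp \<phi>" "open (- tsupp \<phi>)" by (auto simp: tsupp_def)
  moreover have "\<forall>y\<in>- tsupp \<phi>. \<phi> y = 0" using closure_subset[of "{x. \<phi> x \<noteq> 0}"] by (auto simp: tsupp_def)
  ultimately show "eventually (\<lambda>y. \<phi> y = 0) (nhds x)" unfolding eventually_nhds by blast
next
  assume "eventually (\<lambda>y. \<phi> y = 0) (nhds x)"
  then obtain S where "open S" "x \<in> S" "\<forall>y\<in>S. \<phi> y = 0" unfolding eventually_nhds by blast
  then show "x \<notin> tsupp \<phi>" using tsupp_subset_closed[of "- S" \<phi>] by (auto simp: closed_def)
qed

lemma outside_tsupp: "x \<notin> tsupp \<phi> \<Longrightarrow> \<phi> x = 0"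
  using eventually_nhds_x_imp_x not_in_tsupp_iff by metis

lemma C1_outside_tsupp:
  assumes "C1 \<phi> g" "x \<notin> tsupp \<phi>"
  shows "g x = 0"
proof -
  have "(\<phi> has_derivative (\<lambda>h. g x \<bullet> h)) (at x)" using assms by (simp add: C1_def)
  moreover have "(\<phi> has_derivative (\<lambda>h. 0)) (at x)"
  proof (rule has_derivative_transform_eventually[of "\<lambda>_. 0"])
    show "\<forall>\<^sub>F y in at x. 0 = \<phi> y"
      using assms(2) unfolding not_in_tsupp_iff eventually_at_filter by (auto elim: eventually_mono)
  qed (use outside_tsupp[OF assms(2)] in auto)
  ultimately have "(\<lambda>h. g x \<bullet> h) = (\<lambda>h. 0)" by (rule has_derivative_unique)
  then show ?thesis by (metis inner_eq_zero_iff)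
qed

lemma C1c_outside_tsupp: "C1c \<phi> g \<Longrightarrow> x \<notin> tsupp \<phi> \<Longrightarrow> \<phi> x = 0 \<and> g x = 0"
  using C1_outside_tsupp outside_tsupp unfolding C1c_iff by metis

lemma tsupp_add: "tsupp (\<lambda>x. \<phi> x + \<psi> x) \<subseteq> tsupp \<phi> \<union> tsupp \<psi>"
  by (rule tsupp_subset_closed) (auto simp: outside_tsupp closed_tsupp)

lemma tsupp_mult: "tsupp (\<lambda>x. \<phi> x * \<psi> x) \<subseteq> tsupp \<phi> \<inter> tsupp \<psi>"
  by (rule tsupp_subset_closed) (auto simp: outside_tsupp closed_tsupp)

lemma tsupp_scale: "tsupp (\<lambda>x. c * \<phi> x) \<subseteq> tsupp \<phi>"
  by (rule tsupp_subset_closed) (auto simp: outside_tsupp closed_tsupp)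

lemma compact_tsupp_subset: "tsupp \<psi> \<subseteq> C \<Longrightarrow> compact C \<Longrightarrow> compact (tsupp \<psi>)"
  by (metis closed_Int_compact closed_closure inf.absorb1 tsupp_def)

lemma C1c_zero: "C1c (\<lambda>_. 0) (\<lambda>_. 0)"
  by (auto simp: C1c_iff C1_const tsupp_def)

lemma tsupp_zero: "tsupp (\<lambda>_. 0) = {}"
  by (simp add: tsupp_def)

lemma C1c_add: "C1c \<phi> g \<Longrightarrow> C1c \<psi> h \<Longrightarrow> C1c (\<lambda>x. \<phi> x + \<psi> x) (\<lambda>x. g x + h x)"
  unfolding C1c_iff by (auto intro!: C1_add compact_tsupp_subset[OF tsupp_add])

lemma C1c_scale: "C1c \<phi> g \<Longrightarrow> C1c (\<lambda>x. c * \<phi> x) (\<lambda>x. c *\<^sub>R g x)"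
  unfolding C1c_iff by (auto intro!: C1_scale compact_tsupp_subset[OF tsupp_scale])

lemma C1c_mult:
  "C1 \<eta> h \<Longrightarrow> C1c \<phi> g \<Longrightarrow> C1c (\<lambda>x. \<eta> x * \<phi> x) (\<lambda>x. \<eta> x *\<^sub>R g x + \<phi> x *\<^sub>R h x)"
  unfolding C1c_iff using tsupp_mult[of \<eta> \<phi>] by (auto intro!: C1_mult compact_tsupp_subset[of _ "tsupp \<phi>"])

lemma C1c_bounded:
  assumes "C1c \<phi> g"
  shows "\<exists>B>0. \<forall>x. \<bar>\<phi> x\<bar> \<le> B \<and> norm (g x) \<le> B"
proof -
  have c: "C1 \<phi> g" "compact (tsupp \<phi>)" using assms by (auto simp: C1c_iff)
  have "bounded (\<phi> ` tsupp \<phi>)" "bounded (g ` tsupp \<phi>)"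
    using C1_continuous[OF c(1)] c(2)
    by (auto intro!: compact_imp_bounded compact_continuous_image intro: continuous_on_subset)
  then obtain A B where AB: "\<And>x. x \<in> tsupp \<phi> \<Longrightarrow> \<bar>\<phi> x\<bar> \<le> A" "\<And>x. x \<in> tsupp \<phi> \<Longrightarrow> norm (g x) \<le> B"
    unfolding bounded_iff by auto
  have "\<bar>\<phi> x\<bar> \<le> \<bar>A\<bar> + \<bar>B\<bar> + 1 \<and> norm (g x) \<le> \<bar>A\<bar> + \<bar>B\<bar> + 1" for x
    using C1c_outside_tsupp[OF assms, of x] AB[of x] by (cases "x \<in> tsupp \<phi>") auto
  then show ?thesis by (intro exI[of _ "\<bar>A\<bar> + \<bar>B\<bar> + 1"]) auto
qed

text \<open>Near a point of \<open>frontier U\<close> the function already vanishes, so truncation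
  creates no new singularity. This is how a test function that avoids a frontier is extended by zero
  across it.\<close>

lemma C1c_cut:
  assumes \<phi>: "C1c \<phi> g" and U: "open U" and disj: "tsupp \<phi> \<inter> frontier U = {}"
  shows "C1c (\<lambda>x. if x \<in> U then \<phi> x else 0) (\<lambda>x. if x \<in> U then g x else 0)"
    "tsupp (\<lambda>x. if x \<in> U then \<phi> x else 0) \<subseteq> U \<inter> tsupp \<phi>"
proof -
  let ?f = "\<lambda>x. if x \<in> U then \<phi> x else 0" and ?g = "\<lambda>x. if x \<in> U then g x else 0"
  have C: "C1 \<phi> g" "compact (tsupp \<phi>)" using \<phi> by (auto simp: C1c_iff)
  have "(?f has_derivative (\<lambda>h. ?g x \<bullet> h)) (at x) \<and> isCont ?g x" for x
  proof -
    consider "x \<in> U" | "x \<notin> closure U" | "x \<in> frontier U" using U by (auto simp: frontier_def interior_open)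
    then show ?thesis
    proof cases
      case 1
      then have ev: "\<forall>\<^sub>F y in nhds x. y \<in> U" using U eventually_nhds by blast
      have "(?f has_derivative (\<lambda>h. g x \<bullet> h)) (at x)"
        by (rule has_derivative_transform_within_open[of \<phi> _ x UNIV U])
          (use C U 1 in \<open>auto simp: C1_def\<close>)
      moreover have "isCont ?g x \<longleftrightarrow> isCont g x"
        by (rule isCont_cong) (use ev in eventually_elim, simp)
      ultimately show ?thesis
        using 1 C1_continuous[OF C(1)] by (simp add: continuous_on_eq_continuous_at)
    next
      case 2
      then have O: "x \<in> - closure U" "open (- closure U)" by auto
      have sub: "y \<notin> U" if "y \<in> - closure U" for y using that closure_subset by blast
      have ev: "\<forall>\<^sub>F y in nhds x. y \<in> - closure U" using O eventually_nhds by blast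
      have "(?f has_derivative (\<lambda>h. 0)) (at x)"
        by (rule has_derivative_transform_within_open[of "\<lambda>_. 0" _ x UNIV "- closure U"])
          (use O sub in auto)
      moreover have "isCont ?g x \<longleftrightarrow> isCont (\<lambda>_. 0::'a) x"
        by (rule isCont_cong) (use ev in eventually_elim, use sub in simp)
      ultimately show ?thesis using sub[OF O(1)] by simp
    next
      case 3
      then have O: "x \<in> - tsupp \<phi>" "open (- tsupp \<phi>)" "x \<notin> U"
        using disj U by (auto simp: tsupp_def frontier_def interior_open)
      have z: "\<phi> y = 0 \<and> g y = 0" if "y \<in> - tsupp \<phi>" for y using C1c_outside_tsupp[OF \<phi>] that by simp
      have ev: "\<forall>\<^sub>F y in nhds x. y \<in> - tsupp \<phi>" using O eventually_nhds by blast
      have "(?f has_derivative (\<lambda>h. 0)) (at x)"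
        by (rule has_derivative_transform_within_open[of "\<lambda>_. 0" _ x UNIV "- tsupp \<phi>"])
          (use O z in auto)
      moreover have "isCont ?g x \<longleftrightarrow> isCont (\<lambda>_. 0::'a) x"
        by (rule isCont_cong) (use ev in eventually_elim, use z in simp)
      ultimately show ?thesis using O(3) by simp
    qed
  qed
  then have c1: "C1 ?f ?g" by (simp add: C1_def continuous_on_eq_continuous_at)
  have "closed (closure U \<inter> tsupp \<phi>)" by (simp add: closed_tsupp closed_Int)
  moreover have "closure U \<inter> tsupp \<phi> = U \<inter> tsupp \<phi>"
    using disj U closure_subset by (auto simp: frontier_def interior_open)
  ultimately have cl: "closed (U \<inter> tsupp \<phi>)" by simp
  show sub: "tsupp ?f \<subseteq> U \<inter> tsupp \<phi>"
    by (rule tsupp_subset_closed[OF cl]) (auto simp: outside_tsupp)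
  show "C1c ?f ?g" using c1 C(2) compact_tsupp_subset[of ?f "tsupp \<phi>"] sub by (auto simp: C1c_iff)
qed

subsection \<open>Cutoff functions\<close>

text \<open>Squaring removes the kink of \<open>max 0\<close> at the origin; all cutoffs below are
  built from this C1 profile.\<close>

lemma has_derivative_max0_squared: "((\<lambda>t::real. (max 0 t)\<^sup>2) has_real_derivative 2 * max 0 t) (at t)"
proof -
  consider "t > 0" | "t < 0" | "t = 0" by linarith
  then show ?thesis
  proof cases
    case 1
    have "((\<lambda>t::real. t\<^sup>2) has_real_derivative 2 * max 0 t) (at t)"
      using 1 by (auto intro!: derivative_eq_intros)
    then show ?thesis
      by (rule has_field_derivative_transform_within_open[of _ _ _ "{0<..}"]) (use 1 in auto)
  next
    case 2
    have "((\<lambda>t::real. 0) has_real_derivative 2 * max 0 t) (at t)"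
      using 2 by (auto intro!: derivative_eq_intros)
    then show ?thesis
      by (rule has_field_derivative_transform_within_open[of _ _ _ "{..<0}"]) (use 2 in auto)
  next
    case 3
    have "(\<lambda>h::real. ((max 0 h)\<^sup>2) / h) \<midarrow>0\<rightarrow> 0"
    proof (rule Lim_null_comparison[of _ "\<lambda>h. \<bar>h\<bar>"])
      show "\<forall>\<^sub>F h::real in at 0. norm ((max 0 h)\<^sup>2 / h) \<le> \<bar>h\<bar>"
        by (auto intro!: always_eventually simp: max_def power2_eq_square)
      show "(\<lambda>h::real. \<bar>h\<bar>) \<midarrow>0\<rightarrow> 0" using tendsto_rabs_zero[OF tendsto_ident_at] by simp
    qed
    then show ?thesis using 3 by (simp add: DERIV_def)
  qed
qed

text \<open>The outer square makes the derivative vanish on the sphere of radius \<open>r\<close>,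
  which gives C1 regularity with a gradient of size \<open>4 / r\<close>.\<close>

definition bump :: "'a::euclidean_space \<Rightarrow> real \<Rightarrow> 'a \<Rightarrow> real" where
  "bump p r x = (max 0 (1 - (norm (x - p))\<^sup>2 / r\<^sup>2))\<^sup>2"

definition bump_grad :: "'a::euclidean_space \<Rightarrow> real \<Rightarrow> 'a \<Rightarrow> 'a" where
  "bump_grad p r x = (2 * max 0 (1 - (norm (x - p))\<^sup>2 / r\<^sup>2)) *\<^sub>R ((- 2 / r\<^sup>2) *\<^sub>R (x - p))"

lemma C1_bump: "C1 (bump p r) (bump_grad p r)"
proof -
  have "((\<lambda>x. (x - p) \<bullet> (x - p)) has_derivative (\<lambda>h. (2 *\<^sub>R (x - p)) \<bullet> h)) (at x)" for x
    by (auto intro!: derivative_eq_intros simp: inner_commute)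
  then have "C1 (\<lambda>x. (x - p) \<bullet> (x - p)) (\<lambda>x. 2 *\<^sub>R (x - p))"
    by (auto simp: C1_def intro!: continuous_intros)
  from C1_add[OF C1_const[of 1] C1_scale[OF this, of "- 1 / r\<^sup>2"]]
  have "C1 (\<lambda>x. 1 - (norm (x - p))\<^sup>2 / r\<^sup>2) (\<lambda>x. (- 2 / r\<^sup>2) *\<^sub>R (x - p))"
    by (simp add: power2_norm_eq_inner)
  from C1_compose[OF this has_derivative_max0_squared]
  show ?thesis unfolding bump_def bump_grad_def by (simp add: continuous_intros)
qed

lemma bump_bounds:
  assumes r: "r > 0"
  shows "0 \<le> bump p r x" "norm (x - p) < r / 2 \<Longrightarrow> 1 / 2 \<le> bump p r x"
    "norm (x - p) \<ge> r \<Longrightarrow> bump p r x = 0 \<and> bump_grad p r x = 0" "norm (bump_grad p r x) \<le> 4 / r"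
proof -
  show "0 \<le> bump p r x" by (simp add: bump_def)
  { assume "norm (x - p) < r / 2"
    then have "(norm (x - p))\<^sup>2 \<le> (r / 2)\<^sup>2" by (intro power_mono) auto
    then have "3 / 4 \<le> 1 - (norm (x - p))\<^sup>2 / r\<^sup>2" using r by (simp add: field_simps power2_eq_square)
    from power_mono[OF order.trans[OF this max.cobounded2], of 2 0]
    have "(3 / 4)\<^sup>2 \<le> bump p r x" by (simp only: bump_def)
    moreover have "1 / 2 \<le> (3 / 4 :: real)\<^sup>2" by (simp add: power2_eq_square)
    ultimately show "1 / 2 \<le> bump p r x" by linarith }
  { assume "norm (x - p) \<ge> r"
    then have "r\<^sup>2 \<le> (norm (x - p))\<^sup>2" using r by (intro power_mono) auto
    then have "1 - (norm (x - p))\<^sup>2 / r\<^sup>2 \<le> 0" using r by (simp add: field_simps)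
    then show "bump p r x = 0 \<and> bump_grad p r x = 0" by (simp add: bump_def bump_grad_def) }
  note out = this
  show "norm (bump_grad p r x) \<le> 4 / r"
  proof (cases "norm (x - p) \<ge> r")
    case True then show ?thesis using out r by simp
  next
    case False
    have "norm (bump_grad p r x) = (2 * max 0 (1 - (norm (x - p))\<^sup>2 / r\<^sup>2)) * (2 / r\<^sup>2 * norm (x - p))"
      by (simp add: bump_grad_def abs_mult)
    also have "\<dots> \<le> (2 * 1) * (2 / r\<^sup>2 * r)"
      using False r by (intro mult_mono mult_nonneg_nonneg) auto
    also have "\<dots> = 4 / r" using r by (simp add: power2_eq_square)
    finally show ?thesis .
  qed
qed

text \<open>It reaches the value 1 already at \<open>1 / 2\<close> and has slope at most 4 on the
  nonnegative axis, so every sum of bumps that is at least \<open>1 / 2\<close> is sent to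
  1.\<close>

definition smoothstep :: "real \<Rightarrow> real" where
  "smoothstep t = 1 - (max 0 (1 - 2 * t))\<^sup>2"

lemma smoothstep:
  "(smoothstep has_real_derivative 4 * max 0 (1 - 2 * t)) (at t)"
  "t \<ge> 1 / 2 \<Longrightarrow> smoothstep t = 1" "smoothstep 0 = 0"
  "t \<ge> 0 \<Longrightarrow> 0 \<le> smoothstep t" "smoothstep t \<le> 1" "t \<ge> 0 \<Longrightarrow> 4 * max 0 (1 - 2 * t) \<le> 4"
proof -
  have "((\<lambda>t. 1 - 2 * t) has_real_derivative - 2) (at t)" by (auto intro!: derivative_eq_intros)
  from DERIV_chain2[OF has_derivative_max0_squared this]
  have "((\<lambda>t. (max 0 (1 - 2 * t))\<^sup>2) has_real_derivative 2 * max 0 (1 - 2 * t) * (- 2)) (at t)" .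
  then show "(smoothstep has_real_derivative 4 * max 0 (1 - 2 * t)) (at t)"
    using DERIV_diff[OF DERIV_const[of 1]] unfolding smoothstep_def[abs_def] by fastforce
  show "0 \<le> smoothstep t" if "t \<ge> 0"
  proof -
    have "(max 0 (1 - 2 * t))\<^sup>2 \<le> 1\<^sup>2" using that by (intro power_mono) auto
    then show ?thesis by (simp add: smoothstep_def)
  qed
qed (auto simp: smoothstep_def)

text \<open>The cutoff is \<open>smoothstep\<close> of the sum of the bumps. At any point at most
  \<open>N\<close> bumps have a nonzero gradient, each of size at most \<open>4 / r\<close>, and
  \<open>smoothstep\<close> contributes a factor 4: hence \<open>16 * N / r\<close>. What matters is
  the overlap \<open>N\<close>, not the number of points.\<close>

lemma cutoff_near_finite_set:
  assumes P: "finite P" and r: "r > 0" and N: "\<And>x. card {p\<in>P. norm (x - p) < r} \<le> N"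
  shows "\<exists>\<eta> h. C1c \<eta> h \<and> (\<forall>x. 0 \<le> \<eta> x \<and> \<eta> x \<le> 1) \<and> (\<forall>x. norm (h x) \<le> 16 * real N / r)
    \<and> (\<forall>x\<in>(\<Union>p\<in>P. ball p (r/2)). \<eta> x = 1) \<and> (\<forall>x. x \<notin> (\<Union>p\<in>P. ball p r) \<longrightarrow> \<eta> x = 0 \<and> h x = 0)
    \<and> tsupp \<eta> \<subseteq> (\<Union>p\<in>P. cball p r)"
proof -
  define S where "S x = (\<Sum>p\<in>P. bump p r x)" for x
  define G where "G x = (\<Sum>p\<in>P. bump_grad p r x)" for x
  define \<eta> where "\<eta> x = smoothstep (S x)" for x
  define h where "h x = (4 * max 0 (1 - 2 * S x)) *\<^sub>R G x" for x
  have "C1 S G" unfolding S_def[abs_def] G_def[abs_def] by (intro C1_sum C1_bump)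
  from C1_compose[OF this smoothstep(1)] have c1: "C1 \<eta> h"
    unfolding \<eta>_def[abs_def] h_def[abs_def] by (simp add: continuous_intros)
  have S0: "0 \<le> S x" for x unfolding S_def by (intro sum_nonneg bump_bounds(1) r)
  have out: "\<eta> x = 0 \<and> h x = 0" if "x \<notin> (\<Union>p\<in>P. ball p r)" for x
  proof -
    have "bump p r x = 0 \<and> bump_grad p r x = 0" if "p \<in> P" for p
      using bump_bounds(3)[OF r, of x p] that \<open>x \<notin> _\<close> by (auto simp: dist_norm norm_minus_commute not_less)
    then have "S x = 0" "G x = 0" unfolding S_def G_def by (auto intro: sum.neutral)
    then show ?thesis by (simp add: \<eta>_def h_def smoothstep)
  qed
  have sup: "tsupp \<eta> \<subseteq> (\<Union>p\<in>P. cball p r)"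
  proof (rule tsupp_subset_closed)
    show "closed (\<Union>p\<in>P. cball p r)" using P by (intro closed_UN) auto
    show "\<eta> x = 0" if "x \<notin> (\<Union>p\<in>P. cball p r)" for x
    proof -
      have "x \<notin> (\<Union>p\<in>P. ball p r)" using that ball_subset_cball by blast
      then show ?thesis using out by blast
    qed
  qed
  then have "C1c \<eta> h" using c1 P by (auto simp: C1c_iff intro!: compact_tsupp_subset[of _ "\<Union>p\<in>P. cball p r"])
  moreover have "\<eta> x = 1" if x: "x \<in> (\<Union>p\<in>P. ball p (r/2))" for x
  proof -
    obtain p where p: "p \<in> P" "x \<in> ball p (r / 2)" using x by blast
    then have px: "norm (x - p) < r / 2" by (simp add: dist_norm norm_minus_commute[of x p])
    have "1 / 2 \<le> bump p r x" by (rule bump_bounds(2)[OF r px])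
    also have "\<dots> \<le> S x" unfolding S_def by (rule member_le_sum) (use p P bump_bounds(1)[OF r] in auto)
    finally show ?thesis by (simp add: \<eta>_def smoothstep)
  qed
  moreover have "norm (h x) \<le> 16 * real N / r" for x
  proof -
    have "G x = (\<Sum>p\<in>{p\<in>P. norm (x - p) < r}. bump_grad p r x)"
      unfolding G_def by (rule sum.mono_neutral_right) (use P bump_bounds(3)[OF r, of x] in \<open>auto simp: not_less\<close>)
    also have "norm \<dots> \<le> real (card {p\<in>P. norm (x - p) < r}) * (4 / r)"
      by (rule sum_norm_bound) (rule bump_bounds(4)[OF r])
    also have "\<dots> \<le> real N * (4 / r)" using N r by (intro mult_right_mono) auto
    finally have "norm (G x) \<le> real N * (4 / r)" .
    moreover have "norm (h x) = (4 * max 0 (1 - 2 * S x)) * norm (G x)" by (simp add: h_def)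
    ultimately have "norm (h x) \<le> 4 * (real N * (4 / r))"
      using smoothstep(6)[OF S0[of x]] by (simp only:) (intro mult_mono; simp)
    then show ?thesis by simp
  qed
  ultimately show ?thesis using out sup S0 smoothstep(4,5) by (intro exI[of _ \<eta>] exI[of _ h]) (auto simp: \<eta>_def)
qed

text \<open>The plateau is an open set \<open>V\<close> and not just \<open>K\<close>: a function
  multiplied by the cutoff is then unchanged in a neighbourhood of \<open>K\<close>, so that its
  support near \<open>K\<close> is unchanged too.\<close>

lemma cutoff_compact_open:
  assumes K: "compact K" and U: "open U" and KU: "K \<subseteq> U"
  shows "\<exists>\<eta> h V. C1c \<eta> h \<and> (\<forall>x. 0 \<le> \<eta> x \<and> \<eta> x \<le> 1) \<and> tsupp \<eta> \<subseteq> U \<and> open V \<and> K \<subseteq> V \<and> (\<forall>x\<in>V. \<eta> x = 1)"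
proof -
  obtain r where r: "r > 0" "(\<Union>x\<in>K. cball x r) \<subseteq> U"
    using compact_subset_open_imp_cball_epsilon_subset[OF K U KU] by blast
  obtain P where P: "P \<subseteq> K" "finite P" "K \<subseteq> (\<Union>p\<in>P. ball p (r/2))"
    using compactE_image[OF K, of K "\<lambda>p. ball p (r/2)"] r(1) by force
  obtain \<eta> h where "C1c \<eta> h" "\<forall>x. 0 \<le> \<eta> x \<and> \<eta> x \<le> 1"
    "\<forall>x\<in>(\<Union>p\<in>P. ball p (r/2)). \<eta> x = 1" "tsupp \<eta> \<subseteq> (\<Union>p\<in>P. cball p r)"
    using cutoff_near_finite_set[OF P(2) r(1), of "card P"] card_mono[OF P(2), of "{p\<in>P. norm (_ - p) < r}"] by blast
  moreover have "(\<Union>p\<in>P. cball p r) \<subseteq> U" using P(1) r(2) by blast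
  ultimately show ?thesis using P by (intro exI[of _ \<eta>] exI[of _ h] exI[of _ "\<Union>p\<in>P. ball p (r/2)"]) auto
qed

subsection \<open>Integration by parts\<close>

text \<open>Difference quotients have integral zero because Lebesgue measure is translation
  invariant. They are bounded through the mean value inequality, and dominated convergence passes to
  the derivative.\<close>

lemma C1c_integral_grad_zero:
  assumes \<phi>: "C1c \<phi> g"
  shows "integrable lborel g" "(\<integral>x. g x \<partial>lborel) = 0"
proof -
  have C: "C1 \<phi> g" "compact (tsupp \<phi>)" using \<phi> by (auto simp: C1c_iff)
  have mg: "g \<in> borel_measurable borel" and m\<phi>: "\<phi> \<in> borel_measurable borel"
    using C1_continuous[OF C(1)] by (auto intro: borel_measurable_continuous_onI)
  obtain B where B: "B > 0" "\<And>x. \<bar>\<phi> x\<bar> \<le> B" "\<And>x. norm (g x) \<le> B" using C1c_bounded[OF \<phi>] by blast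
  have dom: "integrable lborel (\<lambda>x. B' * indicator S x :: real)" if "compact S" for S :: "'a set" and B'
    using that emeasure_compact_finite[OF that]
    by (intro integrable_mult_right) (auto simp: integrable_indicator_iff borel_compact)
  have bd: "norm (g x) \<le> norm (B * indicator (tsupp \<phi>) x :: real)" for x
    using B C1c_outside_tsupp[OF \<phi>, of x] by (auto simp: indicator_def)
  show int: "integrable lborel g"
    by (rule Bochner_Integration.integrable_bound[OF dom[OF C(2), of B]]) (use mg bd in auto)
  have int\<phi>: "integrable lborel \<phi>"
    by (rule Bochner_Integration.integrable_bound[OF dom[OF C(2), of B]])
      (use m\<phi> B C1c_outside_tsupp[OF \<phi>] in \<open>auto simp: indicator_def\<close>)
  have "(\<integral>x. g x \<partial>lborel) \<bullet> v = 0" if v: "v \<in> Basis" for v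
  proof -
    let ?q = "\<lambda>n x. (\<phi> (x + inverse (real (Suc n)) *\<^sub>R v) - \<phi> x) / inverse (real (Suc n))"
    have q0: "(\<integral>x. ?q n x \<partial>lborel) = 0" for n
    proof -
      let ?t = "inverse (real (Suc n)) *\<^sub>R v"
      have "integrable (distr lborel borel ((+) ?t)) \<phi>" using int\<phi> by (simp add: lborel_distr_plus)
      then have 1: "integrable lborel (\<lambda>x. \<phi> (x + ?t))"
        by (subst (asm) integrable_distr_eq) (use m\<phi> in \<open>auto simp: add.commute\<close>)
      have "(\<integral>x. \<phi> x \<partial>distr lborel borel ((+) ?t)) = (\<integral>x. \<phi> (x + ?t) \<partial>lborel)"
        by (subst integral_distr) (use m\<phi> in \<open>auto simp: add.commute\<close>)
      then have "(\<integral>x. \<phi> (x + ?t) \<partial>lborel) = (\<integral>x. \<phi> x \<partial>lborel)" by (simp add: lborel_distr_plus)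
      then show ?thesis using 1 int\<phi> by simp
    qed
    \<comment> \<open>All shifts have length at most 1, so every difference quotient vanishes off
      this neighbourhood of the support.\<close>
    let ?S = "{x + y |x y. x \<in> tsupp \<phi> \<and> y \<in> cball 0 1}"
    have cS: "compact ?S" by (rule compact_sums[OF C(2) compact_cball])
    have "(\<lambda>n. \<integral>x. ?q n x \<partial>lborel) \<longlonglongrightarrow> (\<integral>x. g x \<bullet> v \<partial>lborel)"
    proof (rule integral_dominated_convergence[OF _ _ dom[OF cS, of B]])
      show "(\<lambda>x. g x \<bullet> v) \<in> borel_measurable lborel" using mg by simp
      show "?q n \<in> borel_measurable lborel" for n using m\<phi> by measurable
      show "AE x in lborel. (\<lambda>n. ?q n x) \<longlonglongrightarrow> g x \<bullet> v"
      proof (rule AE_I2)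
        fix x
        have 1: "(\<phi> has_derivative (\<lambda>h. g x \<bullet> h)) (at (x + 0 *\<^sub>R v))" using C(1) by (simp add: C1_def)
        have 2: "((\<lambda>t. x + t *\<^sub>R v) has_derivative (\<lambda>t. t *\<^sub>R v)) (at 0)"
          by (auto intro!: derivative_eq_intros)
        have "(\<lambda>t. g x \<bullet> (t *\<^sub>R v)) = (*) (g x \<bullet> v)" by (auto simp: fun_eq_iff)
        then have "DERIV (\<lambda>t. \<phi> (x + t *\<^sub>R v)) 0 :> g x \<bullet> v"
          using has_derivative_compose[OF 2 1] by (simp only: has_field_derivative_def)
        then have lim: "(\<lambda>t. (\<phi> (x + t *\<^sub>R v) - \<phi> x) / t) \<midarrow>0\<rightarrow> g x \<bullet> v" by (simp add: DERIV_def)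
        have "filterlim (\<lambda>n. inverse (real (Suc n))) (at 0) sequentially"
          unfolding filterlim_at using LIMSEQ_inverse_real_of_nat by auto
        from filterlim_compose[OF lim this] show "(\<lambda>n. ?q n x) \<longlonglongrightarrow> g x \<bullet> v" .
      qed
      show "AE x in lborel. norm (?q n x) \<le> B * indicator ?S x" for n
      proof (rule AE_I2)
        fix x
        let ?t = "inverse (real (Suc n))"
        have t: "0 < ?t" "?t \<le> 1" by (auto simp: field_simps)
        have nv: "norm (?t *\<^sub>R v) = ?t" using v by simp
        have mv: "norm (\<phi> (x + ?t *\<^sub>R v) - \<phi> x) \<le> B * norm (?t *\<^sub>R v)"
        proof -
          have "norm (\<phi> (x + ?t *\<^sub>R v) - \<phi> x) \<le> B * norm (x + ?t *\<^sub>R v - x)"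
          proof (rule differentiable_bound[of UNIV \<phi> "\<lambda>x h. g x \<bullet> h"])
            show "(\<phi> has_derivative (\<lambda>h. g z \<bullet> h)) (at z)" for z using C(1) by (simp add: C1_def)
            show "onorm (\<lambda>h. g z \<bullet> h) \<le> B" for z
            proof (rule onorm_bound)
              show "norm (g z \<bullet> y) \<le> B * norm y" for y
                using Cauchy_Schwarz_ineq2[of "g z" y] mult_right_mono[OF B(3)[of z] norm_ge_zero[of y]] by simp
            qed (use B in simp)
          qed auto
          then show ?thesis by simp
        qed
        show "norm (?q n x) \<le> B * indicator ?S x"
        proof (cases "x \<in> ?S")
          case True
          have "norm (?q n x) = norm (\<phi> (x + ?t *\<^sub>R v) - \<phi> x) / ?t" using t by (simp add: abs_mult divide_simps)
          also have "\<dots> \<le> B" using mv t nv by (simp add: divide_le_eq)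
          finally show ?thesis using True by simp
        next
          case False
          have "x \<notin> tsupp \<phi>" using False by (auto simp: intro: exI[of _ x] exI[of _ 0])
          moreover have "x + ?t *\<^sub>R v \<notin> tsupp \<phi>"
          proof
            assume "x + ?t *\<^sub>R v \<in> tsupp \<phi>"
            moreover have "- (?t *\<^sub>R v) \<in> cball 0 1" using nv t by simp
            ultimately have "(x + ?t *\<^sub>R v) + - (?t *\<^sub>R v) \<in> ?S" by blast
            then show False using False by simp
          qed
          ultimately show ?thesis using False by (simp add: outside_tsupp)
        qed
      qed
    qed
    then have "(\<integral>x. g x \<bullet> v \<partial>lborel) = 0" using q0 by (simp add: LIMSEQ_const_iff)
    then show ?thesis using int by simp
  qed
  then show "(\<integral>x. g x \<partial>lborel) = 0" by (auto simp: euclidean_eq_iff[where 'a='a])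
qed

lemma measurable_lebesgue_on_continuous:
  "continuous_on UNIV (f::'a::euclidean_space \<Rightarrow> 'b::euclidean_space) \<Longrightarrow> f \<in> borel_measurable (lebesgue_on W)"
  by (intro measurable_restrict_space1 measurable_completion) (simp add: borel_measurable_continuous_onI)

lemma C1_measurable:
  assumes "C1 \<phi> g"
  shows "\<phi> \<in> borel_measurable (lebesgue_on W)" "g \<in> borel_measurable (lebesgue_on W)"
  using C1_continuous[OF assms] measurable_lebesgue_on_continuous by auto

text \<open>Pairing \<open>u\<close> with its gradient turns convergence in \<open>H1\<close> into mean square convergence of a single
  vector valued function.\<close>
definition jet :: "('a \<Rightarrow> real) \<Rightarrow> ('a \<Rightarrow> 'b) \<Rightarrow> 'a \<Rightarrow> real \<times> 'b" where
  "jet \<phi> g x = (\<phi> x, g x)"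

lemma bounded_sqint:
  fixes f :: "'a::euclidean_space \<Rightarrow> 'b::euclidean_space"
  assumes W: "W \<in> lmeasurable" and f: "f \<in> borel_measurable (lebesgue_on W)" and B: "\<And>x. norm (f x) \<le> B"
  shows "sqint (lebesgue_on W) f"
proof -
  interpret finite_measure "lebesgue_on W" using W by (rule finite_measure_lebesgue_on)
  show ?thesis by (rule sqint_bound(1)[OF sqint_const[of B] f, of 1]) (use B order.trans[OF B abs_ge_self] in auto)
qed

lemma sqint_jet:
  assumes "C1c \<phi> g" "W \<in> lmeasurable"
  shows "sqint (lebesgue_on W) (jet \<phi> g)"
proof -
  have C: "C1 \<phi> g" using assms by (auto simp: C1c_iff)
  obtain B where B: "B > 0" "\<And>x. \<bar>\<phi> x\<bar> \<le> B" "\<And>x. norm (g x) \<le> B" using C1c_bounded[OF assms(1)] by blast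
  have "continuous_on UNIV (jet \<phi> g)" unfolding jet_def[abs_def]
    using C1_continuous[OF C] by (intro continuous_intros)
  then have "jet \<phi> g \<in> borel_measurable (lebesgue_on W)" by (rule measurable_lebesgue_on_continuous)
  moreover have "norm (jet \<phi> g x) \<le> B + B" for x
    unfolding jet_def using B by (intro order.trans[OF norm_Pair_le] add_mono) auto
  ultimately show ?thesis using bounded_sqint[OF assms(2)] by blast
qed

lemma integral_lebesgue_on_supported:
  fixes f :: "'a::euclidean_space \<Rightarrow> 'b::euclidean_space"
  assumes f: "f \<in> borel_measurable borel" and W: "W \<in> sets lebesgue" and z: "\<And>x. x \<notin> W \<Longrightarrow> f x = 0"
  shows "(\<integral>x. f x \<partial>lebesgue_on W) = (\<integral>x. f x \<partial>lborel)"
proof -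
  have "(\<integral>x. f x \<partial>lebesgue_on W) = (\<integral>x. indicator W x *\<^sub>R f x \<partial>lebesgue)"
    by (rule integral_restrict_space) (use W in auto)
  also have "\<dots> = (\<integral>x. f x \<partial>lebesgue)"
    by (rule Bochner_Integration.integral_cong) (use z in \<open>auto simp: indicator_def\<close>)
  also have "\<dots> = (\<integral>x. f x \<partial>lborel)" by (rule integral_completion) (use f in simp)
  finally show ?thesis .
qed

lemma C1c_integration_by_parts:
  fixes \<phi> \<psi> :: "'a::euclidean_space \<Rightarrow> real"
  assumes \<phi>: "C1 \<phi> g" and \<psi>: "C1c \<psi> h" and sup: "tsupp \<psi> \<subseteq> W" and W: "W \<in> lmeasurable"
  shows "(\<integral>x. \<phi> x *\<^sub>R h x \<partial>lebesgue_on W) = - (\<integral>x. \<psi> x *\<^sub>R g x \<partial>lebesgue_on W)"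
proof -
  have C: "C1 \<psi> h" "compact (tsupp \<psi>)" using \<psi> by (auto simp: C1c_iff)
  have p: "C1c (\<lambda>x. \<phi> x * \<psi> x) (\<lambda>x. \<phi> x *\<^sub>R h x + \<psi> x *\<^sub>R g x)"
    using C1c_mult[OF \<phi> \<psi>] .
  have z: "\<psi> x = 0 \<and> h x = 0" if "x \<notin> tsupp \<psi>" for x using C1c_outside_tsupp[OF \<psi> that] .
  have cont: "continuous_on UNIV (\<lambda>x. \<phi> x *\<^sub>R h x)" "continuous_on UNIV (\<lambda>x. \<psi> x *\<^sub>R g x)"
    using C1_continuous[OF \<phi>] C1_continuous[OF C(1)] by (auto intro!: continuous_intros)
  have m: "(\<lambda>x. \<phi> x *\<^sub>R h x) \<in> borel_measurable borel" "(\<lambda>x. \<psi> x *\<^sub>R g x) \<in> borel_measurable borel"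
    using cont by (auto intro: borel_measurable_continuous_onI)
  have int: "integrable lborel f"
    if "continuous_on UNIV f" "\<And>x. x \<notin> tsupp \<psi> \<Longrightarrow> f x = 0" for f :: "'a \<Rightarrow> 'a"
  proof -
    have "integrable lborel (\<lambda>x. indicator (tsupp \<psi>) x *\<^sub>R f x)"
      by (rule borel_integrable_compact[OF C(2)]) (rule continuous_on_subset[OF that(1)], simp)
    moreover have "(\<lambda>x. indicator (tsupp \<psi>) x *\<^sub>R f x) = f" using that(2) by (auto simp: indicator_def)
    ultimately show ?thesis by simp
  qed
  have Ws: "W \<in> sets lebesgue" using W by (simp add: fmeasurableD)
  have 1: "(\<integral>x. \<phi> x *\<^sub>R h x \<partial>lebesgue_on W) = (\<integral>x. \<phi> x *\<^sub>R h x \<partial>lborel)"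
    by (rule integral_lebesgue_on_supported[OF m(1) Ws]) (use z sup in auto)
  have 2: "(\<integral>x. \<psi> x *\<^sub>R g x \<partial>lebesgue_on W) = (\<integral>x. \<psi> x *\<^sub>R g x \<partial>lborel)"
    by (rule integral_lebesgue_on_supported[OF m(2) Ws]) (use z sup in auto)
  have "(\<integral>x. \<phi> x *\<^sub>R h x \<partial>lborel) + (\<integral>x. \<psi> x *\<^sub>R g x \<partial>lborel) = (\<integral>x. \<phi> x *\<^sub>R h x + \<psi> x *\<^sub>R g x \<partial>lborel)"
    by (rule Bochner_Integration.integral_add[symmetric]) (rule int, rule cont, use z in simp)+
  also have "\<dots> = 0" by (rule C1c_integral_grad_zero(2)[OF p])
  finally show ?thesis unfolding 1 2 by (simp add: eq_neg_iff_add_eq_0)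
qed

section \<open>Weak gradients as L2 jets\<close>

text \<open>If the set where \<open>f > 0\<close> had positive measure, inner regularity would give
  a closed subset of positive measure. It is a countable union of compact sets; on each of them
  \<open>f\<close> is positive with integral zero, so each is null.\<close>

lemma AE_nonpos_if_compact_integrals_zero:
  fixes f :: "'a::euclidean_space \<Rightarrow> real"
  assumes W: "W \<in> lmeasurable" and f: "integrable (lebesgue_on W) f"
    and z: "\<And>K. compact K \<Longrightarrow> K \<subseteq> W \<Longrightarrow> (\<integral>x. indicator K x * f x \<partial>lebesgue_on W) = 0"
  shows "AE x in lebesgue_on W. f x \<le> 0"
proof -
  have Ws: "W \<in> sets lebesgue" using W by (simp add: fmeasurableD)
  define A where "A = {x \<in> space (lebesgue_on W). f x > 0}"
  have mA: "A \<in> sets (lebesgue_on W)" unfolding A_def using f by measurable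
  then have As: "A \<in> sets lebesgue" "A \<subseteq> W" using Ws by (auto simp: sets_restrict_space_iff A_def)
  have "emeasure lebesgue A = 0"
  proof (rule ccontr)
    assume "emeasure lebesgue A \<noteq> 0"
    then have pos: "0 < emeasure lebesgue A" using zero_less_iff_neq_zero by blast
    have Alm: "A \<in> lmeasurable" using fmeasurableI2[OF W As(2,1)] .
    then have mpos: "0 < measure lebesgue A" using pos by (simp add: emeasure_eq_measure2 fmeasurableD2)
    obtain C where C: "closed C" "C \<subseteq> A" "A - C \<in> lmeasurable" "emeasure lebesgue (A - C) < ennreal (measure lebesgue A / 2)"
      using sets_lebesgue_inner_closed[OF As(1), of "measure lebesgue A / 2"] mpos by auto
    have Clm: "C \<in> lmeasurable" using fmeasurableI2[OF Alm C(2)] C(1) by simp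
    have "measure lebesgue (A - C) < measure lebesgue A / 2"
      using C(3,4) mpos by (simp add: emeasure_eq_measure2 ennreal_less_iff)
    moreover have "measure lebesgue (A - C) = measure lebesgue A - measure lebesgue C"
      by (rule measurable_measure_Diff) (use Alm Clm C in auto)
    ultimately have "measure lebesgue C > measure lebesgue A / 2" by simp
    then have mC: "measure lebesgue C > 0" using mpos by simp
    define K where "K n = C \<inter> cball 0 (real n)" for n
    have cK: "compact (K n)" for n unfolding K_def using C(1) by (simp add: closed_Int_compact)
    have "emeasure lebesgue (K n) = 0" for n
    proof -
      have KW: "K n \<subseteq> A" "K n \<subseteq> W" using C As by (auto simp: K_def)
      have mK: "K n \<in> sets (lebesgue_on W)"
        using KW cK[of n] Ws by (auto simp: sets_restrict_space_iff compact_imp_closed)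
      have "AE x in lebesgue_on W. indicator (K n) x * f x = 0"
      proof (subst integral_nonneg_eq_0_iff_AE[symmetric])
        show "integrable (lebesgue_on W) (\<lambda>x. indicator (K n) x * f x)"
          using integrable_real_mult_indicator[OF mK f] by (simp add: mult.commute)
        show "AE x in lebesgue_on W. 0 \<le> indicator (K n) x * f x"
          using KW by (auto simp: indicator_def A_def intro!: AE_I2)
      qed (use z[OF cK KW(2)] in auto)
      then have "AE x in lebesgue_on W. x \<notin> K n"
        by (rule AE_mp) (use KW in \<open>auto simp: A_def indicator_def intro!: AE_I2\<close>)
      then have "AE x in lebesgue. x \<in> W \<longrightarrow> x \<notin> K n" by (subst (asm) AE_restrict_space_iff) (use Ws in auto)
      then have "AE x in lebesgue. x \<notin> K n" using KW by (auto elim!: eventually_mono)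
      then show ?thesis using cK[of n] AE_iff_measurable[of "K n" lebesgue "\<lambda>x. x \<notin> K n"]
        by (simp add: compact_imp_closed)
    qed
    moreover have "C = (\<Union>n. K n)" unfolding K_def by (auto intro: real_arch_simple)
    ultimately have "emeasure lebesgue C = 0"
      using emeasure_UN_eq_0[of lebesgue K] cK by (auto simp: compact_imp_closed image_subset_iff)
    then show False using mC by (simp add: measure_def)
  qed
  then have "AE x in lebesgue. x \<notin> A" using As(1) by (intro AE_not_in) (auto simp: null_sets_def)
  then have "AE x in lebesgue. x \<in> W \<longrightarrow> f x \<le> 0"
    by (rule AE_mp) (auto simp: A_def not_less intro!: AE_I2)
  then show ?thesis by (subst AE_restrict_space_iff) (use Ws in auto)
qed

text \<open>The lemma of du Bois-Reymond. Since \<open>wgrad\<close> is chosen by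
  \<open>SOME\<close>, this is what allows it to be replaced by any known weak gradient under an
  integral.\<close>

lemma weak_grad_unique:
  fixes W :: "'a::euclidean_space set"
  assumes W: "open W" "bounded W" and G: "weak_grad W u G" and H: "weak_grad W u H"
  shows "AE x in lebesgue_on W. G x = H x"
proof -
  have Wl: "W \<in> lmeasurable" using W by (simp add: lmeasurable_open)
  interpret finite_measure "lebesgue_on W" using Wl by (rule finite_measure_lebesgue_on)
  have sGH: "sqint (lebesgue_on W) G" "sqint (lebesgue_on W) H"
    using G H by (auto simp: weak_grad_def sqint_def)
  define F where "F x = G x - H x" for x
  have sF: "sqint (lebesgue_on W) F" unfolding F_def[abs_def] using sGH by (rule sqint_diff)
  have iF: "integrable (lebesgue_on W) (\<lambda>x. norm (F x))" by (rule sqint_norm_integral(1)[OF sF])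
  have mF: "F \<in> borel_measurable (lebesgue_on W)" using sF by (rule sqint_measurable)
  have test: "(\<integral>x. \<phi> x *\<^sub>R F x \<partial>lebesgue_on W) = 0" if \<phi>: "C1c \<phi> g" "tsupp \<phi> \<subseteq> W" for \<phi> g
  proof -
    have C1: "C1 \<phi> g" using \<phi> by (simp add: C1c_iff)
    obtain B where B: "B > 0" "\<And>x. \<bar>\<phi> x\<bar> \<le> B" using C1c_bounded[OF \<phi>(1)] by blast
    have int: "integrable (lebesgue_on W) (\<lambda>x. \<phi> x *\<^sub>R f x)" if s: "sqint (lebesgue_on W) f" for f :: "'a \<Rightarrow> 'a"
    proof (rule Bochner_Integration.integrable_bound)
      show "integrable (lebesgue_on W) (\<lambda>x. B * norm (f x))" using sqint_norm_integral(1)[OF s] by simp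
      show "(\<lambda>x. \<phi> x *\<^sub>R f x) \<in> borel_measurable (lebesgue_on W)"
        using C1_measurable(1)[OF C1] sqint_measurable[OF s] by measurable
      show "AE x in lebesgue_on W. norm (\<phi> x *\<^sub>R f x) \<le> norm (B * norm (f x))"
        using B by (auto intro!: AE_I2 mult_right_mono simp: abs_mult)
    qed
    have "(\<integral>x. \<phi> x *\<^sub>R F x \<partial>lebesgue_on W) = (\<integral>x. \<phi> x *\<^sub>R G x \<partial>lebesgue_on W) - (\<integral>x. \<phi> x *\<^sub>R H x \<partial>lebesgue_on W)"
      unfolding F_def scaleR_diff_right by (rule Bochner_Integration.integral_diff) (intro int sGH)+
    moreover have "(\<integral>x. u x *\<^sub>R g x \<partial>lebesgue_on W) = - (\<integral>x. \<phi> x *\<^sub>R G x \<partial>lebesgue_on W)"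
      "(\<integral>x. u x *\<^sub>R g x \<partial>lebesgue_on W) = - (\<integral>x. \<phi> x *\<^sub>R H x \<partial>lebesgue_on W)"
      using G H \<phi> by (auto simp: weak_grad_def)
    ultimately show ?thesis by simp
  qed
  have cpt: "(\<integral>x. indicator K x *\<^sub>R F x \<partial>lebesgue_on W) = 0" if K: "compact K" "K \<subseteq> W" for K
  proof (cases "K = {}")
    case False
    \<comment> \<open>Open neighbourhoods shrinking to \<open>K\<close>: cutoffs supported in them
      and equal to 1 on \<open>K\<close> tend pointwise to the indicator of
      \<open>K\<close>.\<close>
    define U where "U n = W \<inter> {x. infdist x K < inverse (real (Suc n))}" for n
    have U: "open (U n)" "K \<subseteq> U n" for n
    proof -
      have "open {x. infdist x K < inverse (real (Suc n))}"
        by (intro open_Collect_less continuous_intros)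
      then show "open (U n)" using W by (auto simp: U_def)
      show "K \<subseteq> U n" using K by (auto simp: U_def)
    qed
    have "\<forall>n. \<exists>\<eta> h V. C1c \<eta> h \<and> (\<forall>x. 0 \<le> \<eta> x \<and> \<eta> x \<le> 1) \<and> tsupp \<eta> \<subseteq> U n \<and> open V \<and> K \<subseteq> V \<and> (\<forall>x\<in>V. \<eta> x = 1)"
      using cutoff_compact_open[OF K(1) U] by blast
    then obtain \<eta> h where \<eta>: "\<And>n. C1c (\<eta> n) (h n)" "\<And>n x. 0 \<le> \<eta> n x \<and> \<eta> n x \<le> 1" "\<And>n. tsupp (\<eta> n) \<subseteq> U n"
      "\<And>n x. x \<in> K \<Longrightarrow> \<eta> n x = 1" by (metis subsetD)
    have "(\<lambda>n. \<integral>x. \<eta> n x *\<^sub>R F x \<partial>lebesgue_on W) \<longlonglongrightarrow> (\<integral>x. indicator K x *\<^sub>R F x \<partial>lebesgue_on W)"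
    proof (rule integral_dominated_convergence[OF _ _ iF])
      have "K \<in> sets (lebesgue_on W)" using K W by (auto simp: sets_restrict_space_iff compact_imp_closed)
      then show "(\<lambda>x. indicator K x *\<^sub>R F x) \<in> borel_measurable (lebesgue_on W)" using mF by measurable
      show "(\<lambda>x. \<eta> n x *\<^sub>R F x) \<in> borel_measurable (lebesgue_on W)" for n
        using mF C1_measurable(1)[of "\<eta> n" "h n" W] \<eta>(1)[of n] by (simp add: C1c_iff)
      show "AE x in lebesgue_on W. norm (\<eta> n x *\<^sub>R F x) \<le> norm (F x)" for n
        using \<eta>(2)[of n] by (auto intro!: AE_I2 mult_left_le_one_le)
      have "(\<lambda>n. \<eta> n x) \<longlonglongrightarrow> indicator K x" for x
      proof (cases "x \<in> K")
        case True then show ?thesis using \<eta>(4) by simp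
      next
        case out: False
        then have "infdist x K > 0"
          using K False infdist_pos_not_in_closed[of K x] by (auto simp: compact_imp_closed)
        then have "\<forall>\<^sub>F n in sequentially. inverse (real (Suc n)) < infdist x K"
          using order_tendstoD(2)[OF LIMSEQ_inverse_real_of_nat] by blast
        then have "\<forall>\<^sub>F n in sequentially. \<eta> n x = indicator K x"
        proof eventually_elim
          case (elim n)
          then have "x \<notin> U n" by (simp add: U_def)
          then show ?case using \<eta>(3)[of n] out outside_tsupp[of x "\<eta> n"] by auto
        qed
        then show ?thesis by (rule tendsto_eventually)
      qed
      then show "AE x in lebesgue_on W. (\<lambda>n. \<eta> n x *\<^sub>R F x) \<longlonglongrightarrow> indicator K x *\<^sub>R F x"
        by (intro AE_I2 tendsto_intros)
    qed
    moreover have "(\<integral>x. \<eta> n x *\<^sub>R F x \<partial>lebesgue_on W) = 0" for n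
      using test[OF \<eta>(1)] \<eta>(3) by (auto simp: U_def)
    ultimately show ?thesis by (simp add: LIMSEQ_const_iff)
  qed simp
  have le0: "AE x in lebesgue_on W. F x \<bullet> c \<le> 0" for c
  proof (rule AE_nonpos_if_compact_integrals_zero[OF Wl])
    have iF': "integrable (lebesgue_on W) F" using iF mF by (simp add: integrable_norm_iff)
    then show "integrable (lebesgue_on W) (\<lambda>x. F x \<bullet> c)" by simp
    fix K assume K: "compact K" "K \<subseteq> W"
    have "K \<in> sets (lebesgue_on W)" using K W by (auto simp: sets_restrict_space_iff compact_imp_closed)
    then have "integrable (lebesgue_on W) (\<lambda>x. indicator K x *\<^sub>R F x)"
      by (rule integrable_mult_indicator[OF _ iF'])
    from integral_inner_left[OF this, of c]
    have "(\<integral>x. (indicator K x *\<^sub>R F x) \<bullet> c \<partial>lebesgue_on W) = 0" using cpt[OF K] by simp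
    then show "(\<integral>x. indicator K x * (F x \<bullet> c) \<partial>lebesgue_on W) = 0" by simp
  qed
  \<comment> \<open>Both signs of every basis direction together force all components to
    vanish.\<close>
  have "AE x in lebesgue_on W. \<forall>b\<in>Basis. F x \<bullet> b \<le> 0 \<and> F x \<bullet> (- b) \<le> 0"
    using le0 by (intro AE_finite_allI finite_Basis AE_conjI)
  then show ?thesis
    by (rule AE_mp) (auto intro!: AE_I2 simp: F_def euclidean_eq_iff[where 'a='a] inner_diff_left)
qed

subsection \<open>H1 jets\<close>

lemma sqint_fst_snd:
  fixes P :: "'x \<Rightarrow> real \<times> 'b::euclidean_space"
  assumes "sqint M P"
  shows "sqint M (\<lambda>x. fst (P x))" "sqint M (\<lambda>x. snd (P x))"
proof -
  have m: "P \<in> borel_measurable M" using assms by (rule sqint_measurable)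
  have m': "(\<lambda>x. fst (P x)) \<in> borel_measurable M" "(\<lambda>x. snd (P x)) \<in> borel_measurable M"
    using m by (auto intro!: measurable_compose[OF m] borel_measurable_continuous_onI continuous_intros)
  have n: "norm (fst v) \<le> norm v" "norm (snd v) \<le> norm v" for v :: "real \<times> 'b"
    by (metis norm_fst_le prod.collapse) (metis norm_snd_le prod.collapse)
  show "sqint M (\<lambda>x. fst (P x))"
    by (rule sqint_bound(1)[OF assms m'(1), of 1]) (simp only: mult_1 n)
  show "sqint M (\<lambda>x. snd (P x))"
    by (rule sqint_bound(1)[OF assms m'(2), of 1]) (simp only: mult_1 n)
qed

lemma sqint_Pair:
  fixes G :: "'x \<Rightarrow> 'b::euclidean_space"
  assumes "sqint M (u :: 'x \<Rightarrow> real)" "sqint M G"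
  shows "sqint M (jet u G)" "N2 M (jet u G) = N2 M u + N2 M G"
proof -
  have n: "(norm (jet u G x))\<^sup>2 = (norm (u x))\<^sup>2 + (norm (G x))\<^sup>2" for x
    by (simp add: jet_def norm_Pair)
  show "sqint M (jet u G)" unfolding sqint_def n
    using assms by (auto simp: sqint_def jet_def[abs_def] intro!: borel_measurable_Pair)
  show "N2 M (jet u G) = N2 M u + N2 M G" unfolding N2_def n
    using assms by (intro Bochner_Integration.integral_add) (auto simp: sqint_def)
qed

definition H1_jet :: "'a::euclidean_space set \<Rightarrow> ('a \<Rightarrow> real \<times> 'a) \<Rightarrow> bool" where
  "H1_jet W P \<longleftrightarrow> sqint (lebesgue_on W) P \<and> weak_grad W (\<lambda>x. fst (P x)) (\<lambda>x. snd (P x))"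

text \<open>The symmetric linear map on pairs (value, gradient) whose quadratic form is the energy
  density. It makes the energy an L2 inner product, so that its continuity follows from
  \<open>L2lim_inner\<close>.\<close>

definition energy_map :: "real \<Rightarrow> real \<times> 'b \<Rightarrow> real \<times> 'b::euclidean_space" where
  "energy_map \<Lambda> v = (- \<Lambda> * fst v, snd v)"

definition energy_form :: "'a::euclidean_space set \<Rightarrow> real \<Rightarrow> ('a \<Rightarrow> real \<times> 'a) \<Rightarrow> ('a \<Rightarrow> real \<times> 'a) \<Rightarrow> real" where
  "energy_form W \<Lambda> P Q = (\<integral>x. P x \<bullet> energy_map \<Lambda> (Q x) \<partial>lebesgue_on W)"

text \<open>Taken in a direction \<open>b\<close>, the defining identity of the weak gradient says
  that the pair is orthogonal in L2 to the fixed field \<open>(g \<bullet> b, \<phi> b)\<close>. In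
  this form it is stable under L2 limits and linear combinations.\<close>

lemma weak_grad_jetI:
  assumes s: "sqint (lebesgue_on W) P" and W: "W \<in> lmeasurable"
    and t: "\<And>\<phi> g b. C1c \<phi> g \<Longrightarrow> tsupp \<phi> \<subseteq> W \<Longrightarrow> b \<in> Basis \<Longrightarrow>
      (\<integral>x. P x \<bullet> (g x \<bullet> b, \<phi> x *\<^sub>R b) \<partial>lebesgue_on W) = 0"
  shows "weak_grad W (\<lambda>x. fst (P x)) (\<lambda>x. snd (P x :: real \<times> 'a::euclidean_space))"
proof -
  interpret finite_measure "lebesgue_on W" using W by (rule finite_measure_lebesgue_on)
  note s' = sqint_fst_snd[OF s]
  have "(\<integral>x. fst (P x) *\<^sub>R g x \<partial>lebesgue_on W) = - (\<integral>x. \<phi> x *\<^sub>R snd (P x) \<partial>lebesgue_on W)"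
    if \<phi>: "C1c \<phi> g" "tsupp \<phi> \<subseteq> W" for \<phi> g
  proof -
    have sj: "sqint (lebesgue_on W) (\<lambda>x. \<phi> x)" "sqint (lebesgue_on W) (\<lambda>x. g x)"
      using sqint_fst_snd[OF sqint_jet[OF \<phi>(1) W]] by (auto simp: jet_def)
    have m: "\<phi> \<in> borel_measurable (lebesgue_on W)" "g \<in> borel_measurable (lebesgue_on W)"
      using sj by (auto intro: sqint_measurable)
    have int1: "integrable (lebesgue_on W) (\<lambda>x. fst (P x) *\<^sub>R g x)"
    proof (rule Bochner_Integration.integrable_bound)
      have "sqint (lebesgue_on W) (\<lambda>x. norm (g x))" using sj(2) by (auto simp: sqint_def)
      from sqint_inner[OF s'(1) this] show "integrable (lebesgue_on W) (\<lambda>x. fst (P x) * norm (g x))" by simp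
      show "(\<lambda>x. fst (P x) *\<^sub>R g x) \<in> borel_measurable (lebesgue_on W)"
        using m sqint_measurable[OF s'(1)] by measurable
    qed (auto simp: abs_mult)
    have int2: "integrable (lebesgue_on W) (\<lambda>x. \<phi> x *\<^sub>R snd (P x))"
    proof (rule Bochner_Integration.integrable_bound)
      have "sqint (lebesgue_on W) (\<lambda>x. norm (snd (P x)))" using s'(2) by (auto simp: sqint_def)
      from sqint_inner[OF sj(1) this] show "integrable (lebesgue_on W) (\<lambda>x. \<phi> x * norm (snd (P x)))" by simp
      show "(\<lambda>x. \<phi> x *\<^sub>R snd (P x)) \<in> borel_measurable (lebesgue_on W)"
        using m sqint_measurable[OF s'(2)] by measurable
    qed (auto simp: abs_mult)
    have "((\<integral>x. fst (P x) *\<^sub>R g x \<partial>lebesgue_on W) + (\<integral>x. \<phi> x *\<^sub>R snd (P x) \<partial>lebesgue_on W)) \<bullet> b = 0"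
      if b: "b \<in> Basis" for b
    proof -
      have "((\<integral>x. fst (P x) *\<^sub>R g x \<partial>lebesgue_on W) + (\<integral>x. \<phi> x *\<^sub>R snd (P x) \<partial>lebesgue_on W)) \<bullet> b
          = (\<integral>x. (fst (P x) *\<^sub>R g x + \<phi> x *\<^sub>R snd (P x)) \<bullet> b \<partial>lebesgue_on W)"
        using int1 int2 by simp
      also have "\<dots> = (\<integral>x. P x \<bullet> (g x \<bullet> b, \<phi> x *\<^sub>R b) \<partial>lebesgue_on W)"
        by (simp add: inner_prod_def inner_add_left)
      finally show ?thesis using t[OF \<phi> b] by simp
    qed
    then have "(\<integral>x. fst (P x) *\<^sub>R g x \<partial>lebesgue_on W) + (\<integral>x. \<phi> x *\<^sub>R snd (P x) \<partial>lebesgue_on W) = 0"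
      by (subst euclidean_eq_iff) simp
    then show ?thesis by (simp add: eq_neg_iff_add_eq_0)
  qed
  then show ?thesis using s'(2) by (auto simp: weak_grad_def sqint_def)
qed

text \<open>For C1 functions the orthogonality is integration by parts, and an L2 inner product with
  a fixed field passes to the limit.\<close>

lemma L2lim_jets_H1:
  assumes W: "W \<in> lmeasurable" and w: "\<And>n. C1c (w n) (gw n)"
    and lim: "L2lim (lebesgue_on W) (\<lambda>n. jet (w n) (gw n)) P"
  shows "H1_jet W P"
proof -
  have "weak_grad W (\<lambda>x. fst (P x)) (\<lambda>x. snd (P x))"
  proof (rule weak_grad_jetI[OF L2limD(2)[OF lim] W])
    fix \<phi> g and b :: 'a assume \<phi>: "C1c \<phi> g" "tsupp \<phi> \<subseteq> W" and b: "b \<in> Basis"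
    let ?t = "\<lambda>x. (g x \<bullet> b, \<phi> x *\<^sub>R b)"
    have C: "C1 \<phi> g" using \<phi> by (simp add: C1c_iff)
    have "sqint (lebesgue_on W) ?t"
    proof -
      obtain B where B: "B > 0" "\<And>x. \<bar>\<phi> x\<bar> \<le> B" "\<And>x. norm (g x) \<le> B" using C1c_bounded[OF \<phi>(1)] by blast
      have "norm (?t x) \<le> B + B" for x
        using B b Basis_le_norm[OF b, of "g x"]
        by (intro order.trans[OF norm_Pair_le] add_mono) (auto intro: order.trans)
      moreover have "?t \<in> borel_measurable (lebesgue_on W)"
        using C1_continuous[OF C] by (intro measurable_lebesgue_on_continuous continuous_intros)
      ultimately show ?thesis using bounded_sqint[OF W] by blast
    qed
    from L2lim_inner[OF lim L2lim_const[OF this]]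
    have "(\<lambda>n. \<integral>x. jet (w n) (gw n) x \<bullet> ?t x \<partial>lebesgue_on W) \<longlonglongrightarrow> (\<integral>x. P x \<bullet> ?t x \<partial>lebesgue_on W)" .
    moreover have "(\<integral>x. jet (w n) (gw n) x \<bullet> ?t x \<partial>lebesgue_on W) = 0" for n
    proof -
      have Cw: "C1 (w n) (gw n)" using w by (simp add: C1c_iff)
      have c: "continuous_on UNIV (\<lambda>x. w n x *\<^sub>R g x)" "continuous_on UNIV (\<lambda>x. \<phi> x *\<^sub>R gw n x)"
        using C1_continuous[OF C] C1_continuous[OF Cw] by (auto intro!: continuous_intros)
      have int: "integrable (lebesgue_on W) f" if "continuous_on UNIV f" "\<And>x. x \<notin> tsupp \<phi> \<Longrightarrow> f x = 0" for f :: "'a \<Rightarrow> 'a"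
      proof -
        have "bounded (f ` tsupp \<phi>)"
          using \<phi>(1) continuous_on_subset[OF that(1)] by (auto simp: C1c_iff intro!: compact_imp_bounded compact_continuous_image)
        then obtain B where "\<And>x. x \<in> tsupp \<phi> \<Longrightarrow> norm (f x) \<le> B" unfolding bounded_iff by auto
        then have B: "norm (f x) \<le> \<bar>B\<bar>" for x
          using that(2)[of x] by (cases "x \<in> tsupp \<phi>") (auto intro: order.trans[OF _ abs_ge_self])
        interpret finite_measure "lebesgue_on W" using W by (rule finite_measure_lebesgue_on)
        show ?thesis by (rule integrable_const_bound[of _ "\<bar>B\<bar>"])
            (use B measurable_lebesgue_on_continuous[OF that(1)] in auto)
      qed
      have i: "integrable (lebesgue_on W) (\<lambda>x. w n x *\<^sub>R g x)" "integrable (lebesgue_on W) (\<lambda>x. \<phi> x *\<^sub>R gw n x)"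
        using c C1c_outside_tsupp[OF \<phi>(1)] by (auto intro!: int)
      have "(\<integral>x. jet (w n) (gw n) x \<bullet> ?t x \<partial>lebesgue_on W) = (\<integral>x. (w n x *\<^sub>R g x + \<phi> x *\<^sub>R gw n x) \<bullet> b \<partial>lebesgue_on W)"
        by (simp add: jet_def inner_prod_def inner_add_left)
      also have "\<dots> = ((\<integral>x. w n x *\<^sub>R g x \<partial>lebesgue_on W) + (\<integral>x. \<phi> x *\<^sub>R gw n x \<partial>lebesgue_on W)) \<bullet> b"
        using i by simp
      also have "\<dots> = 0" using C1c_integration_by_parts[OF Cw \<phi> W] by simp
      finally show ?thesis .
    qed
    ultimately show "(\<integral>x. P x \<bullet> ?t x \<partial>lebesgue_on W) = 0" by (simp add: LIMSEQ_const_iff)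
  qed
  then show ?thesis using L2limD(2)[OF lim] by (simp add: H1_jet_def)
qed

lemma C1c_H1_jet: "W \<in> lmeasurable \<Longrightarrow> C1c \<phi> g \<Longrightarrow> H1_jet W (jet \<phi> g)"
  using L2lim_jets_H1[of W "\<lambda>_. \<phi>" "\<lambda>_. g"] L2lim_const[OF sqint_jet] by blast

lemma H1_jet_imp_H1: "H1_jet W P \<Longrightarrow> H1 W (\<lambda>x. fst (P x))"
  using sqint_fst_snd(1)[of "lebesgue_on W" P] by (auto simp: H1_jet_def H1_def L2_dom_def sqint_def)

lemma H1_imp_H1_jet: "H1 W u \<Longrightarrow> weak_grad W u G \<Longrightarrow> H1_jet W (jet u G)"
  using sqint_Pair(1)[of "lebesgue_on W" u G]
  by (auto simp: H1_jet_def H1_def L2_dom_def weak_grad_def sqint_def jet_def)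

lemma H1_weak_grad: "H1 W u \<Longrightarrow> weak_grad W u (wgrad W u)"
  unfolding H1_def wgrad_def by (metis someI_ex)

lemma H1_jet_diff:
  assumes W: "W \<in> lmeasurable" and P: "H1_jet W P" and Q: "H1_jet W Q"
  shows "H1_jet W (\<lambda>x. P x - Q x)"
proof -
  have s: "sqint (lebesgue_on W) P" "sqint (lebesgue_on W) Q" using P Q by (auto simp: H1_jet_def)
  have t: "(\<integral>x. R x \<bullet> (g x \<bullet> b, \<phi> x *\<^sub>R b) \<partial>lebesgue_on W) = 0 \<and> integrable (lebesgue_on W) (\<lambda>x. R x \<bullet> (g x \<bullet> b, \<phi> x *\<^sub>R b))"
    if R: "H1_jet W R" and \<phi>: "C1c \<phi> g" "tsupp \<phi> \<subseteq> W" "b \<in> Basis" for R \<phi> g b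
  proof -
    have sj: "sqint (lebesgue_on W) (\<lambda>x. \<phi> x)" "sqint (lebesgue_on W) (\<lambda>x. g x)"
      using sqint_fst_snd[OF sqint_jet[OF \<phi>(1) W]] by (auto simp: jet_def)
    have sR: "sqint (lebesgue_on W) (\<lambda>x. fst (R x))" "sqint (lebesgue_on W) (\<lambda>x. snd (R x))"
      using R by (auto simp: H1_jet_def intro: sqint_fst_snd)
    have n: "sqint (lebesgue_on W) (\<lambda>x. norm (g x))" "sqint (lebesgue_on W) (\<lambda>x. norm (snd (R x)))"
      using sj sR by (auto simp: sqint_def)
    have m: "\<phi> \<in> borel_measurable (lebesgue_on W)" "g \<in> borel_measurable (lebesgue_on W)"
       "(\<lambda>x. fst (R x)) \<in> borel_measurable (lebesgue_on W)" "(\<lambda>x. snd (R x)) \<in> borel_measurable (lebesgue_on W)"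
      using sj sR by (auto intro: sqint_measurable)
    have i1: "integrable (lebesgue_on W) (\<lambda>x. fst (R x) *\<^sub>R g x)"
      using sqint_inner[OF sR(1) n(1)] by (rule Bochner_Integration.integrable_bound) (use m in \<open>auto simp: abs_mult\<close>)
    have i2: "integrable (lebesgue_on W) (\<lambda>x. \<phi> x *\<^sub>R snd (R x))"
      using sqint_inner[OF sj(1) n(2)] by (rule Bochner_Integration.integrable_bound) (use m in \<open>auto simp: abs_mult\<close>)
    have e: "R x \<bullet> (g x \<bullet> b, \<phi> x *\<^sub>R b) = (fst (R x) *\<^sub>R g x + \<phi> x *\<^sub>R snd (R x)) \<bullet> b" for x
      by (simp add: inner_prod_def inner_add_left)
    have "(\<integral>x. fst (R x) *\<^sub>R g x \<partial>lebesgue_on W) = - (\<integral>x. \<phi> x *\<^sub>R snd (R x) \<partial>lebesgue_on W)"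
      using R \<phi> by (auto simp: H1_jet_def weak_grad_def)
    then show ?thesis unfolding e using i1 i2 by simp
  qed
  have "weak_grad W (\<lambda>x. fst (P x - Q x)) (\<lambda>x. snd (P x - Q x))"
  proof (rule weak_grad_jetI[OF sqint_diff(1)[OF s] W])
    fix \<phi> g and b :: 'a assume a: "C1c \<phi> g" "tsupp \<phi> \<subseteq> W" "b \<in> Basis"
    show "(\<integral>x. (P x - Q x) \<bullet> (g x \<bullet> b, \<phi> x *\<^sub>R b) \<partial>lebesgue_on W) = 0"
      unfolding inner_diff_left using t[OF P a] t[OF Q a] by simp
  qed
  then show ?thesis using sqint_diff(1)[OF s] by (simp add: H1_jet_def)
qed

section \<open>Traces, energies and the weak equation in terms of jets\<close>

context
  fixes W :: "'a::euclidean_space set"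
  assumes W: "open W" "bounded W"
begin

lemma lmeasurable_W: "W \<in> lmeasurable"
  using W by (simp add: lmeasurable_open)

lemma wgrad_AE:
  assumes "H1_jet W P"
  shows "AE x in lebesgue_on W. wgrad W (\<lambda>x. fst (P x)) x = snd (P x)"
  using weak_grad_unique[OF W H1_weak_grad[OF H1_jet_imp_H1[OF assms]]] assms by (auto simp: H1_jet_def)

lemma dirichlet_energy_jet:
  assumes P: "H1_jet W P"
  shows "dirichlet_energy W (\<lambda>x. fst (P x)) = N2 (lebesgue_on W) (\<lambda>x. snd (P x))"
proof -
  have m: "wgrad W (\<lambda>x. fst (P x)) \<in> borel_measurable (lebesgue_on W)"
    using H1_weak_grad[OF H1_jet_imp_H1[OF P]] by (simp add: weak_grad_def)
  have m': "(\<lambda>x. snd (P x)) \<in> borel_measurable (lebesgue_on W)"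
    using P by (simp add: H1_jet_def weak_grad_def)
  show ?thesis unfolding dirichlet_energy_def N2_def
    by (rule integral_cong_AE) (use m m' wgrad_AE[OF P] in \<open>auto elim!: eventually_mono\<close>)
qed

lemma energy_jet:
  assumes P: "H1_jet W P"
  shows "dirichlet_energy W (\<lambda>x. fst (P x)) - \<Lambda> * L2norm2 W (\<lambda>x. fst (P x)) = energy_form W \<Lambda> P P"
proof -
  have s: "sqint (lebesgue_on W) (\<lambda>x. fst (P x))" "sqint (lebesgue_on W) (\<lambda>x. snd (P x))"
    using P by (auto simp: H1_jet_def intro: sqint_fst_snd)
  have "energy_form W \<Lambda> P P = (\<integral>x. (norm (snd (P x)))\<^sup>2 - \<Lambda> * (norm (fst (P x)))\<^sup>2 \<partial>lebesgue_on W)"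
    unfolding energy_form_def energy_map_def
    by (rule Bochner_Integration.integral_cong) (auto simp: inner_prod_def dot_square_norm power2_eq_square algebra_simps)
  also have "\<dots> = N2 (lebesgue_on W) (\<lambda>x. snd (P x)) - \<Lambda> * L2norm2 W (\<lambda>x. fst (P x))"
    unfolding N2_def L2norm2_def using s by (simp add: sqint_def)
  finally show ?thesis using dirichlet_energy_jet[OF P] by simp
qed

lemma H1dist2_jet:
  assumes P: "H1_jet W P" and w: "C1c w gw"
  shows "H1dist2 W w (\<lambda>x. fst (P x)) = N2 (lebesgue_on W) (\<lambda>x. jet w gw x - P x)"
proof -
  have d: "H1_jet W (\<lambda>x. jet w gw x - P x)"
    by (rule H1_jet_diff[OF lmeasurable_W C1c_H1_jet[OF lmeasurable_W w] P])
  then have s: "sqint (lebesgue_on W) (\<lambda>x. fst (jet w gw x - P x))" "sqint (lebesgue_on W) (\<lambda>x. snd (jet w gw x - P x))"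
    by (auto simp: H1_jet_def simp del: fst_diff snd_diff intro: sqint_fst_snd)
  have "H1dist2 W w (\<lambda>x. fst (P x)) = L2norm2 W (\<lambda>x. fst (jet w gw x - P x)) + dirichlet_energy W (\<lambda>x. fst (jet w gw x - P x))"
    by (simp add: H1dist2_def jet_def)
  also have "\<dots> = N2 (lebesgue_on W) (\<lambda>x. fst (jet w gw x - P x)) + N2 (lebesgue_on W) (\<lambda>x. snd (jet w gw x - P x))"
    unfolding dirichlet_energy_jet[OF d] by (simp add: L2norm2_def N2_def)
  also have "\<dots> = N2 (lebesgue_on W) (\<lambda>x. jet w gw x - P x)"
  proof -
    have "jet (\<lambda>x. fst (jet w gw x - P x)) (\<lambda>x. snd (jet w gw x - P x)) = (\<lambda>x. jet w gw x - P x)"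
      by (simp add: jet_def fun_eq_iff prod_eq_iff)
    then show ?thesis using sqint_Pair(2)[OF s] by (simp only:)
  qed
  finally show ?thesis .
qed

lemma H1dist2_tendsto_iff:
  assumes P: "H1_jet W P" and w: "\<And>n. C1c (w n) (gw n)"
  shows "(\<lambda>n. H1dist2 W (w n) (\<lambda>x. fst (P x))) \<longlonglongrightarrow> 0 \<longleftrightarrow> L2lim (lebesgue_on W) (\<lambda>n. jet (w n) (gw n)) P"
  using H1dist2_jet[OF P w] sqint_jet[OF w lmeasurable_W] P by (simp add: L2lim_def H1_jet_def)

lemma trace_onD:
  assumes "trace_on W \<Gamma> (\<lambda>x. fst (P x)) f" "H1_jet W P"
  obtains w gw where "\<And>n. C1c (w n) (gw n)" "L2lim (lebesgue_on W) (\<lambda>n. jet (w n) (gw n)) P"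
    "(\<lambda>n. integral\<^sup>L (surf \<Gamma>) (\<lambda>x. (w n x - f x)\<^sup>2)) \<longlonglongrightarrow> 0"
proof -
  obtain w gw where w: "\<And>n. C1c (w n) (gw n)" "(\<lambda>n. H1dist2 W (w n) (\<lambda>x. fst (P x))) \<longlonglongrightarrow> 0"
    "(\<lambda>n. integral\<^sup>L (surf \<Gamma>) (\<lambda>x. (w n x - f x)\<^sup>2)) \<longlonglongrightarrow> 0"
    using assms(1) unfolding trace_on_def by blast
  show thesis
    by (rule that[OF w(1) _ w(3)]) (rule iffD1[OF H1dist2_tendsto_iff[OF assms(2) w(1)] w(2)])
qed

lemma trace_onI:
  assumes "\<And>n. C1c (w n) (gw n)" "L2lim (lebesgue_on W) (\<lambda>n. jet (w n) (gw n)) P" "L2_surf \<Gamma> f"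
    "(\<lambda>n. integral\<^sup>L (surf \<Gamma>) (\<lambda>x. (w n x - f x)\<^sup>2)) \<longlonglongrightarrow> 0"
  shows "trace_on W \<Gamma> (\<lambda>x. fst (P x)) f"
proof -
  have P: "H1_jet W P" by (rule L2lim_jets_H1[OF lmeasurable_W assms(1,2)])
  have "(\<lambda>n. H1dist2 W (w n) (\<lambda>x. fst (P x))) \<longlonglongrightarrow> 0"
    by (rule iffD2[OF H1dist2_tendsto_iff[OF P assms(1)] assms(2)])
  then show ?thesis unfolding trace_on_def using H1_jet_imp_H1[OF P] assms(1,3,4) by blast
qed

lemma weak_equation_jet:
  assumes P: "H1_jet W P" and \<phi>: "C1c \<phi> g"
  shows "(\<integral>x. wgrad W (\<lambda>x. fst (P x)) x \<bullet> g x \<partial>lebesgue_on W) = \<Lambda> * (\<integral>x. fst (P x) * \<phi> x \<partial>lebesgue_on W)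
    \<longleftrightarrow> energy_form W \<Lambda> P (jet \<phi> g) = 0"
proof -
  have s: "sqint (lebesgue_on W) (\<lambda>x. fst (P x))" "sqint (lebesgue_on W) (\<lambda>x. snd (P x))"
    using P by (auto simp: H1_jet_def intro: sqint_fst_snd)
  have sj: "sqint (lebesgue_on W) (\<lambda>x. \<phi> x)" "sqint (lebesgue_on W) (\<lambda>x. g x)"
    using sqint_fst_snd[OF sqint_jet[OF \<phi> lmeasurable_W]] by (auto simp: jet_def)
  have i: "integrable (lebesgue_on W) (\<lambda>x. fst (P x) * \<phi> x)" "integrable (lebesgue_on W) (\<lambda>x. snd (P x) \<bullet> g x)"
    using sqint_inner[OF s(1) sj(1)] sqint_inner[OF s(2) sj(2)] by auto
  have m: "wgrad W (\<lambda>x. fst (P x)) \<in> borel_measurable (lebesgue_on W)"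
    using H1_weak_grad[OF H1_jet_imp_H1[OF P]] by (simp add: weak_grad_def)
  have "(\<integral>x. wgrad W (\<lambda>x. fst (P x)) x \<bullet> g x \<partial>lebesgue_on W) = (\<integral>x. snd (P x) \<bullet> g x \<partial>lebesgue_on W)"
  proof (rule integral_cong_AE)
    show "(\<lambda>x. wgrad W (\<lambda>x. fst (P x)) x \<bullet> g x) \<in> borel_measurable (lebesgue_on W)"
      using m sqint_measurable[OF sj(2)] by measurable
    show "AE x in lebesgue_on W. wgrad W (\<lambda>x. fst (P x)) x \<bullet> g x = snd (P x) \<bullet> g x"
      using wgrad_AE[OF P] by (auto elim!: eventually_mono)
  qed (use i in simp)
  moreover have "energy_form W \<Lambda> P (jet \<phi> g) = (\<integral>x. snd (P x) \<bullet> g x - \<Lambda> * (fst (P x) * \<phi> x) \<partial>lebesgue_on W)"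
    unfolding energy_form_def energy_map_def jet_def
    by (rule Bochner_Integration.integral_cong) (auto simp: inner_prod_def algebra_simps)
  ultimately show ?thesis using i by simp
qed

end

section \<open>The energy form\<close>

lemma energy_map_simps:
  "energy_map \<Lambda> (x + y) = energy_map \<Lambda> x + energy_map \<Lambda> y"
  "energy_map \<Lambda> (x - y) = energy_map \<Lambda> x - energy_map \<Lambda> y"
  "energy_map \<Lambda> (c *\<^sub>R x) = c *\<^sub>R energy_map \<Lambda> x"
  by (auto simp: energy_map_def prod_eq_iff algebra_simps)

lemma energy_map_sym: "x \<bullet> energy_map \<Lambda> y = energy_map \<Lambda> x \<bullet> y"
  by (auto simp: energy_map_def inner_prod_def)

lemma norm_fst_snd_le: "norm (fst v) \<le> norm v" "norm (snd v) \<le> norm v"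
  for v :: "'b::real_normed_vector \<times> 'c::real_normed_vector"
  by (metis norm_fst_le prod.collapse) (metis norm_snd_le prod.collapse)

lemma energy_map_norm: "norm (energy_map \<Lambda> v) \<le> (\<bar>\<Lambda>\<bar> + 1) * norm v"
proof -
  have "norm (energy_map \<Lambda> v) \<le> \<bar>\<Lambda>\<bar> * norm (fst v) + norm (snd v)"
    unfolding energy_map_def by (rule order.trans[OF norm_Pair_le]) (simp add: abs_mult)
  also have "\<dots> \<le> \<bar>\<Lambda>\<bar> * norm v + norm v"
    by (intro add_mono mult_left_mono norm_fst_snd_le) auto
  finally show ?thesis by (simp add: algebra_simps)
qed

lemma continuous_energy_map: "continuous_on UNIV (energy_map \<Lambda>)"
  unfolding energy_map_def by (intro continuous_intros)

lemma energy_map_measurable: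
  "Q \<in> borel_measurable M \<Longrightarrow> (\<lambda>x. energy_map \<Lambda> (Q x)) \<in> borel_measurable M"
  by (rule measurable_compose[OF _ borel_measurable_continuous_onI[OF continuous_energy_map]])

lemma sqint_energy_map: "sqint M Q \<Longrightarrow> sqint M (\<lambda>x. energy_map \<Lambda> (Q x))"
  using sqint_bound(1)[OF _ energy_map_measurable energy_map_norm] sqint_measurable by blast

lemma L2lim_energy_map:
  assumes "L2lim M q Q" shows "L2lim M (\<lambda>n x. energy_map \<Lambda> (q n x)) (\<lambda>x. energy_map \<Lambda> (Q x))"
proof (rule L2lim_bound[OF assms, where K = "\<bar>\<Lambda>\<bar> + 1"])
  show "norm (energy_map \<Lambda> (q n x) - energy_map \<Lambda> (Q x)) \<le> (\<bar>\<Lambda>\<bar> + 1) * norm (q n x - Q x)" for n x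
    using energy_map_norm[of \<Lambda> "q n x - Q x"] by (simp add: energy_map_simps)
  show "(\<lambda>x. energy_map \<Lambda> (q n x)) \<in> borel_measurable M" for n
    by (rule energy_map_measurable[OF sqint_measurable[OF L2limD(1)[OF assms]]])
  show "(\<lambda>x. energy_map \<Lambda> (Q x)) \<in> borel_measurable M"
    by (rule energy_map_measurable[OF sqint_measurable[OF L2limD(2)[OF assms]]])
qed (rule energy_map_norm)+

lemma energy_form_integrable:
  "sqint (lebesgue_on W) P \<Longrightarrow> sqint (lebesgue_on W) Q \<Longrightarrow>
    integrable (lebesgue_on W) (\<lambda>x. P x \<bullet> energy_map \<Lambda> (Q x))"
  by (rule sqint_inner[OF _ sqint_energy_map])

lemma energy_form_sym: "energy_form W \<Lambda> P Q = energy_form W \<Lambda> Q P"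
proof -
  have "P x \<bullet> energy_map \<Lambda> (Q x) = Q x \<bullet> energy_map \<Lambda> (P x)" for x
    by (metis energy_map_sym inner_commute)
  then show ?thesis by (simp only: energy_form_def)
qed

lemma energy_form_add_left:
  assumes "sqint (lebesgue_on W) P" "sqint (lebesgue_on W) Q" "sqint (lebesgue_on W) R"
  shows "energy_form W \<Lambda> (\<lambda>x. P x + Q x) R = energy_form W \<Lambda> P R + energy_form W \<Lambda> Q R"
  unfolding energy_form_def inner_add_left
  by (intro Bochner_Integration.integral_add energy_form_integrable assms)

lemma energy_form_scale_left:
  "energy_form W \<Lambda> (\<lambda>x. c *\<^sub>R P x) R = c * energy_form W \<Lambda> P R"
  unfolding energy_form_def by simp

lemma energy_form_L2lim:
  assumes "L2lim (lebesgue_on W) p P" "L2lim (lebesgue_on W) q Q"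
  shows "(\<lambda>n. energy_form W \<Lambda> (p n) (q n)) \<longlonglongrightarrow> energy_form W \<Lambda> P Q"
  unfolding energy_form_def by (rule L2lim_inner[OF assms(1) L2lim_energy_map[OF assms(2)]])

lemma energy_form_expand:
  assumes "sqint (lebesgue_on W) P" "sqint (lebesgue_on W) Q"
  shows "energy_form W \<Lambda> (\<lambda>x. P x + s *\<^sub>R Q x) (\<lambda>x. P x + s *\<^sub>R Q x) =
    energy_form W \<Lambda> P P + 2 * s * energy_form W \<Lambda> P Q + s\<^sup>2 * energy_form W \<Lambda> Q Q"
proof -
  have sQ: "sqint (lebesgue_on W) (\<lambda>x. s *\<^sub>R Q x)" using assms by (intro sqint_scaleR)
  have s: "sqint (lebesgue_on W) (\<lambda>x. P x + s *\<^sub>R Q x)" using assms sQ by (intro sqint_add)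
  have l: "energy_form W \<Lambda> (\<lambda>x. P x + s *\<^sub>R Q x) R = energy_form W \<Lambda> P R + s * energy_form W \<Lambda> Q R"
    if "sqint (lebesgue_on W) R" for R
    using energy_form_add_left[OF assms(1) sQ that] by (simp add: energy_form_scale_left)
  show ?thesis
    unfolding l[OF s] using l[OF assms(1)] l[OF assms(2)]
    by (simp add: energy_form_sym[of _ _ _ "\<lambda>x. P x + s *\<^sub>R Q x"] energy_form_sym[of _ _ Q P]
        power2_eq_square algebra_simps)
qed

text \<open>A minimising sequence of a coercive quadratic functional is Cauchy by the parallelogram law.\<close>
lemma energy_projection:
  assumes W: "W \<in> lmeasurable" and T: "\<And>t. t \<in> T \<Longrightarrow> sqint (lebesgue_on W) t"
    and add: "\<And>s t. s \<in> T \<Longrightarrow> t \<in> T \<Longrightarrow> (\<lambda>x. s x + t x) \<in> T"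
    and scale: "\<And>c t. t \<in> T \<Longrightarrow> (\<lambda>x. c *\<^sub>R t x) \<in> T" and ne: "T \<noteq> {}"
    and c: "c > 0" and coer: "\<And>t. t \<in> T \<Longrightarrow> c * N2 (lebesgue_on W) t \<le> energy_form W \<Lambda> t t"
    and P: "sqint (lebesgue_on W) P"
  shows "\<exists>q Q. (\<forall>n. q n \<in> T) \<and> L2lim (lebesgue_on W) q Q \<and>
    (\<forall>t\<in>T. energy_form W \<Lambda> (\<lambda>x. P x - Q x) t = 0)"
proof -
  interpret finite_measure "lebesgue_on W" using W by (rule finite_measure_lebesgue_on)
  let ?a = "energy_form W \<Lambda>" and ?N = "N2 (lebesgue_on W)"
  define J where "J t = ?a (\<lambda>x. P x - t x) (\<lambda>x. P x - t x)" for t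
  have J_shift: "J (\<lambda>x. s x + r *\<^sub>R t x) = J s - 2 * r * ?a (\<lambda>x. P x - s x) t + r\<^sup>2 * ?a t t"
    if "s \<in> T" "t \<in> T" for s t r
    using energy_form_expand[OF sqint_diff(1)[OF P T[OF that(1)]] T[OF that(2)], of \<Lambda> "- r"]
    by (simp add: J_def algebra_simps)
  \<comment> \<open>Completing the square: \<open>c s^2 - 2 A s\<close> is at least
    \<open>- A^2 / c\<close>, where \<open>s\<close> is the norm of \<open>t\<close>, and
    \<open>A\<close> bounds the linear term by Cauchy-Schwarz.\<close>
  have lower: "?a P P - N2 (lebesgue_on W) (\<lambda>x. energy_map \<Lambda> (P x)) / c \<le> J t" if t: "t \<in> T" for t
  proof -
    let ?A = "sqrt (?N (\<lambda>x. energy_map \<Lambda> (P x)))" and ?s = "sqrt (?N t)"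
    have "J t = ?a P P - 2 * ?a P t + ?a t t"
      using energy_form_expand[OF P T[OF t], of \<Lambda> "- 1"] by (simp add: J_def)
    moreover have "\<bar>?a P t\<bar> \<le> ?A * ?s"
      using L2_Cauchy_Schwarz[OF sqint_energy_map[OF P] T[OF t]] unfolding energy_form_def energy_map_sym .
    moreover have "c * ?s\<^sup>2 \<le> ?a t t" using coer[OF t] by (simp add: N2_nonneg)
    moreover have "0 \<le> (c * ?s - ?A)\<^sup>2 / c" using c by simp
    then have "- (?A\<^sup>2 / c) \<le> c * ?s\<^sup>2 - 2 * (?A * ?s)"
      using c by (simp add: power2_eq_square field_simps)
    moreover have "?A\<^sup>2 = ?N (\<lambda>x. energy_map \<Lambda> (P x))" by (simp add: N2_nonneg)
    ultimately show ?thesis by (simp only:)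
  qed
  define m where "m = Inf (J ` T)"
  have bdd: "bdd_below (J ` T)" using lower by (auto simp: bdd_below_def)
  have m_le: "m \<le> J t" if "t \<in> T" for t unfolding m_def using bdd that by (intro cInf_lower) auto
  have "\<exists>t\<in>T. J t < m + inverse (real (Suc n))" for n
  proof -
    have "m < m + inverse (real (Suc n))" by simp
    then show ?thesis unfolding m_def using cInf_lessD[of "J ` T" "Inf (J ` T) + inverse (real (Suc n))"] ne by auto
  qed
  then obtain q where q: "\<And>n. q n \<in> T" "\<And>n. J (q n) < m + inverse (real (Suc n))" by metis
  have close: "c * ?N (\<lambda>x. q n x - q k x) \<le> 2 * inverse (real (Suc n)) + 2 * inverse (real (Suc k))" for n k
  proof -
    have dT: "(\<lambda>x. q n x - q k x) \<in> T" using add[OF q(1)[of n] scale[OF q(1)[of k], of "-1"]] by simp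
    let ?d = "\<lambda>x. q n x - q k x"
    \<comment> \<open>The midpoint of \<open>q k\<close> and \<open>q n\<close>. Its value is at
      least \<open>m\<close> while the values at both ends are close to \<open>m\<close>, so the
      energy of the difference is small.\<close>
    have mid: "(\<lambda>x. q k x + (1/2) *\<^sub>R ?d x) \<in> T" by (rule add[OF q(1) scale[OF dT]])
    have "J (\<lambda>x. q k x + 1 *\<^sub>R ?d x) = J (q n)" by simp
    then have "J (q n) = J (q k) - 2 * ?a (\<lambda>x. P x - q k x) ?d + ?a ?d ?d"
      using J_shift[OF q(1) dT, of k 1] by simp
    moreover have "J (\<lambda>x. q k x + (1/2) *\<^sub>R ?d x) = J (q k) - ?a (\<lambda>x. P x - q k x) ?d + (1/4) * ?a ?d ?d"
      using J_shift[OF q(1) dT, of k "1/2"] by (simp add: power2_eq_square)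
    ultimately have "?a ?d ?d = 2 * J (q n) + 2 * J (q k) - 4 * J (\<lambda>x. q k x + (1/2) *\<^sub>R ?d x)"
      by linarith
    then show ?thesis using m_le[OF mid] q(2)[of n] q(2)[of k] coer[OF dT] by linarith
  qed
  have "\<exists>Q. L2lim (lebesgue_on W) q Q"
  proof (rule L2_complete[OF T[OF q(1)]])
    fix e :: real assume e: "e > 0"
    obtain n0 where n0: "inverse (real (Suc n0)) < c * e / 4"
      using reals_Archimedean[of "c * e / 4"] e c by auto
    have "?N (\<lambda>x. q m x - q n x) < e" if "m \<ge> n0" "n \<ge> n0" for m n
    proof -
      have "inverse (real (Suc m)) \<le> inverse (real (Suc n0))" "inverse (real (Suc n)) \<le> inverse (real (Suc n0))"
        using that by (auto intro!: le_imp_inverse_le)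
      then have "c * ?N (\<lambda>x. q m x - q n x) < c * e" using close[of m n] n0 by linarith
      then show ?thesis using c by simp
    qed
    then show "\<exists>n0. \<forall>m\<ge>n0. \<forall>n\<ge>n0. ?N (\<lambda>x. q m x - q n x) < e" by blast
  qed
  then obtain Q where Q: "L2lim (lebesgue_on W) q Q" by blast
  have "?a (\<lambda>x. P x - Q x) t = 0" if t: "t \<in> T" for t
  proof -
    have lim: "(\<lambda>n. ?a (\<lambda>x. P x - q n x) t) \<longlonglongrightarrow> ?a (\<lambda>x. P x - Q x) t"
      by (rule energy_form_L2lim[OF L2lim_diff[OF L2lim_const[OF P] Q] L2lim_const[OF T[OF t]]])
    \<comment> \<open>The first variation: moving from \<open>q n\<close> in the direction
      \<open>t\<close> cannot bring \<open>J\<close> below \<open>m\<close>. In the limit the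
      constant term disappears, and a quadratic without constant term that stays nonnegative has no
      linear term.\<close>
    have "0 \<le> 0 + 2 * r * ?a (\<lambda>x. P x - Q x) t + r\<^sup>2 * ?a t t" for r
    proof -
      have "0 \<le> inverse (real (Suc n)) + 2 * r * ?a (\<lambda>x. P x - q n x) t + r\<^sup>2 * ?a t t" for n
        using m_le[OF add[OF q(1)[of n] scale[OF t, of "- r"]]] J_shift[OF q(1)[of n] t, of "- r"] q(2)[of n]
        by simp
      moreover have "(\<lambda>n. inverse (real (Suc n)) + 2 * r * ?a (\<lambda>x. P x - q n x) t + r\<^sup>2 * ?a t t)
        \<longlonglongrightarrow> 0 + 2 * r * ?a (\<lambda>x. P x - Q x) t + r\<^sup>2 * ?a t t"
        by (intro tendsto_intros lim LIMSEQ_inverse_real_of_nat)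
      ultimately show ?thesis by (intro LIMSEQ_le_const) auto
    qed
    then have "(?a (\<lambda>x. P x - Q x) t)\<^sup>2 \<le> 0 * ?a t t"
      by (rule quadratic_nonneg_imp) (use coer[OF t] c N2_nonneg[of "lebesgue_on W" t] in \<open>meson mult_nonneg_nonneg less_imp_le order.trans\<close>)
    then show ?thesis by simp
  qed
  then show ?thesis using q Q by blast
qed

section \<open>Spaces of test jets and gluing\<close>

definition tests :: "'a::euclidean_space set \<Rightarrow> ('a \<Rightarrow> real \<times> 'a) set" where
  "tests S = {jet \<phi> g | \<phi> g. C1c \<phi> g \<and> tsupp \<phi> \<inter> S = {}}"

text \<open>The closure in H1 of the C1 functions vanishing near \<open>S\<close>. It stands for the
  condition of zero boundary values on \<open>S\<close>; for \<open>S = {}\<close> only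
  approximability by C1 functions on the whole space remains.\<close>

definition H1_cl :: "'a::euclidean_space set \<Rightarrow> 'a set \<Rightarrow> ('a \<Rightarrow> real \<times> 'a) \<Rightarrow> bool" where
  "H1_cl W S P \<longleftrightarrow> (\<exists>q. (\<forall>n. q n \<in> tests S) \<and> L2lim (lebesgue_on W) q P)"

lemma testsI: "C1c \<phi> g \<Longrightarrow> tsupp \<phi> \<inter> S = {} \<Longrightarrow> jet \<phi> g \<in> tests S"
  by (auto simp: tests_def)

lemma tests_add: "s \<in> tests S \<Longrightarrow> t \<in> tests S \<Longrightarrow> (\<lambda>x. s x + t x) \<in> tests S"
proof -
  assume "s \<in> tests S" "t \<in> tests S"
  then obtain \<phi> g \<psi> h where *: "s = jet \<phi> g" "t = jet \<psi> h" "C1c \<phi> g" "C1c \<psi> h" "tsupp \<phi> \<inter> S = {}" "tsupp \<psi> \<inter> S = {}"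
    by (auto simp: tests_def)
  have "(\<lambda>x. s x + t x) = jet (\<lambda>x. \<phi> x + \<psi> x) (\<lambda>x. g x + h x)" using * by (simp add: jet_def fun_eq_iff)
  then show ?thesis using * tsupp_add[of \<phi> \<psi>] by (auto intro!: testsI C1c_add)
qed

lemma tests_scale: "t \<in> tests S \<Longrightarrow> (\<lambda>x. c *\<^sub>R t x) \<in> tests S"
proof -
  assume "t \<in> tests S"
  then obtain \<psi> h where *: "t = jet \<psi> h" "C1c \<psi> h" "tsupp \<psi> \<inter> S = {}"
    by (auto simp: tests_def)
  have "(\<lambda>x. c *\<^sub>R t x) = jet (\<lambda>x. c * \<psi> x) (\<lambda>x. c *\<^sub>R h x)" using * by (simp add: jet_def fun_eq_iff)
  then show ?thesis using * tsupp_scale[of c \<psi>] by (auto intro!: testsI C1c_scale)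
qed

lemma tests_diff: "s \<in> tests S \<Longrightarrow> t \<in> tests S \<Longrightarrow> (\<lambda>x. s x - t x) \<in> tests S"
  using tests_add[OF _ tests_scale[of t S "-1"], of s] by simp

lemma tests_zero: "(\<lambda>_. 0) \<in> tests S"
  using testsI[OF C1c_zero, of S] by (simp add: tsupp_zero jet_def[abs_def] zero_prod_def)

lemma tests_mono: "S \<subseteq> S' \<Longrightarrow> tests S' \<subseteq> tests S"
  by (auto simp: tests_def)

lemma sqint_tests: "t \<in> tests S \<Longrightarrow> W \<in> lmeasurable \<Longrightarrow> sqint (lebesgue_on W) t"
  by (auto simp: tests_def sqint_jet)

lemma tests_eq_0: "t \<in> tests S \<Longrightarrow> x \<in> S \<Longrightarrow> t x = 0"
  using C1c_outside_tsupp by (fastforce simp: tests_def jet_def zero_prod_def)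

lemma H1_cl_mono: "S \<subseteq> S' \<Longrightarrow> H1_cl W S' P \<Longrightarrow> H1_cl W S P"
  unfolding H1_cl_def using tests_mono by blast

lemma L2lim_tests_H1:
  assumes W: "W \<in> lmeasurable" and q: "\<And>n. q n \<in> tests S" and lim: "L2lim (lebesgue_on W) q P"
  shows "H1_jet W P"
proof -
  have "\<forall>n. \<exists>\<phi> g. q n = jet \<phi> g \<and> C1c \<phi> g" using q by (fastforce simp: tests_def)
  then obtain \<phi> g where *: "\<And>n. q n = jet (\<phi> n) (g n)" "\<And>n. C1c (\<phi> n) (g n)" by metis
  then have "q = (\<lambda>n. jet (\<phi> n) (g n))" by auto
  then show ?thesis using L2lim_jets_H1[OF W *(2)] lim by simp
qed

lemma H1_cl_imp_H1_jet: "W \<in> lmeasurable \<Longrightarrow> H1_cl W S P \<Longrightarrow> H1_jet W P"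
  unfolding H1_cl_def using L2lim_tests_H1 by blast

lemma H1_cl_sqint: "H1_cl W S P \<Longrightarrow> sqint (lebesgue_on W) P"
  unfolding H1_cl_def using L2limD(2) by blast

lemma H1_cl_add: "H1_cl W S P \<Longrightarrow> H1_cl W S Q \<Longrightarrow> H1_cl W S (\<lambda>x. P x + Q x)"
  unfolding H1_cl_def
proof (elim exE conjE)
  fix p q assume "\<forall>n. p n \<in> tests S" "L2lim (lebesgue_on W) p P" "\<forall>n. q n \<in> tests S" "L2lim (lebesgue_on W) q Q"
  then show "\<exists>r. (\<forall>n. r n \<in> tests S) \<and> L2lim (lebesgue_on W) r (\<lambda>x. P x + Q x)"
    by (intro exI[of _ "\<lambda>n x. p n x + q n x"]) (auto intro: tests_add L2lim_add)
qed

lemma H1_cl_scale: "H1_cl W S P \<Longrightarrow> H1_cl W S (\<lambda>x. c *\<^sub>R P x)"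
  unfolding H1_cl_def
proof (elim exE conjE)
  fix p assume "\<forall>n. p n \<in> tests S" "L2lim (lebesgue_on W) p P"
  then show "\<exists>r. (\<forall>n. r n \<in> tests S) \<and> L2lim (lebesgue_on W) r (\<lambda>x. c *\<^sub>R P x)"
    by (intro exI[of _ "\<lambda>n x. c *\<^sub>R p n x"]) (auto intro: tests_scale L2lim_scaleR)
qed

lemma H1_cl_diff: "H1_cl W S P \<Longrightarrow> H1_cl W S Q \<Longrightarrow> H1_cl W S (\<lambda>x. P x - Q x)"
  using H1_cl_add[OF _ H1_cl_scale[of W S Q "-1"], of P] by simp

lemma H1_cl_zero: "H1_cl W S (\<lambda>_. 0)"
  unfolding H1_cl_def using L2lim_const[OF sqint_zero(1)] tests_zero by fast

section \<open>Multiplication of jets by cutoffs, and gluing\<close>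

definition jet_mul :: "('a \<Rightarrow> real) \<Rightarrow> ('a \<Rightarrow> 'a) \<Rightarrow> ('a \<Rightarrow> real \<times> 'a) \<Rightarrow> 'a \<Rightarrow> real \<times> 'a::euclidean_space" where
  "jet_mul \<eta> h P x = (\<eta> x * fst (P x), \<eta> x *\<^sub>R snd (P x) + fst (P x) *\<^sub>R h x)"

lemma jet_mul_jet: "jet_mul \<eta> h (jet \<phi> g) = jet (\<lambda>x. \<eta> x * \<phi> x) (\<lambda>x. \<eta> x *\<^sub>R g x + \<phi> x *\<^sub>R h x)"
  by (simp add: jet_mul_def jet_def fun_eq_iff)

lemma jet_mul_diff: "jet_mul \<eta> h P x - jet_mul \<eta> h Q x = jet_mul \<eta> h (\<lambda>x. P x - Q x) x"
  by (simp add: jet_mul_def algebra_simps)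

lemma norm_jet_mul_le:
  assumes "\<bar>\<eta> x\<bar> \<le> B" "norm (h x) \<le> B"
  shows "norm (jet_mul \<eta> h P x) \<le> 3 * B * norm (P x)"
proof -
  have f: "\<bar>fst (P x)\<bar> \<le> norm (P x)" "norm (snd (P x)) \<le> norm (P x)"
    using norm_fst_snd_le[of "P x"] by auto
  have B: "B \<ge> 0" using assms by linarith
  have "norm (jet_mul \<eta> h P x) \<le> \<bar>\<eta> x\<bar> * \<bar>fst (P x)\<bar> + (\<bar>\<eta> x\<bar> * norm (snd (P x)) + \<bar>fst (P x)\<bar> * norm (h x))"
    unfolding jet_mul_def
    by (rule order.trans[OF norm_Pair_le]) (auto simp: abs_mult intro!: order.trans[OF norm_triangle_ineq])
  also have "\<dots> \<le> B * norm (P x) + (B * norm (P x) + norm (P x) * B)"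
    by (intro add_mono mult_mono assms f B) auto
  finally show ?thesis by (simp add: algebra_simps)
qed

lemma jet_mul_measurable:
  assumes "C1 \<eta> h" "P \<in> borel_measurable (lebesgue_on W)"
  shows "jet_mul \<eta> h P \<in> borel_measurable (lebesgue_on W)"
proof -
  have m: "(\<lambda>x. fst (P x)) \<in> borel_measurable (lebesgue_on W)" "(\<lambda>x. snd (P x)) \<in> borel_measurable (lebesgue_on W)"
    using assms(2) by (auto intro!: measurable_compose[OF assms(2)] borel_measurable_continuous_onI continuous_intros)
  show ?thesis unfolding jet_mul_def[abs_def]
    by (intro borel_measurable_Pair borel_measurable_add borel_measurable_scaleR borel_measurable_times
        C1_measurable[OF assms(1)] m)
qed

lemma L2lim_jet_mul:
  assumes \<eta>: "C1c \<eta> h" and q: "L2lim (lebesgue_on W) q P"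
  shows "L2lim (lebesgue_on W) (\<lambda>n. jet_mul \<eta> h (q n)) (jet_mul \<eta> h P)"
proof -
  obtain B where B: "B > 0" "\<And>x. \<bar>\<eta> x\<bar> \<le> B" "\<And>x. norm (h x) \<le> B" using C1c_bounded[OF \<eta>] by blast
  have C: "C1 \<eta> h" using \<eta> by (simp add: C1c_iff)
  show ?thesis
    by (rule L2lim_bound[OF q, where K = "3 * B"])
      (use jet_mul_measurable[OF C] norm_jet_mul_le[of \<eta> _ B h] B L2limD[OF q] in
        \<open>auto simp: jet_mul_diff intro: sqint_measurable\<close>)
qed

text \<open>The common estimate behind extension by zero, restriction and gluing, where the two
  functions live on different domains.\<close>

lemma N2_transfer:
  assumes f: "sqint (lebesgue_on Wa) f" and g: "sqint (lebesgue_on Wb) g"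
    and W: "Wa \<in> sets lebesgue" "Wb \<in> sets lebesgue"
    and le: "\<And>x. x \<in> Wa \<Longrightarrow> x \<in> Wb \<Longrightarrow> norm (f x) \<le> K * norm (g x)" "\<And>x. x \<in> Wa \<Longrightarrow> x \<notin> Wb \<Longrightarrow> f x = 0"
  shows "N2 (lebesgue_on Wa) f \<le> K\<^sup>2 * N2 (lebesgue_on Wb) g"
proof -
  have i: "integrable lebesgue (\<lambda>x. indicator Wa x *\<^sub>R (norm (f x))\<^sup>2)"
    "integrable lebesgue (\<lambda>x. indicator Wb x *\<^sub>R (norm (g x))\<^sup>2)"
    using f g W by (auto simp: sqint_def integrable_restrict_space)
  have "N2 (lebesgue_on Wa) f = (\<integral>x. indicator Wa x *\<^sub>R (norm (f x))\<^sup>2 \<partial>lebesgue)"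
    unfolding N2_def by (rule integral_restrict_space) (use W in auto)
  also have "\<dots> \<le> (\<integral>x. K\<^sup>2 * (indicator Wb x *\<^sub>R (norm (g x))\<^sup>2) \<partial>lebesgue)"
  proof (rule integral_mono)
    fix x
    show "indicator Wa x *\<^sub>R (norm (f x))\<^sup>2 \<le> K\<^sup>2 * (indicator Wb x *\<^sub>R (norm (g x))\<^sup>2)"
      using power_mono[OF le(1)[of x] norm_ge_zero, of 2] le(2)[of x]
      by (cases "x \<in> Wa"; cases "x \<in> Wb") (auto simp: power_mult_distrib)
  qed (use i in auto)
  also have "\<dots> = K\<^sup>2 * (\<integral>x. indicator Wb x *\<^sub>R (norm (g x))\<^sup>2 \<partial>lebesgue)" by simp
  also have "(\<integral>x. indicator Wb x *\<^sub>R (norm (g x))\<^sup>2 \<partial>lebesgue) = N2 (lebesgue_on Wb) g"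
    unfolding N2_def by (rule integral_restrict_space[symmetric]) (use W in auto)
  finally show ?thesis .
qed

text \<open>The jet of \<open>\<eta> u + (1 - \<eta>) v\<close>, where \<open>p\<close> is the jet
  of \<open>u\<close> and \<open>w\<close> that of \<open>v\<close>: it follows \<open>p\<close> on
  the plateau of \<open>\<eta>\<close> and \<open>w\<close> off its support.\<close>

definition glue :: "('a \<Rightarrow> real) \<Rightarrow> ('a \<Rightarrow> 'a) \<Rightarrow> ('a \<Rightarrow> real \<times> 'a) \<Rightarrow> ('a \<Rightarrow> real \<times> 'a) \<Rightarrow> 'a \<Rightarrow> real \<times> 'a::euclidean_space" where
  "glue \<eta> h p w x = jet_mul \<eta> h p x + (w x - jet_mul \<eta> h w x)"

text \<open>Near a point of the plateau the glued function is the one from \<open>p\<close>, near a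
  point off the support it is the one from \<open>w\<close>; each of them has to vanish only near
  its own share of \<open>S\<close>.\<close>

lemma glue_tests:
  assumes \<eta>: "C1c \<eta> h" and V: "open V" "\<And>x. x \<in> V \<Longrightarrow> \<eta> x = 1"
    and p: "p \<in> tests A" and w: "w \<in> tests B"
    and S: "\<And>x. x \<in> S \<Longrightarrow> (x \<in> V \<and> x \<in> A) \<or> (x \<notin> tsupp \<eta> \<and> x \<in> B)"
  shows "glue \<eta> h p w \<in> tests S"
proof -
  have C: "C1 \<eta> h" using \<eta> by (simp add: C1c_iff)
  obtain \<phi> g \<psi> k where *: "p = jet \<phi> g" "w = jet \<psi> k" "C1c \<phi> g" "C1c \<psi> k" "tsupp \<phi> \<inter> A = {}" "tsupp \<psi> \<inter> B = {}"
    using p w by (auto simp: tests_def)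
  let ?f = "\<lambda>x. \<eta> x * \<phi> x + (\<psi> x + (- 1) * (\<eta> x * \<psi> x))"
  let ?g = "\<lambda>x. (\<eta> x *\<^sub>R g x + \<phi> x *\<^sub>R h x) + (k x + (- 1) *\<^sub>R (\<eta> x *\<^sub>R k x + \<psi> x *\<^sub>R h x))"
  have "glue \<eta> h p w = jet ?f ?g"
    unfolding glue_def[abs_def] *(1,2) jet_mul_jet by (simp add: jet_def fun_eq_iff)
  moreover have "C1c ?f ?g" by (intro C1c_add C1c_scale C1c_mult C *)
  moreover have "x \<notin> tsupp ?f" if x: "x \<in> S" for x
    using S[OF x]
  proof
    assume a: "x \<in> V \<and> x \<in> A"
    then have "\<forall>\<^sub>F y in nhds x. y \<in> V" "\<forall>\<^sub>F y in nhds x. \<phi> y = 0"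
      using V(1) eventually_nhds[of "\<lambda>y. y \<in> V" x] *(5) not_in_tsupp_iff[of x \<phi>] by blast+
    then have "\<forall>\<^sub>F y in nhds x. ?f y = 0" by eventually_elim (use V(2) in simp)
    then show ?thesis by (simp add: not_in_tsupp_iff)
  next
    assume a: "x \<notin> tsupp \<eta> \<and> x \<in> B"
    then have "\<forall>\<^sub>F y in nhds x. \<eta> y = 0" "\<forall>\<^sub>F y in nhds x. \<psi> y = 0"
      using *(6) not_in_tsupp_iff[of x \<psi>] not_in_tsupp_iff[of x \<eta>] by blast+
    then have "\<forall>\<^sub>F y in nhds x. ?f y = 0" by eventually_elim simp
    then show ?thesis by (simp add: not_in_tsupp_iff)
  qed
  ultimately show ?thesis by (auto intro!: testsI)
qed

lemma glue_on_plateau: "open V \<Longrightarrow> (\<And>x. x \<in> V \<Longrightarrow> \<eta> x = 1) \<Longrightarrow> x \<in> V \<Longrightarrow> fst (glue \<eta> h p w x) = fst (p x)"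
  by (simp add: glue_def jet_mul_def)

text \<open>The sequence \<open>p\<close> converges on \<open>Wb\<close> and \<open>w\<close> on
  \<open>Wa\<close>. Within \<open>Wa\<close> the support of \<open>\<eta>\<close> lies in
  \<open>Wb\<close>, where the limits agree, so both parts of the glued jet converge on
  \<open>Wa\<close> and their limits add up to \<open>PA\<close>.\<close>

lemma glue_L2lim:
  assumes \<eta>: "C1c \<eta> h" and W: "Wa \<in> lmeasurable" "Wb \<in> lmeasurable"
    and p: "\<And>n. p n \<in> tests S" "L2lim (lebesgue_on Wb) p PB" and w: "L2lim (lebesgue_on Wa) w PA"
    and eq: "\<And>x. x \<in> Wa \<Longrightarrow> x \<in> tsupp \<eta> \<Longrightarrow> x \<in> Wb \<and> PA x = PB x"
  shows "L2lim (lebesgue_on Wa) (\<lambda>n. glue \<eta> h (p n) (w n)) PA"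
proof -
  have C: "C1 \<eta> h" using \<eta> by (simp add: C1c_iff)
  obtain B where B: "B > 0" "\<And>x. \<bar>\<eta> x\<bar> \<le> B" "\<And>x. norm (h x) \<le> B" using C1c_bounded[OF \<eta>] by blast
  have Ws: "Wa \<in> sets lebesgue" "Wb \<in> sets lebesgue" using W by (auto simp: fmeasurableD)
  note jw = L2lim_jet_mul[OF \<eta> w]
  have 1: "L2lim (lebesgue_on Wa) (\<lambda>n. jet_mul \<eta> h (p n)) (jet_mul \<eta> h PA)"
  proof (rule L2limI_le)
    show s1: "sqint (lebesgue_on Wa) (jet_mul \<eta> h (p n))" for n
    proof -
      obtain \<phi> g where "p n = jet \<phi> g" "C1c \<phi> g" using p(1)[of n] by (auto simp: tests_def)
      then show ?thesis using C1c_mult[OF C] sqint_jet[OF _ W(1)] by (simp add: jet_mul_jet)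
    qed
    show s2: "sqint (lebesgue_on Wa) (jet_mul \<eta> h PA)" by (rule L2limD(2)[OF jw])
    show "N2 (lebesgue_on Wa) (\<lambda>x. jet_mul \<eta> h (p n) x - jet_mul \<eta> h PA x)
        \<le> (3 * B)\<^sup>2 * N2 (lebesgue_on Wb) (\<lambda>x. p n x - PB x)" for n
    proof (rule N2_transfer[OF sqint_diff(1)[OF s1 s2] sqint_diff(1)[OF L2limD(1,2)[OF p(2)]] Ws])
      have z: "jet_mul \<eta> h Q x = 0" if "x \<notin> tsupp \<eta>" for Q x
        using C1c_outside_tsupp[OF \<eta> that] by (simp add: jet_mul_def zero_prod_def)
      fix x assume x: "x \<in> Wa"
      show "norm (jet_mul \<eta> h (p n) x - jet_mul \<eta> h PA x) \<le> 3 * B * norm (p n x - PB x)"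
      proof (cases "x \<in> tsupp \<eta>")
        case True
        then show ?thesis using norm_jet_mul_le[of \<eta> x B h "\<lambda>x. p n x - PA x"] B(2,3) eq[OF x]
          by (simp add: jet_mul_diff)
      next
        case False then show ?thesis using B z by simp
      qed
      show "jet_mul \<eta> h (p n) x - jet_mul \<eta> h PA x = 0" if "x \<notin> Wb"
      proof -
        have "x \<notin> tsupp \<eta>" using eq[OF x] that by blast
        then show ?thesis by (simp add: z)
      qed
    qed
    show "(\<lambda>n. (3 * B)\<^sup>2 * N2 (lebesgue_on Wb) (\<lambda>x. p n x - PB x)) \<longlonglongrightarrow> 0"
      using tendsto_mult_left[OF L2limD(3)[OF p(2)], of "(3 * B)\<^sup>2"] by simp
  qed
  show ?thesis using L2lim_add[OF 1 L2lim_diff[OF w jw]] by (simp add: glue_def[abs_def])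
qed

lemma trace_on_tests_iff:
  assumes W: "open W" "bounded W" and P: "H1_jet W P"
  shows "trace_on W \<Gamma> (\<lambda>x. fst (P x)) f \<longleftrightarrow> L2_surf \<Gamma> f \<and>
    (\<exists>q. (\<forall>n. q n \<in> tests {}) \<and> L2lim (lebesgue_on W) q P \<and>
      (\<lambda>n. integral\<^sup>L (surf \<Gamma>) (\<lambda>x. (fst (q n x) - f x)\<^sup>2)) \<longlonglongrightarrow> 0)" (is "?l \<longleftrightarrow> ?r")
proof
  assume l: ?l
  obtain w gw where w: "\<And>n. C1c (w n) (gw n)" "L2lim (lebesgue_on W) (\<lambda>n. jet (w n) (gw n)) P"
    "(\<lambda>n. integral\<^sup>L (surf \<Gamma>) (\<lambda>x. (w n x - f x)\<^sup>2)) \<longlonglongrightarrow> 0"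
    using trace_onD[OF W l P] by blast
  then show ?r using l by (intro conjI exI[of _ "\<lambda>n. jet (w n) (gw n)"]) (auto simp: trace_on_def jet_def intro!: testsI)
next
  assume r: ?r
  then obtain q where q: "\<And>n. q n \<in> tests {}" "L2lim (lebesgue_on W) q P"
     "(\<lambda>n. integral\<^sup>L (surf \<Gamma>) (\<lambda>x. (fst (q n x) - f x)\<^sup>2)) \<longlonglongrightarrow> 0" by blast
  have "\<forall>n. \<exists>\<phi> g. q n = jet \<phi> g \<and> C1c \<phi> g" using q(1) by (fastforce simp: tests_def)
  then obtain \<phi> g where *: "\<And>n. q n = jet (\<phi> n) (g n)" "\<And>n. C1c (\<phi> n) (g n)" by metis
  have qe: "q = (\<lambda>n. jet (\<phi> n) (g n))" using * by auto
  show ?l by (rule trace_onI[OF W *(2)]) (use q r in \<open>auto simp: qe jet_def[of "\<phi> _"]\<close>)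
qed

lemma space_surf: "space (surf \<Gamma>) = \<Gamma>"
  unfolding surf_def by (simp add: space_measure_of_conv)

section \<open>Comparison of two Dirichlet-to-Neumann problems\<close>

text \<open>The traces are chosen by \<open>SOME\<close>. They agree because \<open>V\<close> on \<open>Wb\<close> and the corresponding \<open>W\<close> on
  \<open>Wa\<close> have the same set of admissible traces on \<open>\<Gamma>\<close>, so no trace theorem is needed.\<close>

locale dtn_comparison =
  fixes Wa Wb \<Gamma> Ga Gb Y N :: "'a::euclidean_space set" and \<Lambda> :: real
    and \<eta> :: "'a \<Rightarrow> real" and h :: "'a \<Rightarrow> 'a" and ca cb :: real
  assumes Wa: "open Wa" "bounded Wa" and Wb: "open Wb" "bounded Wb"
    and \<eta>: "C1c \<eta> h" and N: "open N" "\<Gamma> \<subseteq> N" "\<And>x. x \<in> N \<Longrightarrow> \<eta> x = 1"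
    and supp: "\<And>x. x \<in> tsupp \<eta> \<Longrightarrow> x \<in> Wa \<longleftrightarrow> x \<in> Wb" "\<And>x. x \<in> tsupp \<eta> \<Longrightarrow> x \<in> Wb \<Longrightarrow> x \<in> Y"
      "tsupp \<eta> \<inter> (Ga \<union> Gb) = {}"
    and coercive_a: "ca > 0" "\<And>t. t \<in> tests (\<Gamma> \<union> Ga) \<Longrightarrow> ca * N2 (lebesgue_on Wa) t \<le> energy_form Wa \<Lambda> t t"
    and coercive_b: "cb > 0" "\<And>t. t \<in> tests (\<Gamma> \<union> Gb) \<Longrightarrow> cb * N2 (lebesgue_on Wb) t \<le> energy_form Wb \<Lambda> t t"
    and extension: "\<And>P. H1_cl Wb Gb P \<Longrightarrow> H1_cl Wa Ga (\<lambda>x. if x \<in> Y then P x else 0) \<and>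
      energy_form Wa \<Lambda> (\<lambda>x. if x \<in> Y then P x else 0) (\<lambda>x. if x \<in> Y then P x else 0) \<le> energy_form Wb \<Lambda> P P"
    and trace_zero: "\<And>P. H1_jet Wb P \<Longrightarrow> trace_on Wb Gb (\<lambda>x. fst (P x)) (\<lambda>_. 0) \<Longrightarrow> H1_cl Wb Gb P"
begin

text \<open>Extension by zero if \<open>Wa\<close> is the larger domain, restriction if it is the
  smaller one: in both uses of the locale \<open>Y\<close> is the smaller domain.\<close>

definition E :: "('a \<Rightarrow> real \<times> 'a) \<Rightarrow> 'a \<Rightarrow> real \<times> 'a" where
  "E P = (\<lambda>x. if x \<in> Y then P x else 0)"

lemma E_linear: "E (\<lambda>x. P x + Q x) x = E P x + E Q x" "E (\<lambda>x. c *\<^sub>R P x) x = c *\<^sub>R E P x" "E (\<lambda>_. 0) x = 0"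
  by (auto simp: E_def)

lemma Wlm: "Wa \<in> lmeasurable" "Wb \<in> lmeasurable"
  using Wa Wb by (auto intro: lmeasurable_open)

text \<open>\<open>Q\<close> is an energy projection of \<open>E P\<close> onto the closure of the
  tests vanishing near \<Gamma> and \<open>Ga\<close>. A relation is used because projections are
  unique only almost everywhere: a choice of \<open>Q\<close> for each \<open>P\<close> would not be
  linear, whereas the relation is closed under sums and multiples.\<close>

definition rel_jet :: "('a \<Rightarrow> real \<times> 'a) \<Rightarrow> ('a \<Rightarrow> real \<times> 'a) \<Rightarrow> bool" where
  "rel_jet P Q \<longleftrightarrow> H1_cl Wb Gb P \<and> (\<forall>t\<in>tests (\<Gamma> \<union> Gb). energy_form Wb \<Lambda> P t = 0) \<and>
     H1_cl Wa (\<Gamma> \<union> Ga) Q \<and> (\<forall>t\<in>tests (\<Gamma> \<union> Ga). energy_form Wa \<Lambda> (\<lambda>x. E P x - Q x) t = 0)"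

definition rel :: "('a \<Rightarrow> real) \<Rightarrow> ('a \<Rightarrow> real) \<Rightarrow> bool" where
  "rel V W \<longleftrightarrow> (\<exists>P Q. rel_jet P Q \<and> V = (\<lambda>x. fst (P x)) \<and> W = (\<lambda>x. fst (E P x - Q x)))"

lemma H1_cl_E: "H1_cl Wb Gb P \<Longrightarrow> H1_cl Wa Ga (E P)"
  using extension unfolding E_def by blast

text \<open>Zero trace on \<open>Gb\<close> is converted by \<open>trace_zero\<close> into
  membership in \<open>H1_cl\<close>, the form in which \<open>E\<close> can transport it; the
  projection of the transported jet then exists by coercivity on \<open>Wa\<close>.\<close>

lemma rel_exists:
  assumes V: "V \<in> dtn_space Wb \<Gamma> Gb \<Lambda>"
  shows "\<exists>W. rel V W"
proof -
  have H: "H1 Wb V" and tr: "trace_on Wb Gb V (\<lambda>_. 0)" using V by (auto simp: dtn_space_def)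
  define P where "P = jet V (wgrad Wb V)"
  have VP: "V = (\<lambda>x. fst (P x))" by (simp add: P_def jet_def)
  have P: "H1_jet Wb P" unfolding P_def by (rule H1_imp_H1_jet[OF H H1_weak_grad[OF H]])
  have cl: "H1_cl Wb Gb P" using trace_zero[OF P] tr VP by simp
  have eq: "energy_form Wb \<Lambda> P t = 0" if tt: "t \<in> tests (\<Gamma> \<union> Gb)" for t
  proof -
    obtain \<phi> g where t: "t = jet \<phi> g" "C1c \<phi> g" "tsupp \<phi> \<inter> (\<Gamma> \<union> Gb) = {}" using tt by (auto simp: tests_def)
    have "(\<integral>x. wgrad Wb V x \<bullet> g x \<partial>lebesgue_on Wb) = \<Lambda> * (\<integral>x. V x * \<phi> x \<partial>lebesgue_on Wb)"
      using V t by (auto simp: dtn_space_def)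
    then show ?thesis using weak_equation_jet[OF Wb P t(2), of \<Lambda>] by (simp add: VP t(1))
  qed
  have sE: "sqint (lebesgue_on Wa) (E P)" by (rule H1_cl_sqint[OF H1_cl_E[OF cl]])
  have ne: "tests (\<Gamma> \<union> Ga) \<noteq> {}" using tests_zero by blast
  have "\<exists>q Q. (\<forall>n. q n \<in> tests (\<Gamma> \<union> Ga)) \<and> L2lim (lebesgue_on Wa) q Q \<and>
    (\<forall>t\<in>tests (\<Gamma> \<union> Ga). energy_form Wa \<Lambda> (\<lambda>x. E P x - Q x) t = 0)"
    by (rule energy_projection[OF Wlm(1) _ _ _ ne coercive_a sE])
      (auto intro: sqint_tests Wlm tests_add tests_scale)
  then obtain q Q where q: "\<And>n. q n \<in> tests (\<Gamma> \<union> Ga)" "L2lim (lebesgue_on Wa) q Q"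
    "\<forall>t\<in>tests (\<Gamma> \<union> Ga). energy_form Wa \<Lambda> (\<lambda>x. E P x - Q x) t = 0" by blast
  have "H1_cl Wa (\<Gamma> \<union> Ga) Q" unfolding H1_cl_def using q by blast
  then have "rel_jet P Q" using cl eq q(3) by (auto simp: rel_jet_def)
  then show ?thesis using VP unfolding rel_def by blast
qed

lemma rel_jet_add:
  assumes "rel_jet P Q" "rel_jet P' Q'"
  shows "rel_jet (\<lambda>x. P x + P' x) (\<lambda>x. Q x + Q' x)"
proof -
  note a = assms[unfolded rel_jet_def]
  have s: "sqint (lebesgue_on Wb) P" "sqint (lebesgue_on Wb) P'"
     "sqint (lebesgue_on Wa) (\<lambda>x. E P x - Q x)" "sqint (lebesgue_on Wa) (\<lambda>x. E P' x - Q' x)"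
    using a H1_cl_sqint H1_cl_E by (blast intro: sqint_diff)+
  have e: "(\<lambda>x. E (\<lambda>x. P x + P' x) x - (Q x + Q' x)) = (\<lambda>x. (E P x - Q x) + (E P' x - Q' x))"
    by (simp add: E_linear fun_eq_iff algebra_simps)
  show ?thesis unfolding rel_jet_def e
    using a energy_form_add_left[OF s(1,2) sqint_tests[OF _ Wlm(2)]]
      energy_form_add_left[OF s(3,4) sqint_tests[OF _ Wlm(1)]] by (auto intro: H1_cl_add)
qed

lemma rel_jet_scale:
  assumes "rel_jet P Q"
  shows "rel_jet (\<lambda>x. c *\<^sub>R P x) (\<lambda>x. c *\<^sub>R Q x)"
proof -
  note a = assms[unfolded rel_jet_def]
  have e: "(\<lambda>x. E (\<lambda>x. c *\<^sub>R P x) x - c *\<^sub>R Q x) = (\<lambda>x. c *\<^sub>R (E P x - Q x))"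
    by (simp add: E_linear algebra_simps)
  show ?thesis unfolding rel_jet_def e
    using a by (auto intro: H1_cl_scale simp: energy_form_scale_left)
qed

lemma rel_sum: "(\<And>i. i < (k::nat) \<Longrightarrow> rel (V i) (W i)) \<Longrightarrow> rel (\<lambda>x. \<Sum>i<k. c i * V i x) (\<lambda>x. \<Sum>i<k. c i * W i x)"
proof (induction k)
  case 0
  have z: "energy_form W \<Lambda> (\<lambda>_. 0) t = 0" for W t by (simp add: energy_form_def)
  have "rel_jet (\<lambda>_. 0) (\<lambda>_. 0)" unfolding rel_jet_def by (simp add: E_linear H1_cl_zero z)
  then show ?case unfolding rel_def by (intro exI[of _ "\<lambda>_. 0"]) (simp add: E_linear)
next
  case (Suc k)
  obtain P Q where 1: "rel_jet P Q" "(\<lambda>x. \<Sum>i<k. c i * V i x) = (\<lambda>x. fst (P x))"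
     "(\<lambda>x. \<Sum>i<k. c i * W i x) = (\<lambda>x. fst (E P x - Q x))" using Suc unfolding rel_def by auto
  obtain P' Q' where 2: "rel_jet P' Q'" "V k = (\<lambda>x. fst (P' x))" "W k = (\<lambda>x. fst (E P' x - Q' x))"
    using Suc.prems[of k] unfolding rel_def by auto
  show ?case unfolding rel_def
  proof (intro exI conjI)
    show "rel_jet (\<lambda>x. P x + c k *\<^sub>R P' x) (\<lambda>x. Q x + c k *\<^sub>R Q' x)"
      by (intro rel_jet_add rel_jet_scale 1 2)
    show "(\<lambda>x. \<Sum>i<Suc k. c i * V i x) = (\<lambda>x. fst (P x + c k *\<^sub>R P' x))"
      using fun_cong[OF 1(2)] 2(2) by (simp add: fun_eq_iff)
    show "(\<lambda>x. \<Sum>i<Suc k. c i * W i x) = (\<lambda>x. fst (E (\<lambda>x. P x + c k *\<^sub>R P' x) x - (Q x + c k *\<^sub>R Q' x)))"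
    proof
      fix x
      have "(\<Sum>i<k. c i * W i x) = fst (E P x - Q x)" "W k x = fst (E P' x - Q' x)"
        using fun_cong[OF 1(3)] fun_cong[OF 2(3)] by auto
      then show "(\<Sum>i<Suc k. c i * W i x) = fst (E (\<lambda>x. P x + c k *\<^sub>R P' x) x - (Q x + c k *\<^sub>R Q' x))"
        by (simp only: sum.lessThan_Suc E_linear) (simp add: algebra_simps)
    qed
  qed
qed

lemma rel_jetD:
  assumes "rel_jet P Q"
  shows "H1_cl Wa Ga (\<lambda>x. E P x - Q x)" "H1_jet Wa (\<lambda>x. E P x - Q x)" "H1_jet Wb P"
proof -
  show cl: "H1_cl Wa Ga (\<lambda>x. E P x - Q x)"
    using assms H1_cl_E H1_cl_mono[of Ga "\<Gamma> \<union> Ga" Wa Q] unfolding rel_jet_def by (auto intro: H1_cl_diff)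
  show "H1_jet Wa (\<lambda>x. E P x - Q x)" by (rule H1_cl_imp_H1_jet[OF Wlm(1) cl])
  show "H1_jet Wb P" using assms H1_cl_imp_H1_jet[OF Wlm(2)] by (auto simp: rel_jet_def)
qed

lemma rel_dtn_space:
  assumes "rel V W"
  shows "W \<in> dtn_space Wa \<Gamma> Ga \<Lambda>"
proof -
  obtain P Q where PQ: "rel_jet P Q" "W = (\<lambda>x. fst (E P x - Q x))" using assms unfolding rel_def by blast
  define R where "R x = E P x - Q x" for x
  have W: "W = (\<lambda>x. fst (R x))" using PQ(2) by (simp add: R_def)
  have R: "H1_cl Wa Ga R" "H1_jet Wa R" using rel_jetD[OF PQ(1)] unfolding R_def[abs_def] by auto
  obtain q where q: "\<And>n. q n \<in> tests Ga" "L2lim (lebesgue_on Wa) q R" using R(1) unfolding H1_cl_def by blast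
  \<comment> \<open>The approximating tests vanish on \<open>Ga\<close> identically, so the boundary
    integrals are zero and not only small.\<close>
  have z: "integral\<^sup>L (surf Ga) (\<lambda>x. (fst (q n x) - 0)\<^sup>2) = 0" for n
    by (rule integral_eq_zero_AE) (auto intro!: AE_I2 simp: space_surf tests_eq_0[OF q(1)])
  have "trace_on Wa Ga (\<lambda>x. fst (R x)) (\<lambda>_. 0)"
    unfolding trace_on_tests_iff[OF Wa R(2)]
    using q z tests_mono[of "{}" Ga] by (auto simp: L2_surf_def intro!: exI[of _ q])
  moreover have "(\<integral>x. wgrad Wa W x \<bullet> g x \<partial>lebesgue_on Wa) = \<Lambda> * (\<integral>x. W x * \<phi> x \<partial>lebesgue_on Wa)"
    if "C1c \<phi> g" "tsupp \<phi> \<inter> (\<Gamma> \<union> Ga) = {}" for \<phi> g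
    using weak_equation_jet[OF Wa R(2) that(1), of \<Lambda>] PQ(1) testsI[OF that]
    unfolding rel_jet_def W R_def by simp
  ultimately show ?thesis using H1_jet_imp_H1[OF R(2)] unfolding dtn_space_def W by blast
qed

text \<open>A sequence admissible for one function is turned into one for the other with the same
  values on \<Gamma>. The \<open>q n\<close> vanish on \<Gamma> and account for the difference of
  the limits \<open>E P\<close> and \<open>E P - Q\<close>; gluing changes the sequence only away
  from \<Gamma> and supplies convergence on the rest of the other domain.\<close>

lemma rel_trace:
  assumes "rel V W"
  shows "trace Wa \<Gamma> W = trace Wb \<Gamma> V"
proof -
  obtain P Q where PQ: "rel_jet P Q" "W = (\<lambda>x. fst (E P x - Q x))" "V = (\<lambda>x. fst (P x))"
    using assms unfolding rel_def by blast
  note H = rel_jetD[OF PQ(1)]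
  obtain q where q: "\<And>n. q n \<in> tests (\<Gamma> \<union> Ga)" "L2lim (lebesgue_on Wa) q Q"
    using PQ(1) unfolding rel_jet_def H1_cl_def by blast
  obtain p where p: "\<And>n. p n \<in> tests Gb" "L2lim (lebesgue_on Wb) p P"
    using PQ(1) unfolding rel_jet_def H1_cl_def by blast
  obtain e where e: "\<And>n. e n \<in> tests Ga" "L2lim (lebesgue_on Wa) e (E P)"
    using PQ(1) H1_cl_E unfolding rel_jet_def H1_cl_def by blast
  have q0: "q n x = 0" if "x \<in> \<Gamma>" for n x using tests_eq_0[OF q(1)] that by blast
  have t0: "t \<in> tests S \<Longrightarrow> t \<in> tests {}" for t :: "'a \<Rightarrow> real \<times> 'a" and S using tests_mono[of "{}" S] by blast
  have surf_cong: "(\<integral>x. (u x - f x)\<^sup>2 \<partial>surf \<Gamma>) = (\<integral>x. (v x - f x)\<^sup>2 \<partial>surf \<Gamma>)"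
    if "\<And>x. x \<in> \<Gamma> \<Longrightarrow> u x = v x" for u v f
    by (rule Bochner_Integration.integral_cong) (use that in \<open>auto simp: space_surf\<close>)
  have "trace_on Wa \<Gamma> W f \<longleftrightarrow> trace_on Wb \<Gamma> V f" for f
    unfolding PQ(2,3) trace_on_tests_iff[OF Wa H(2)] trace_on_tests_iff[OF Wb H(3)]
  proof (intro conj_cong refl iffI; elim exE conjE)
    fix u assume u: "\<forall>n. u n \<in> tests {}" "L2lim (lebesgue_on Wa) u (\<lambda>x. E P x - Q x)"
      "(\<lambda>n. \<integral>x. (fst (u n x) - f x)\<^sup>2 \<partial>surf \<Gamma>) \<longlonglongrightarrow> 0"
    \<comment> \<open>Adding \<open>q n\<close> moves the limit from \<open>E P - Q\<close> to
      \<open>E P\<close>, which coincides with \<open>P\<close> on the support of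
      \<open>\<eta>\<close>; elsewhere in \<open>Wb\<close> the given approximation \<open>p\<close>
      of \<open>P\<close> takes over.\<close>
    let ?v = "\<lambda>n x. u n x + q n x"
    let ?w = "\<lambda>n. glue \<eta> h (?v n) (p n)"
    have v: "?v n \<in> tests {}" for n using u(1) t0[OF q(1)] tests_add by blast
    have "L2lim (lebesgue_on Wa) ?v (E P)" using L2lim_add[OF u(2) q(2)] by simp
    then have "L2lim (lebesgue_on Wb) ?w P"
      by (rule glue_L2lim[OF \<eta> Wlm(2,1) v _ p(2)]) (use supp in \<open>auto simp: E_def\<close>)
    moreover have "?w n \<in> tests {}" for n by (rule glue_tests[OF \<eta> N(1,3) v p(1)]) auto
    moreover have "fst (?w n x) = fst (u n x)" if "x \<in> \<Gamma>" for n x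
      using glue_on_plateau[OF N(1,3), where x = x and h = h and p = "?v n" and w = "p n"] that N(2) q0 by auto
    then have "(\<integral>x. (fst (?w n x) - f x)\<^sup>2 \<partial>surf \<Gamma>) = (\<integral>x. (fst (u n x) - f x)\<^sup>2 \<partial>surf \<Gamma>)" for n
      by (intro surf_cong)
    then have "(\<lambda>n. \<integral>x. (fst (?w n x) - f x)\<^sup>2 \<partial>surf \<Gamma>) \<longlonglongrightarrow> 0" using u(3) by simp
    ultimately show "\<exists>q. (\<forall>n. q n \<in> tests {}) \<and> L2lim (lebesgue_on Wb) q P \<and>
      (\<lambda>n. \<integral>x. (fst (q n x) - f x)\<^sup>2 \<partial>surf \<Gamma>) \<longlonglongrightarrow> 0" by (intro exI[of _ ?w]) blast
  next
    fix u assume u: "\<forall>n. u n \<in> tests {}" "L2lim (lebesgue_on Wb) u P"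
      "(\<lambda>n. \<integral>x. (fst (u n x) - f x)\<^sup>2 \<partial>surf \<Gamma>) \<longlonglongrightarrow> 0"
    have u1: "u n \<in> tests {}" for n using u(1) by blast
    let ?v = "\<lambda>n. glue \<eta> h (u n) (e n)"
    let ?w = "\<lambda>n x. ?v n x - q n x"
    have "L2lim (lebesgue_on Wa) ?v (E P)"
      by (rule glue_L2lim[OF \<eta> Wlm(1,2) u1 u(2) e(2)]) (use supp in \<open>auto simp: E_def\<close>)
    then have "L2lim (lebesgue_on Wa) ?w (\<lambda>x. E P x - Q x)" by (rule L2lim_diff[OF _ q(2)])
    moreover have "?v n \<in> tests {}" for n by (rule glue_tests[OF \<eta> N(1,3) u1 e(1)]) auto
    then have "?w n \<in> tests {}" for n using t0[OF q(1)] tests_diff by blast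
    moreover have "fst (?w n x) = fst (u n x)" if "x \<in> \<Gamma>" for n x
      using glue_on_plateau[OF N(1,3), where x = x and h = h and p = "u n" and w = "e n"] that N(2) q0 by auto
    then have "(\<integral>x. (fst (?w n x) - f x)\<^sup>2 \<partial>surf \<Gamma>) = (\<integral>x. (fst (u n x) - f x)\<^sup>2 \<partial>surf \<Gamma>)" for n
      by (intro surf_cong)
    then have "(\<lambda>n. \<integral>x. (fst (?w n x) - f x)\<^sup>2 \<partial>surf \<Gamma>) \<longlonglongrightarrow> 0" using u(3) by simp
    ultimately show "\<exists>q. (\<forall>n. q n \<in> tests {}) \<and> L2lim (lebesgue_on Wa) q (\<lambda>x. E P x - Q x) \<and>
      (\<lambda>n. \<integral>x. (fst (q n x) - f x)\<^sup>2 \<partial>surf \<Gamma>) \<longlonglongrightarrow> 0" by (intro exI[of _ ?w]) blast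
  qed
  then have "trace_on Wa \<Gamma> W = trace_on Wb \<Gamma> V" by (simp only: fun_eq_iff simp_thms)
  then show ?thesis by (simp only: trace_def)
qed

text \<open>Pythagoras: \<open>E P\<close> is the sum of \<open>E P - Q\<close> and
  \<open>Q\<close>, which are energy-orthogonal, and the energy of \<open>Q\<close> is nonnegative
  as a limit of energies of tests.\<close>

lemma rel_energy:
  assumes "rel_jet P Q"
  shows "energy_form Wa \<Lambda> (\<lambda>x. E P x - Q x) (\<lambda>x. E P x - Q x) \<le> energy_form Wb \<Lambda> P P"
proof -
  let ?R = "\<lambda>x. E P x - Q x" and ?a = "energy_form Wa \<Lambda>"
  obtain q where q: "\<And>n. q n \<in> tests (\<Gamma> \<union> Ga)" "L2lim (lebesgue_on Wa) q Q"
    using assms unfolding rel_jet_def H1_cl_def by blast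
  have sR: "sqint (lebesgue_on Wa) ?R" using H1_cl_sqint[OF rel_jetD(1)[OF assms]] .
  have sQ: "sqint (lebesgue_on Wa) Q" using L2limD(2)[OF q(2)] .
  have "?a ?R (q n) = 0" for n using q(1) assms unfolding rel_jet_def by blast
  then have RQ: "?a ?R Q = 0"
    using energy_form_L2lim[OF L2lim_const[OF sR] q(2), of \<Lambda>] by (simp add: LIMSEQ_const_iff)
  have "0 \<le> ?a (q n) (q n)" for n
    using coercive_a(2)[OF q(1)[of n]] coercive_a(1) N2_nonneg[of "lebesgue_on Wa" "q n"]
    by (meson mult_nonneg_nonneg less_imp_le order.trans)
  then have QQ: "0 \<le> ?a Q Q" using energy_form_L2lim[OF q(2) q(2), of \<Lambda>] by (intro LIMSEQ_le_const) auto
  have "?a (E P) (E P) = ?a ?R ?R + 2 * ?a ?R Q + ?a Q Q"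
    using energy_form_expand[OF sR sQ, of \<Lambda> 1] by simp
  moreover have "?a (E P) (E P) \<le> energy_form Wb \<Lambda> P P"
    using extension assms unfolding rel_jet_def E_def by blast
  ultimately show ?thesis using RQ QQ by simp
qed

text \<open>The traces are equal, so the two quotients share a nonnegative denominator and only the
  energies are compared. If that denominator is 0, both quotients are 0.\<close>

lemma rel_rayleigh:
  assumes "rel V W"
  shows "dtn_rayleigh Wa \<Gamma> \<Lambda> W \<le> dtn_rayleigh Wb \<Gamma> \<Lambda> V"
proof -
  obtain P Q where PQ: "rel_jet P Q" "W = (\<lambda>x. fst (E P x - Q x))" "V = (\<lambda>x. fst (P x))"
    using assms unfolding rel_def by blast
  note H = rel_jetD[OF PQ(1)]
  have "dirichlet_energy Wa W - \<Lambda> * L2norm2 Wa W \<le> dirichlet_energy Wb V - \<Lambda> * L2norm2 Wb V"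
    unfolding PQ(2,3) energy_jet[OF Wa H(2)] energy_jet[OF Wb H(3)] by (rule rel_energy[OF PQ(1)])
  then show ?thesis unfolding dtn_rayleigh_def rel_trace[OF assms] by (intro divide_right_mono) auto
qed

text \<open>If \<open>W\<close> vanishes, \<open>E P\<close> agrees almost everywhere with
  \<open>Q\<close>, a limit of tests vanishing near \<Gamma>. Gluing these to tests for
  \<open>P\<close> shows that \<open>P\<close> is a limit of tests vanishing near \<Gamma> and
  \<open>Gb\<close>. As a solution it is orthogonal to them, so its energy is zero, and coercivity
  on \<open>Wb\<close> ends the argument.\<close>

lemma rel_zero:
  assumes "rel V W" and z: "AE x in lebesgue_on Wa. W x = 0"
  shows "AE x in lebesgue_on Wb. V x = 0"
proof -
  obtain P Q where PQ: "rel_jet P Q" "W = (\<lambda>x. fst (E P x - Q x))" "V = (\<lambda>x. fst (P x))"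
    using assms unfolding rel_def by blast
  note H = rel_jetD[OF PQ(1)]
  let ?R = "\<lambda>x. E P x - Q x"
  have zR: "AE x in lebesgue_on Wa. fst (?R x) = 0" using z PQ(2) by simp
  \<comment> \<open>The hypothesis concerns values only; uniqueness of the weak gradient makes the
    gradient part vanish as well, so that whole jets agree.\<close>
  have "weak_grad Wa (\<lambda>x. fst (?R x)) (\<lambda>_. 0)"
    unfolding weak_grad_def
  proof (intro conjI allI impI)
    fix \<phi> :: "'a \<Rightarrow> real" and g :: "'a \<Rightarrow> 'a"
    have "(\<integral>x. fst (?R x) *\<^sub>R g x \<partial>lebesgue_on Wa) = 0"
      by (rule integral_eq_zero_AE) (use zR in \<open>auto elim!: eventually_mono\<close>)
    then show "(\<integral>x. fst (?R x) *\<^sub>R g x \<partial>lebesgue_on Wa) = - (\<integral>x. \<phi> x *\<^sub>R 0 \<partial>lebesgue_on Wa)" by simp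
  qed auto
  then have "AE x in lebesgue_on Wa. snd (?R x) = 0"
    using weak_grad_unique[OF Wa] H(2) unfolding H1_jet_def by blast
  then have PQae: "AE x in lebesgue_on Wa. E P x = Q x"
    using zR by eventually_elim (auto simp: prod_eq_iff)
  obtain q where q: "\<And>n. q n \<in> tests (\<Gamma> \<union> Ga)" "L2lim (lebesgue_on Wa) q Q"
    using PQ(1) unfolding rel_jet_def H1_cl_def by blast
  obtain p where p: "\<And>n. p n \<in> tests Gb" "L2lim (lebesgue_on Wb) p P"
    using PQ(1) unfolding rel_jet_def H1_cl_def by blast
  have sE: "sqint (lebesgue_on Wa) (E P)" using H1_cl_sqint H1_cl_E PQ(1) unfolding rel_jet_def by blast
  have "L2lim (lebesgue_on Wa) q (E P)"
  proof (rule L2limI_le[OF L2limD(1)[OF q(2)] sE _ L2limD(3)[OF q(2)]])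
    fix n
    have s: "sqint (lebesgue_on Wa) (\<lambda>x. q n x - E P x)" "sqint (lebesgue_on Wa) (\<lambda>x. q n x - Q x)"
      using L2limD(1,2)[OF q(2)] sE by (auto intro: sqint_diff)
    show "N2 (lebesgue_on Wa) (\<lambda>x. q n x - E P x) \<le> N2 (lebesgue_on Wa) (\<lambda>x. q n x - Q x)"
      unfolding N2_def
      by (rule integral_mono_AE) (use PQae s in \<open>auto simp: sqint_def elim!: eventually_mono\<close>)
  qed
  then have lim: "L2lim (lebesgue_on Wb) (\<lambda>n. glue \<eta> h (q n) (p n)) P"
    by (rule glue_L2lim[OF \<eta> Wlm(2,1) q(1) _ p(2)]) (use supp in \<open>auto simp: E_def\<close>)
  let ?r = "\<lambda>n. glue \<eta> h (q n) (p n)" and ?b = "energy_form Wb \<Lambda>"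
  have r: "?r n \<in> tests (\<Gamma> \<union> Gb)" for n
  proof (rule glue_tests[OF \<eta> N(1,3) q(1) p(1)])
    show "x \<in> N \<and> x \<in> \<Gamma> \<union> Ga \<or> x \<notin> tsupp \<eta> \<and> x \<in> Gb" if "x \<in> \<Gamma> \<union> Gb" for x
      using that N(2) supp(3) by blast
  qed
  \<comment> \<open>The weak equation for \<open>P\<close>, tested with its own
    approximants.\<close>
  have "?b P (?r n) = 0" for n using r PQ(1) unfolding rel_jet_def by blast
  then have "?b P P = 0"
    using energy_form_L2lim[OF L2lim_const[OF L2limD(2)[OF lim]] lim, of \<Lambda>] by (simp add: LIMSEQ_const_iff)
  moreover have "cb * N2 (lebesgue_on Wb) P \<le> ?b P P"
    by (rule LIMSEQ_le[OF tendsto_mult_left[OF L2lim_N2[OF lim]] energy_form_L2lim[OF lim lim]])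
      (use coercive_b(2)[OF r] in blast)
  ultimately have "N2 (lebesgue_on Wb) P = 0"
    using coercive_b(1) N2_nonneg[of "lebesgue_on Wb" P] by (simp add: mult_le_0_iff)
  then have "AE x in lebesgue_on Wb. P x = 0" using N2_eq_0_iff[OF L2limD(2)[OF lim]] by simp
  then show ?thesis unfolding PQ(3) by eventually_elim simp
qed

text \<open>Related bases have related linear combinations with the same coefficients, so for each
  \<open>c\<close> the quotient for \<open>W\<close> is at most the one for \<open>V\<close>;
  \<open>rel_zero\<close> keeps the new basis independent.\<close>

theorem dtn_eig_le: "dtn_eig Wa \<Gamma> Ga \<Lambda> k \<le> dtn_eig Wb \<Gamma> Gb \<Lambda> k"
  unfolding dtn_eig_def
proof (rule INF_mono)
  fix V assume "V \<in> {V. (\<forall>i<k. V i \<in> dtn_space Wb \<Gamma> Gb \<Lambda>) \<and> lin_indep_ae Wb k V}"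
  then have V: "\<And>i. i < k \<Longrightarrow> V i \<in> dtn_space Wb \<Gamma> Gb \<Lambda>" "lin_indep_ae Wb k V" by auto
  have "\<forall>i. \<exists>W. i < k \<longrightarrow> rel (V i) W" using rel_exists V(1) by blast
  then obtain W where W: "\<And>i. i < k \<Longrightarrow> rel (V i) (W i)" by metis
  have rs: "rel (\<lambda>x. \<Sum>i<k. c i * V i x) (\<lambda>x. \<Sum>i<k. c i * W i x)" for c by (rule rel_sum[OF W])
  have "lin_indep_ae Wa k W" using V(2) rel_zero[OF rs] unfolding lin_indep_ae_def by blast
  then have "W \<in> {W. (\<forall>i<k. W i \<in> dtn_space Wa \<Gamma> Ga \<Lambda>) \<and> lin_indep_ae Wa k W}"
    using rel_dtn_space[OF W] by auto
  moreover have "(SUP c\<in>{c::nat \<Rightarrow> real. \<exists>i<k. c i \<noteq> 0}. ereal (dtn_rayleigh Wa \<Gamma> \<Lambda> (\<lambda>x. \<Sum>i<k. c i * W i x)))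
    \<le> (SUP c\<in>{c::nat \<Rightarrow> real. \<exists>i<k. c i \<noteq> 0}. ereal (dtn_rayleigh Wb \<Gamma> \<Lambda> (\<lambda>x. \<Sum>i<k. c i * V i x)))"
    by (rule SUP_mono') (use rel_rayleigh[OF rs] in simp)
  ultimately show "\<exists>W\<in>{W. (\<forall>i<k. W i \<in> dtn_space Wa \<Gamma> Ga \<Lambda>) \<and> lin_indep_ae Wa k W}.
      (SUP c\<in>{c::nat \<Rightarrow> real. \<exists>i<k. c i \<noteq> 0}. ereal (dtn_rayleigh Wa \<Gamma> \<Lambda> (\<lambda>x. \<Sum>i<k. c i * W i x)))
    \<le> (SUP c\<in>{c::nat \<Rightarrow> real. \<exists>i<k. c i \<noteq> 0}. ereal (dtn_rayleigh Wb \<Gamma> \<Lambda> (\<lambda>x. \<Sum>i<k. c i * V i x)))"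
    by blast
qed

end

section \<open>Hausdorff measure\<close>

definition covers :: "real \<Rightarrow> 'a::euclidean_space set \<Rightarrow> (nat \<Rightarrow> 'a set) set" where
  "covers \<delta> A = {C. A \<subseteq> (\<Union>n. C n) \<and> (\<forall>n. bounded (C n) \<and> diameter (C n) < \<delta>)}"

definition cover_wt :: "real \<Rightarrow> 'a::euclidean_space set \<Rightarrow> ennreal" where
  "cover_wt s C = ennreal (hausdorff_const s * diameter C powr s)"

definition hausdorff_pre :: "real \<Rightarrow> real \<Rightarrow> 'a::euclidean_space set \<Rightarrow> ennreal" where
  "hausdorff_pre s \<delta> A = (INF C\<in>covers \<delta> A. \<Sum>n. cover_wt s (C n))"

lemma hausdorff_outer_eq: "hausdorff_outer s A = (SUP \<delta>\<in>{0<..}. hausdorff_pre s \<delta> A)"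
  by (simp add: hausdorff_outer_def hausdorff_pre_def covers_def cover_wt_def)

lemma cover_wt_empty: "cover_wt s {} = 0"
  by (simp add: cover_wt_def)

lemma hausdorff_pre_le_outer: "\<delta> > 0 \<Longrightarrow> hausdorff_pre s \<delta> A \<le> hausdorff_outer s A"
  unfolding hausdorff_outer_eq by (rule SUP_upper) simp

lemma hausdorff_pre_antimono: "\<delta> \<le> \<delta>' \<Longrightarrow> hausdorff_pre s \<delta>' A \<le> hausdorff_pre s \<delta> A"
  unfolding hausdorff_pre_def by (rule INF_superset_mono) (auto simp: covers_def intro: less_le_trans)

lemma hausdorff_outer_mono: "A \<subseteq> B \<Longrightarrow> hausdorff_outer s A \<le> hausdorff_outer s B"
  unfolding hausdorff_outer_eq hausdorff_pre_def
  by (intro SUP_mono' INF_superset_mono) (auto simp: covers_def)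

lemma hausdorff_outer_empty: "hausdorff_outer s {} = 0"
proof -
  have "hausdorff_pre s \<delta> ({}::'a::euclidean_space set) \<le> 0" if "\<delta> > 0" for \<delta>
  proof -
    have "(\<lambda>_. {}) \<in> covers \<delta> ({}::'a set)" using that by (simp add: covers_def)
    then have "hausdorff_pre s \<delta> ({}::'a set) \<le> (\<Sum>n::nat. cover_wt s ({}::'a set))"
      unfolding hausdorff_pre_def by (rule INF_lower)
    then show ?thesis by (simp add: cover_wt_empty)
  qed
  then have "hausdorff_outer s ({}::'a set) \<le> 0" unfolding hausdorff_outer_eq by (intro SUP_least) auto
  then show ?thesis by simp
qed

lemma hausdorff_pre_countable_subadd:
  "hausdorff_pre s \<delta> (\<Union>i. A i) \<le> (\<Sum>i. hausdorff_pre s \<delta> (A i))"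
proof (rule ennreal_le_epsilon)
  fix e :: real assume e: "0 < e" and fin: "(\<Sum>i. hausdorff_pre s \<delta> (A i)) < top"
  have "\<exists>C\<in>covers \<delta> (A i). (\<Sum>n. cover_wt s (C n)) < hausdorff_pre s \<delta> (A i) + ennreal (e * (1/2)^Suc i)" for i
  proof -
    have "hausdorff_pre s \<delta> (A i) < top"
      using fin ennreal_suminf_lessD by blast
    moreover have "0 < ennreal (e * (1/2)^Suc i)" using e by simp
    ultimately have "hausdorff_pre s \<delta> (A i) < hausdorff_pre s \<delta> (A i) + ennreal (e * (1/2)^Suc i)"
      using e by (cases "hausdorff_pre s \<delta> (A i)")
        (auto simp: ennreal_less_iff simp flip: ennreal_plus)
    then show ?thesis unfolding hausdorff_pre_def[of s \<delta> "A i"] by (simp only: INF_less_iff)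
  qed
  then obtain C where C: "\<And>i. C i \<in> covers \<delta> (A i)"
    "\<And>i. (\<Sum>n. cover_wt s (C i n)) < hausdorff_pre s \<delta> (A i) + ennreal (e * (1/2)^Suc i)" by metis
  define D where "D m = (case prod_decode m of (i, n) \<Rightarrow> C i n)" for m
  have "D \<in> covers \<delta> (\<Union>i. A i)"
  proof -
    have "(\<Union>i. A i) \<subseteq> (\<Union>m. D m)"
    proof
      fix x assume "x \<in> (\<Union>i. A i)"
      then obtain i n where "x \<in> C i n" using C(1) by (fastforce simp: covers_def)
      then have "x \<in> D (prod_encode (i, n))" by (simp add: D_def)
      then show "x \<in> (\<Union>m. D m)" by blast
    qed
    then show ?thesis using C(1) by (auto simp: covers_def D_def split: prod.split)
  qed
  then have "hausdorff_pre s \<delta> (\<Union>i. A i) \<le> (\<Sum>m. cover_wt s (D m))"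
    unfolding hausdorff_pre_def by (rule INF_lower)
  also have "\<dots> = (\<Sum>m. (\<lambda>p. cover_wt s (C (fst p) (snd p))) (prod_decode m))"
    by (simp add: D_def split_beta)
  also have "\<dots> = (\<Sum>i. \<Sum>n. cover_wt s (C i n))"
    using suminf_ennreal_2dimen[of "\<lambda>i. \<Sum>n. cover_wt s (C i n)" "\<lambda>p. cover_wt s (C (fst p) (snd p))"]
    by (simp add: comp_def)
  also have "\<dots> \<le> (\<Sum>i. hausdorff_pre s \<delta> (A i) + ennreal (e * (1/2)^Suc i))"
    by (intro suminf_le less_imp_le[OF C(2)]) auto
  also have "\<dots> = (\<Sum>i. hausdorff_pre s \<delta> (A i)) + (\<Sum>i. ennreal (e * (1/2)^Suc i))"
    by (intro suminf_add[symmetric]) auto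
  also have "(\<Sum>i. ennreal (e * (1/2)^Suc i)) = ennreal e"
  proof -
    have "(\<lambda>i. e * (1/2)^Suc i) sums (e * 1)" using sums_mult[OF power_half_series] .
    then show ?thesis using e by (subst suminf_ennreal2) (auto simp: sums_iff)
  qed
  finally show "hausdorff_pre s \<delta> (\<Union>i. A i) \<le> (\<Sum>i. hausdorff_pre s \<delta> (A i)) + ennreal e" .
qed

lemma hausdorff_outer_countable_subadd:
  "hausdorff_outer s (\<Union>i. A i) \<le> (\<Sum>i. hausdorff_outer s (A i))"
proof -
  have "hausdorff_pre s \<delta> (\<Union>i. A i) \<le> (\<Sum>i. hausdorff_outer s (A i))" if "\<delta> > 0" for \<delta>
    using hausdorff_pre_countable_subadd[of s \<delta> A]
    by (rule order.trans) (intro suminf_le hausdorff_pre_le_outer that; simp)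
  then show ?thesis unfolding hausdorff_outer_eq[of s "\<Union>i. A i"] by (intro SUP_least) auto
qed

lemma hausdorff_outer_subadd: "hausdorff_outer s (A \<union> B) \<le> hausdorff_outer s A + hausdorff_outer s B"
proof -
  have "A \<union> B = (\<Union>i. binaryset A B i)" by (simp add: UN_binaryset_eq)
  then have "hausdorff_outer s (A \<union> B) \<le> (\<Sum>i. hausdorff_outer s (binaryset A B i))"
    using hausdorff_outer_countable_subadd by metis
  also have "\<dots> = hausdorff_outer s A + hausdorff_outer s B"
    by (rule suminf_binaryset_eq) (rule hausdorff_outer_empty)
  finally show ?thesis .
qed

text \<open>A set of diameter less than \<open>d\<close> cannot meet both \<open>A\<close> and
  \<open>B\<close>, so a sufficiently fine cover of the union splits into a cover of
  \<open>A\<close> and a disjoint part covering \<open>B\<close>.\<close>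

lemma hausdorff_outer_separated:
  assumes d: "d > 0" and sep: "\<And>a b. a \<in> A \<Longrightarrow> b \<in> B \<Longrightarrow> d \<le> dist a b"
  shows "hausdorff_outer s A + hausdorff_outer s B \<le> hausdorff_outer s (A \<union> B)"
proof -
  have pre: "hausdorff_pre s \<delta> A + hausdorff_pre s \<delta> B \<le> hausdorff_pre s \<delta> (A \<union> B)" if \<delta>: "\<delta> \<le> d" for \<delta>
    unfolding hausdorff_pre_def[of s \<delta> "A \<union> B"]
  proof (rule INF_greatest)
    fix C assume C: "C \<in> covers \<delta> (A \<union> B)"
    define CA CB where "CA n = (if C n \<inter> A = {} then {} else C n)" and "CB n = (if C n \<inter> B = {} then {} else C n)" for n
    have pos: "0 < \<delta>"
      using C diameter_ge_0[of "C 0"] by (auto simp: covers_def intro: le_less_trans)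
    have "CA \<in> covers \<delta> A" "CB \<in> covers \<delta> B"
      using C pos by (fastforce simp: covers_def CA_def CB_def)+
    then have "hausdorff_pre s \<delta> A + hausdorff_pre s \<delta> B \<le> (\<Sum>n. cover_wt s (CA n)) + (\<Sum>n. cover_wt s (CB n))"
      unfolding hausdorff_pre_def by (intro add_mono INF_lower)
    also have "\<dots> = (\<Sum>n. cover_wt s (CA n) + cover_wt s (CB n))" by (rule suminf_add) auto
    also have "\<dots> \<le> (\<Sum>n. cover_wt s (C n))"
    proof (rule suminf_le)
      fix n
      have "CA n = {} \<or> CB n = {}"
      proof (rule ccontr)
        assume "\<not> ?thesis"
        then obtain a b where "a \<in> C n" "a \<in> A" "b \<in> C n" "b \<in> B" by (auto simp: CA_def CB_def split: if_splits)
        moreover have "bounded (C n)" "diameter (C n) < \<delta>" using C by (auto simp: covers_def)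
        ultimately show False
          using diameter_bounded_bound[of "C n" a b] sep[of a b] \<delta> by linarith
      qed
      moreover have "CA n \<in> {{}, C n}" "CB n \<in> {{}, C n}" by (auto simp: CA_def CB_def)
      ultimately show "cover_wt s (CA n) + cover_wt s (CB n) \<le> cover_wt s (C n)"
        by (auto simp: cover_wt_empty)
    qed auto
    finally show "hausdorff_pre s \<delta> A + hausdorff_pre s \<delta> B \<le> (\<Sum>n. cover_wt s (C n))" .
  qed
  \<comment> \<open>The suprema over the two scales are taken one after the other, so two
    independent scales are needed; both are refined to a common one not exceeding
    \<open>d\<close>.\<close>
  have two: "hausdorff_pre s \<delta> A + hausdorff_pre s \<delta>' B \<le> hausdorff_outer s (A \<union> B)" if "\<delta> > 0" "\<delta>' > 0" for \<delta> \<delta>'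
  proof -
    let ?m = "min d (min \<delta> \<delta>')"
    have "hausdorff_pre s \<delta> A + hausdorff_pre s \<delta>' B \<le> hausdorff_pre s ?m A + hausdorff_pre s ?m B"
      by (intro add_mono hausdorff_pre_antimono) auto
    also have "\<dots> \<le> hausdorff_pre s ?m (A \<union> B)" by (rule pre) simp
    also have "\<dots> \<le> hausdorff_outer s (A \<union> B)" by (rule hausdorff_pre_le_outer) (use d that in auto)
    finally show ?thesis .
  qed
  have "hausdorff_pre s \<delta> A + hausdorff_outer s B \<le> hausdorff_outer s (A \<union> B)" if "\<delta> > 0" for \<delta>
    unfolding hausdorff_outer_eq[of s B]
    by (subst ennreal_SUP_add_right) (use two[OF that] in \<open>auto intro!: SUP_least\<close>)
  then show ?thesis
    unfolding hausdorff_outer_eq[of s A]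
    by (subst ennreal_SUP_add_left[symmetric]) (auto intro!: SUP_least)
qed

lemma hausdorff_outer_finite_separated_sum:
  fixes m :: nat
  assumes sep: "\<And>k. k < m \<Longrightarrow> \<exists>d>0. \<forall>a\<in>(\<Union>j<k. R j). \<forall>b\<in>R k. d \<le> dist a b"
  shows "(\<Sum>k<m. hausdorff_outer s (R k)) \<le> hausdorff_outer s (\<Union>k<m. R k)"
  using sep
proof (induction m)
  case 0 then show ?case by simp
next
  case (Suc m)
  obtain d where d: "d > 0" "\<forall>a\<in>(\<Union>j<m. R j). \<forall>b\<in>R m. d \<le> dist a b" using Suc.prems[of m] by auto
  have "(\<Sum>k<Suc m. hausdorff_outer s (R k)) \<le> hausdorff_outer s (\<Union>k<m. R k) + hausdorff_outer s (R m)"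
    using Suc by (simp add: add_right_mono)
  also have "\<dots> \<le> hausdorff_outer s ((\<Union>k<m. R k) \<union> R m)"
    by (rule hausdorff_outer_separated[OF d(1)]) (use d(2) in blast)
  also have "(\<Union>k<m. R k) \<union> R m = (\<Union>k<Suc m. R k)" by (auto simp: less_Suc_eq)
  finally show ?case .
qed

text \<open>Caratheodory's criterion for metric outer measures: the shells of even index, and those of odd
  index, are at positive distance from each other, so their measures are summable.\<close>
lemma hausdorff_outer_closed_split:
  assumes F: "closed F"
  shows "hausdorff_outer s (X \<inter> F) + hausdorff_outer s (X - F) \<le> hausdorff_outer s X"
proof (cases "F = {} \<or> hausdorff_outer s X = top")
  case True then show ?thesis by (auto simp: hausdorff_outer_empty)
next
  case False
  then have ne: "F \<noteq> {}" and fin: "hausdorff_outer s X < top" by (auto simp: less_top)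
  let ?i = "\<lambda>n. inverse (real (Suc n))"
  let ?H = "hausdorff_outer s"
  \<comment> \<open>\<open>A n\<close> keeps the distance \<open>1 / (n + 1)\<close> from
    \<open>F\<close>, and the shell \<open>R n\<close> is what \<open>A (Suc n)\<close> adds to
    it.\<close>
  define A where "A n = {x \<in> X. ?i n \<le> infdist x F}" for n
  define R where "R n = {x \<in> X. ?i (Suc n) \<le> infdist x F \<and> infdist x F < ?i n}" for n
  have inf_dist: "infdist a F \<le> infdist b F + dist a b" for a b by (rule infdist_triangle)
  have i_mono: "?i n \<le> ?i m" if "m \<le> n" for m n using that by (auto intro!: le_imp_inverse_le)
  have A_le: "?H (X \<inter> F) + ?H (A n) \<le> ?H X" for n
  proof -
    have "?H (X \<inter> F) + ?H (A n) \<le> ?H ((X \<inter> F) \<union> A n)"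
    proof (rule hausdorff_outer_separated[of "?i n"])
      fix a b assume "a \<in> X \<inter> F" "b \<in> A n"
      then show "?i n \<le> dist a b" using inf_dist[of b a] by (auto simp: A_def dist_commute)
    qed simp
    also have "\<dots> \<le> ?H X" by (rule hausdorff_outer_mono) (auto simp: A_def)
    finally show ?thesis .
  qed
  have shells: "(\<Sum>k<m. ?H (R (2 * k + j))) \<le> ?H X" for m j
  proof -
    have "(\<Sum>k<m. ?H (R (2 * k + j))) \<le> ?H (\<Union>k<m. R (2 * k + j))"
    proof (rule hausdorff_outer_finite_separated_sum)
      fix k
      \<comment> \<open>The width of the skipped shell \<open>R (2 * k + j - 1)\<close>, which
        separates \<open>R (2 * k + j)\<close> from the earlier shells of the same parity.\<close>
      let ?d = "?i (2 * k + j - 1) - ?i (2 * k + j)"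
      show "\<exists>d>0. \<forall>a\<in>(\<Union>l<k. R (2 * l + j)). \<forall>b\<in>R (2 * k + j). d \<le> dist a b"
      proof (cases "k = 0")
        case True then show ?thesis by (auto intro!: exI[of _ 1])
      next
        case k: False
        then have lt: "2 * k + j - 1 < 2 * k + j" by simp
        then have "?i (2 * k + j) < ?i (2 * k + j - 1)" by (intro less_imp_inverse_less) auto
        moreover have "?d \<le> dist a b" if a: "a \<in> (\<Union>l<k. R (2 * l + j))" and b: "b \<in> R (2 * k + j)" for a b
        proof -
          obtain l where l: "l < k" "a \<in> R (2 * l + j)" using a by blast
          have "?i (2 * k + j - 1) \<le> ?i (Suc (2 * l + j))" by (rule i_mono) (use l in linarith)
          also have "\<dots> \<le> infdist a F" using l by (simp add: R_def)
          finally show ?thesis using inf_dist[of a b] b by (simp add: R_def)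
        qed
        ultimately show ?thesis by (intro exI[of _ ?d]) auto
      qed
    qed
    also have "\<dots> \<le> ?H X" by (rule hausdorff_outer_mono) (auto simp: R_def)
    finally show ?thesis .
  qed
  have "(\<Sum>k. ?H (R (2 * k + j))) \<le> ?H X" for j
    unfolding suminf_eq_SUP by (rule SUP_least) (rule shells)
  then have fs: "(\<Sum>k. ?H (R (2 * k + j))) < top" for j using fin le_less_trans by blast
  have summ: "(\<Sum>n. ?H (R n)) < top"
  proof -
    have "(\<Sum>n<m. ?H (R n)) \<le> (\<Sum>k. ?H (R (2 * k + 0))) + (\<Sum>k. ?H (R (2 * k + 1)))" for m
    proof -
      have "(\<Sum>n<m. ?H (R n)) \<le> (\<Sum>n<2 * m. ?H (R n))" by (rule sum_mono2) auto
      also have "\<dots> = (\<Sum>k<m. ?H (R (2 * k))) + (\<Sum>k<m. ?H (R (2 * k + 1)))"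
        by (induction m) (auto simp: algebra_simps)
      also have "\<dots> \<le> (\<Sum>k. ?H (R (2 * k + 0))) + (\<Sum>k. ?H (R (2 * k + 1)))"
        by (intro add_mono) (auto intro!: sum_le_suminf)
      finally show ?thesis .
    qed
    then have "(\<Sum>n. ?H (R n)) \<le> (\<Sum>k. ?H (R (2 * k + 0))) + (\<Sum>k. ?H (R (2 * k + 1)))"
      unfolding suminf_eq_SUP[of "\<lambda>n. ?H (R n)"] by (intro SUP_least)
    also have "\<dots> < top" using fs[of 0] fs[of 1] by simp
    finally show ?thesis .
  qed
  have cov: "X - F = A n \<union> (\<Union>k. R (k + n))" for n
  proof (intro equalityI subsetI)
    fix x assume x: "x \<in> X - F"
    then have pos: "infdist x F > 0" using infdist_pos_not_in_closed[OF F ne] by blast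
    show "x \<in> A n \<union> (\<Union>k. R (k + n))"
    proof (cases "?i n \<le> infdist x F")
      case True then show ?thesis using x by (simp add: A_def)
    next
      case out: False
      define N where "N = (LEAST m. ?i m \<le> infdist x F)"
      obtain m where "?i m \<le> infdist x F" using reals_Archimedean[OF pos] less_imp_le by blast
      then have N: "?i N \<le> infdist x F" unfolding N_def by (rule LeastI)
      have nN: "n < N"
      proof (rule ccontr)
        assume "\<not> n < N"
        then have "?i n \<le> ?i N" by (intro i_mono) simp
        then show False using N out by linarith
      qed
      then obtain k where k: "N = Suc (k + n)" by (metis add.commute less_imp_Suc_add add_Suc_right)
      have "\<not> ?i (k + n) \<le> infdist x F" using not_less_Least[of "k + n" "\<lambda>m. ?i m \<le> infdist x F"] k N_def by simp
      then show ?thesis using x N k by (auto simp: R_def not_le)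
    qed
  next
    fix x assume "x \<in> A n \<union> (\<Union>k. R (k + n))"
    then obtain m where m: "x \<in> X" "?i m \<le> infdist x F" unfolding A_def R_def by blast
    have "0 < ?i m" by simp
    then have "infdist x F > 0" using m(2) by linarith
    then show "x \<in> X - F" using m(1) infdist_zero[of x F] by auto
  qed
  have le: "?H (X \<inter> F) + ?H (X - F) \<le> ?H X + (\<Sum>k. ?H (R (k + n)))" for n
  proof -
    have "?H (X - F) \<le> ?H (A n) + ?H (\<Union>k. R (k + n))" unfolding cov[of n] by (rule hausdorff_outer_subadd)
    also have "\<dots> \<le> ?H (A n) + (\<Sum>k. ?H (R (k + n)))" by (intro add_left_mono hausdorff_outer_countable_subadd)
    finally have "?H (X \<inter> F) + ?H (X - F) \<le> (?H (X \<inter> F) + ?H (A n)) + (\<Sum>k. ?H (R (k + n)))"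
      by (simp add: add.assoc add_left_mono)
    also have "\<dots> \<le> ?H X + (\<Sum>k. ?H (R (k + n)))" by (intro add_right_mono A_le)
    finally show ?thesis .
  qed
  have "(\<lambda>n. \<Sum>k. ?H (R (k + n))) \<longlonglongrightarrow> 0"
  proof -
    obtain r where r: "\<And>n. ?H (R n) = ennreal (r n)" "\<And>n. 0 \<le> r n"
    proof (rule that)
      show "?H (R n) = ennreal (enn2real (?H (R n)))" for n
        using summ ennreal_suminf_lessD[of "\<lambda>n. ?H (R n)" top n] by (simp add: less_top)
    qed simp
    have sr: "summable r" using summ r by (auto intro: summable_suminf_not_top)
    then have "(\<Sum>k. ?H (R (k + n))) = ennreal (\<Sum>k. r (k + n))" for n
      unfolding r(1) by (intro suminf_ennreal2 r(2) summable_ignore_initial_segment)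
    moreover have "(\<lambda>n. \<Sum>k. r (k + n)) \<longlonglongrightarrow> 0" by (rule suminf_exist_split2[OF sr])
    ultimately show ?thesis using tendsto_ennrealI[of "\<lambda>n. \<Sum>k. r (k + n)" 0] by simp
  qed
  then have "(\<lambda>n. ?H X + (\<Sum>k. ?H (R (k + n)))) \<longlonglongrightarrow> ?H X + 0" by (intro tendsto_intros)
  then show ?thesis using le by (intro LIMSEQ_le_const) auto
qed

text \<open>By the preceding splitting, closed sets satisfy the criterion of Caratheodory; they
  generate the Borel sets, on which the outer measure is therefore countably additive.\<close>

lemma hausdorff_measure_space: "measure_space UNIV (sets (borel :: 'a::euclidean_space measure)) (hausdorff_outer s)"
proof -
  let ?H = "hausdorff_outer s :: 'a set \<Rightarrow> ennreal"
  let ?L = "lambda_system UNIV (Pow UNIV) ?H"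
  have oms: "outer_measure_space (Pow UNIV) ?H"
    unfolding outer_measure_space_def positive_def increasing_def countably_subadditive_def
    by (auto simp: hausdorff_outer_empty intro: hausdorff_outer_mono hausdorff_outer_countable_subadd)
  interpret P: sigma_algebra UNIV "Pow UNIV :: 'a set set" by (rule sigma_algebra_Pow)
  have ms: "measure_space UNIV ?L ?H" by (rule P.caratheodory_lemma[OF oms])
  have "F \<in> ?L" if "closed F" for F
    unfolding P.lambda_system_eq
    using hausdorff_outer_closed_split[OF that, of s] hausdorff_outer_subadd[of s "_ \<inter> F" "_ - F"]
    by (auto intro!: antisym) (metis Int_Diff_Un)
  then have "sigma_sets UNIV {F. closed F} \<subseteq> ?L"
    using ms by (intro sigma_algebra.sigma_sets_subset) (auto simp: measure_space_def)
  then have sub: "sets borel \<subseteq> ?L" by (simp add: borel_eq_closed)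
  have "sigma_algebra UNIV (sets (borel :: 'a measure))" using sets.sigma_algebra_axioms[of "borel :: 'a measure"] by simp
  from measure_down[OF ms this sub] show ?thesis .
qed

text \<open>\<open>surf\<close> is given by \<open>measure_of\<close>, which falls back to the zero
  measure unless the set function is a measure. Only with countable additivity do integrals over
  \<open>surf\<close> relate to Hausdorff measure.\<close>

lemma
  fixes G :: "'a::euclidean_space set"
  assumes G: "G \<in> sets borel"
  shows sets_surf: "sets (surf G) = {G \<inter> B | B. B \<in> sets borel}"
    and emeasure_surf: "B \<in> sets borel \<Longrightarrow> B \<subseteq> G \<Longrightarrow> emeasure (surf G) B = hausdorff_outer (real DIM('a) - 1) B"
proof -
  let ?H = "hausdorff_outer (real DIM('a) - 1) :: 'a set \<Rightarrow> ennreal"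
  let ?M = "{G \<inter> B | B. B \<in> sets borel}"
  have "?M = sets (restrict_space borel G)" by (auto simp: sets_restrict_space)
  then have sa: "sigma_algebra G ?M"
    using sets.sigma_algebra_axioms[of "restrict_space borel G"] by (simp add: space_restrict_space)
  have sub: "?M \<subseteq> sets borel" using G by auto
  have pos: "positive ?M ?H" by (simp add: positive_def hausdorff_outer_empty)
  have "countably_additive (sets borel) ?H" using hausdorff_measure_space unfolding measure_space_def by blast
  then have ca: "countably_additive ?M ?H"
    unfolding countably_additive_def using sub by (metis (no_types, lifting) subset_trans subsetD)
  show "sets (surf G) = ?M"
    unfolding surf_def using sigma_algebra.sets_measure_of_eq[OF sa] by simp
  show "emeasure (surf G) B = ?H B" if "B \<in> sets borel" "B \<subseteq> G"
    unfolding surf_def by (rule emeasure_measure_of_sigma[OF sa pos ca]) (use that in blast)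
qed

section \<open>Separated nets\<close>

text \<open>The balls of half the separation distance are pairwise disjoint, so their volumes add up
  to at most the volume of \<open>S\<close>.\<close>

lemma packing:
  fixes P :: "'a::euclidean_space set"
  assumes P: "finite P" and r: "r > 0" and sep: "\<And>p q. p \<in> P \<Longrightarrow> q \<in> P \<Longrightarrow> p \<noteq> q \<Longrightarrow> r \<le> dist p q"
    and S: "S \<in> sets borel" "emeasure lborel S < \<infinity>" and sub: "\<And>p. p \<in> P \<Longrightarrow> ball p (r/2) \<subseteq> S"
  shows "real (card P) * (unit_ball_vol (DIM('a)) * (r/2) ^ DIM('a)) \<le> measure lborel S"
proof -
  have disj: "disjoint_family_on (\<lambda>p. ball p (r/2)) P"
    unfolding disjoint_family_on_def
  proof (intro ballI impI)
    fix p q assume pq: "p \<in> P" "q \<in> P" "p \<noteq> q"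
    have "x \<notin> ball q (r/2)" if "x \<in> ball p (r/2)" for x
      using sep[OF pq] that dist_triangle[of p q x] by (auto simp: dist_commute)
    then show "ball p (r/2) \<inter> ball q (r/2) = {}" by blast
  qed
  have "real (card P) * (unit_ball_vol (DIM('a)) * (r/2) ^ DIM('a)) = (\<Sum>p\<in>P. measure lborel (ball p (r/2)))"
    using r by (simp add: content_ball)
  also have "\<dots> = measure lborel (\<Union>p\<in>P. ball p (r/2))"
    by (rule measure_finite_Union[symmetric]) (use P disj emeasure_bounded_finite[OF bounded_ball] in \<open>auto simp: less_top\<close>)
  also have "\<dots> \<le> measure lborel S"
    by (rule measure_mono_fmeasurable) (use S sub in \<open>auto simp: fmeasurable_def intro!: borel_open\<close>)
  finally show ?thesis .
qed

text \<open>Packing bounds the size of separated subsets, so one of maximal cardinality exists; a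
  point far from all of its members could be added to it.\<close>

lemma separated_net_exists:
  fixes A :: "'a::euclidean_space set"
  assumes A: "bounded A" and r: "r > 0"
  obtains P where "P \<subseteq> A" "finite P" "\<And>p q. p \<in> P \<Longrightarrow> q \<in> P \<Longrightarrow> p \<noteq> q \<Longrightarrow> r \<le> dist p q"
    "\<And>a. a \<in> A \<Longrightarrow> \<exists>p\<in>P. dist a p < r"
proof -
  define Q where "Q P \<longleftrightarrow> P \<subseteq> A \<and> finite P \<and> (\<forall>p\<in>P. \<forall>q\<in>P. p \<noteq> q \<longrightarrow> r \<le> dist p q)" for P
  obtain x R where xR: "A \<subseteq> cball x R" using A bounded_subset_cball by blast
  let ?v = "unit_ball_vol (DIM('a)) * (r/2) ^ DIM('a)"
  have v: "?v > 0" using r by simp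
  have bd: "card P \<le> nat \<lfloor>measure lborel (cball x (R + r)) / ?v\<rfloor>" if "Q P" for P
  proof -
    have "real (card P) * ?v \<le> measure lborel (cball x (R + r))"
    proof (rule packing)
      show "ball p (r/2) \<subseteq> cball x (R + r)" if "p \<in> P" for p
      proof
        fix y assume "y \<in> ball p (r/2)"
        moreover have "dist x p \<le> R" using \<open>Q P\<close> xR that by (auto simp: Q_def)
        ultimately show "y \<in> cball x (R + r)" using dist_triangle[of x y p] r by auto
      qed
    qed (use that r emeasure_bounded_finite[OF bounded_cball] in \<open>auto simp: Q_def\<close>)
    then have "real (card P) \<le> measure lborel (cball x (R + r)) / ?v" using v by (simp add: pos_le_divide_eq)
    then show ?thesis by (simp add: le_nat_floor)
  qed
  have "Q {}" by (simp add: Q_def)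
  then obtain P where P: "Q P" "\<And>P'. Q P' \<Longrightarrow> card P' \<le> card P"
  proof -
    obtain n where n: "\<And>P. Q P \<Longrightarrow> card P \<le> n" using bd by blast
    have "\<exists>P. Q P \<and> (\<forall>P'. Q P' \<longrightarrow> card P' \<le> card P)"
      by (rule ex_has_greatest_nat[of Q "{}" card "Suc n"]) (use \<open>Q {}\<close> n in \<open>auto simp: less_Suc_eq_le\<close>)
    then show ?thesis using that by blast
  qed
  have "\<exists>p\<in>P. dist a p < r" if a: "a \<in> A" for a
  proof (rule ccontr)
    assume n: "\<not> ?thesis"
    then have "a \<notin> P" using r by force
    moreover have "Q (insert a P)" using P(1) a n by (auto simp: Q_def not_less dist_commute)
    ultimately show False using P(2)[of "insert a P"] P(1) by (simp add: Q_def)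
  qed
  then show thesis using that P(1) by (auto simp: Q_def)
qed

text \<open>The balls of radius \<open>r / 2\<close> around the counted points fit into a ball of
  radius \<open>5 * (r / 2)\<close>. The bound is independent of \<open>r\<close>, which is why
  cutoffs built on nets have gradients of order \<open>1 / r\<close>.\<close>

lemma separated_overlap:
  fixes P :: "'a::euclidean_space set"
  assumes P: "finite P" and r: "r > 0" and sep: "\<And>p q. p \<in> P \<Longrightarrow> q \<in> P \<Longrightarrow> p \<noteq> q \<Longrightarrow> r \<le> dist p q"
  shows "card {p\<in>P. norm (x - p) < 2 * r} \<le> 5 ^ DIM('a)"
proof -
  let ?Q = "{p\<in>P. norm (x - p) < 2 * r}" and ?V = "unit_ball_vol (DIM('a))"
  have "real (card ?Q) * (?V * (r/2) ^ DIM('a)) \<le> measure lborel (ball x (5 * (r / 2)))"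
  proof (rule packing)
    show "ball p (r/2) \<subseteq> ball x (5 * (r / 2))" if "p \<in> ?Q" for p
    proof
      fix y assume "y \<in> ball p (r/2)"
      moreover have "dist x p < 2 * r" using that by (simp add: dist_norm)
      ultimately show "y \<in> ball x (5 * (r / 2))" using dist_triangle[of x y p] by auto
    qed
  qed (use P r sep emeasure_bounded_finite[OF bounded_ball] in auto)
  also have "\<dots> = ?V * (5 * (r / 2)) ^ DIM('a)" using r by (intro content_ball) simp
  also have "\<dots> = 5 ^ DIM('a) * (?V * (r/2) ^ DIM('a))" unfolding power_mult_distrib[of 5 "r / 2"] by simp
  finally have "real (card ?Q) \<le> 5 ^ DIM('a)" using r by (simp add: mult_le_cancel_right)
  then show ?thesis by (metis of_nat_le_iff of_nat_numeral of_nat_power)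
qed

section \<open>Comparison of Hausdorff and Lebesgue measure\<close>

lemma hausdorff_const_pos: "s \<ge> 0 \<Longrightarrow> hausdorff_const s > 0"
  unfolding hausdorff_const_def by (intro divide_pos_pos Gamma_real_pos) auto

definition cylinder :: "'a::euclidean_space \<Rightarrow> real \<Rightarrow> 'a set \<Rightarrow> 'a set" where
  "cylinder e T A = {z + t *\<^sub>R e | z t. z \<in> A \<and> 0 \<le> t \<and> t \<le> T}"

text \<open>With \<open>\<rho>\<close> the diameter of \<open>C\<close>, balls of radius
  \<open>2 \<rho>\<close> placed at distance \<open>\<rho>\<close> along \<open>e\<close> cover the
  cylinder. About \<open>T / \<rho>\<close> of them are needed, so the volume is of order
  \<open>T \<rho>^(d - 1)\<close>, the Hausdorff weight of \<open>C\<close> times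
  \<open>T\<close>.\<close>

lemma cylinder_covered_by_balls:
  fixes C :: "'a::euclidean_space set"
  assumes dim: "2 \<le> DIM('a)" and e: "norm e = 1" and T: "T > 0" and C: "bounded C" "diameter C < T"
  shows "\<exists>Z\<in>sets borel. cylinder e T C \<subseteq> Z \<and>
    emeasure lborel Z \<le> ennreal (2 * T * unit_ball_vol (DIM('a)) * 2 ^ DIM('a) * diameter C powr (real DIM('a) - 1))"
proof (cases "C = {}")
  case True
  then show ?thesis by (intro bexI[of _ "{}"]) (auto simp: cylinder_def)
next
  case False
  then obtain p where p: "p \<in> C" by blast
  let ?\<rho> = "diameter C"
  have bd: "dist z p \<le> ?\<rho>" if "z \<in> C" for z using diameter_bounded_bound[OF C(1) that p] .
  show ?thesis
  proof (cases "?\<rho> = 0")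
    \<comment> \<open>Here the weight is 0, since \<open>0 powr s = 0\<close>, so the cylinder must
      be null: it is a segment, and the dimension is at least 2.\<close>
    case True
    then have "z = p" if "z \<in> C" for z using bd[OF that] by simp
    then have "C = {p}" using p by blast
    then have sub: "cylinder e T C \<subseteq> closed_segment p (p + T *\<^sub>R e)"
    proof -
      have "p + t *\<^sub>R e \<in> closed_segment p (p + T *\<^sub>R e)" if "0 \<le> t" "t \<le> T" for t
        unfolding in_segment using that T by (intro exI[of _ "t / T"]) (auto simp: algebra_simps)
      then show ?thesis using \<open>C = {p}\<close> by (auto simp: cylinder_def)
    qed
    have "negligible (closed_segment p (p + T *\<^sub>R e))"
      using interior_closed_segment_ge2[OF dim] negligible_convex_interior by blast
    then have "emeasure lborel (closed_segment p (p + T *\<^sub>R e)) = 0"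
      by (simp add: negligible_iff_emeasure0 emeasure_completion borel_closed closed_segment)
    then show ?thesis using sub True by (intro bexI[of _ "closed_segment p (p + T *\<^sub>R e)"]) (auto simp: borel_closed)
  next
    case False
    then have \<rho>: "?\<rho> > 0" using diameter_ge_0[OF C(1)] by simp
    define m where "m = nat \<lfloor>T / ?\<rho>\<rfloor>"
    define Z where "Z = (\<Union>j\<in>{..m}. cball (p + (real j * ?\<rho>) *\<^sub>R e) (2 * ?\<rho>))"
    have sub: "cylinder e T C \<subseteq> Z"
    proof
      fix y assume "y \<in> cylinder e T C"
      then obtain z t where zt: "z \<in> C" "0 \<le> t" "t \<le> T" "y = z + t *\<^sub>R e" by (auto simp: cylinder_def)
      define j where "j = nat \<lfloor>t / ?\<rho>\<rfloor>"
      have j: "real j \<le> t / ?\<rho>" "t / ?\<rho> < real j + 1" using zt \<rho> by (auto simp: j_def)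
      then have "\<bar>t - real j * ?\<rho>\<bar> \<le> ?\<rho>" using \<rho> by (auto simp: field_simps)
      moreover have y: "y - (p + (real j * ?\<rho>) *\<^sub>R e) = (z - p) + (t - real j * ?\<rho>) *\<^sub>R e"
        using zt(4) by (simp add: algebra_simps)
      have "norm (y - (p + (real j * ?\<rho>) *\<^sub>R e)) \<le> norm (z - p) + \<bar>t - real j * ?\<rho>\<bar>"
        unfolding y using norm_triangle_ineq[of "z - p" "(t - real j * ?\<rho>) *\<^sub>R e"] e by simp
      ultimately have "y \<in> cball (p + (real j * ?\<rho>) *\<^sub>R e) (2 * ?\<rho>)"
        using bd[OF zt(1)] by (simp add: dist_norm norm_minus_commute)
      moreover have "j \<le> m" unfolding j_def m_def using zt \<rho> by (intro nat_mono floor_mono divide_right_mono) auto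
      ultimately show "y \<in> Z" unfolding Z_def by blast
    qed
    have "emeasure lborel Z \<le> (\<Sum>j\<in>{..m}. emeasure lborel (cball (p + (real j * ?\<rho>) *\<^sub>R e) (2 * ?\<rho>)))"
      unfolding Z_def by (rule emeasure_subadditive_finite) auto
    also have "\<dots> = ennreal (real (Suc m) * (unit_ball_vol (DIM('a)) * (2 * ?\<rho>) ^ DIM('a)))"
      using \<rho> by (simp add: emeasure_cball ennreal_mult' flip: ennreal_of_nat_eq_real_of_nat)
    also have "\<dots> \<le> ennreal (2 * T / ?\<rho> * (unit_ball_vol (DIM('a)) * (2 * ?\<rho>) ^ DIM('a)))"
    proof (intro ennreal_leI mult_right_mono)
      \<comment> \<open>There are \<open>m + 1\<close> balls; the extra one is absorbed by the
        factor 2 because the diameter is less than \<open>T\<close>.\<close>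
      have "real m \<le> T / ?\<rho>" unfolding m_def using T \<rho> by simp
      moreover have "1 \<le> T / ?\<rho>" using C(2) \<rho> by simp
      ultimately show "real (Suc m) \<le> 2 * T / ?\<rho>" by simp
    qed (use \<rho> in auto)
    also have "2 * T / ?\<rho> * (unit_ball_vol (DIM('a)) * (2 * ?\<rho>) ^ DIM('a)) =
        2 * T * unit_ball_vol (DIM('a)) * 2 ^ DIM('a) * ?\<rho> powr (real DIM('a) - 1)"
      using \<rho> by (simp add: powr_diff powr_realpow power_mult_distrib)
    finally show ?thesis using sub by (intro bexI[of _ Z]) (auto simp: Z_def)
  qed
qed

text \<open>The constant of \<open>cylinder_covered_by_balls\<close>, without \<open>T\<close>,
  divided by the normalisation of Hausdorff measure.\<close>

definition cyl_const :: "'a::euclidean_space itself \<Rightarrow> real" where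
  "cyl_const TYPE('a) = 2 * unit_ball_vol (DIM('a)) * 2 ^ DIM('a) / hausdorff_const (real DIM('a) - 1)"

lemma cyl_const_pos: "cyl_const TYPE('a::euclidean_space) > 0"
proof -
  have "real DIM('a) - 1 \<ge> 0" using DIM_positive[where 'a='a] by linarith
  then show ?thesis unfolding cyl_const_def by (intro divide_pos_pos hausdorff_const_pos) auto
qed

text \<open>Every cover of \<open>A\<close> by sets of diameter less than \<open>T\<close> gives a
  cover of the cylinder by balls with proportional total volume, so the premeasure at the single
  scale \<open>T\<close> suffices. \<open>S\<close> is a Borel subset, as the cylinder over
  \<open>A\<close> need not be measurable.\<close>

lemma cylinder_measure_le:
  fixes A :: "'a::euclidean_space set"
  assumes dim: "2 \<le> DIM('a)" and e: "norm e = 1" and T: "T > 0"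
    and S: "S \<in> sets borel" "S \<subseteq> cylinder e T A"
  shows "emeasure lborel S \<le> ennreal (cyl_const TYPE('a) * T) * hausdorff_outer (real DIM('a) - 1) A"
proof -
  let ?s = "real DIM('a) - 1" and ?K = "cyl_const TYPE('a) * T"
  have s: "?s \<ge> 0" using dim by simp
  have K: "?K > 0" using cyl_const_pos[where 'a='a] T by simp
  have le: "emeasure lborel S \<le> ennreal ?K * (\<Sum>n. cover_wt ?s (C n))" if C: "C \<in> covers T A" for C
  proof -
    have Cn: "bounded (C n)" "diameter (C n) < T" for n using C by (auto simp: covers_def)
    have "\<forall>n. \<exists>Z. Z \<in> sets borel \<and> cylinder e T (C n) \<subseteq> Z \<and> emeasure lborel Z \<le>
      ennreal (2 * T * unit_ball_vol (DIM('a)) * 2 ^ DIM('a) * diameter (C n) powr ?s)"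
      using cylinder_covered_by_balls[OF dim e T Cn] by blast
    then obtain Z where Z: "\<And>n. Z n \<in> sets borel" "\<And>n. cylinder e T (C n) \<subseteq> Z n" "\<And>n. emeasure lborel (Z n) \<le>
      ennreal (2 * T * unit_ball_vol (DIM('a)) * 2 ^ DIM('a) * diameter (C n) powr ?s)" by metis
    have "S \<subseteq> (\<Union>n. Z n)"
    proof
      fix y assume "y \<in> S"
      then obtain z t where "z \<in> A" "0 \<le> t" "t \<le> T" "y = z + t *\<^sub>R e" using S(2) by (auto simp: cylinder_def)
      moreover from this obtain n where "z \<in> C n" using C by (auto simp: covers_def)
      ultimately have "y \<in> cylinder e T (C n)" by (auto simp: cylinder_def)
      then show "y \<in> (\<Union>n. Z n)" using Z(2) by blast
    qed
    then have "emeasure lborel S \<le> emeasure lborel (\<Union>n. Z n)" using Z(1) by (intro emeasure_mono) auto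
    also have "\<dots> \<le> (\<Sum>n. emeasure lborel (Z n))" using Z(1) by (intro emeasure_subadditive_countably) auto
    also have "\<dots> \<le> (\<Sum>n. ennreal ?K * cover_wt ?s (C n))"
    proof (intro suminf_le order.trans[OF Z(3)])
      fix n
      have eq: "2 * T * unit_ball_vol (DIM('a)) * 2 ^ DIM('a) * diameter (C n) powr ?s =
          ?K * (hausdorff_const ?s * diameter (C n) powr ?s)"
        using hausdorff_const_pos[OF s] by (simp add: cyl_const_def)
      show "ennreal (2 * T * unit_ball_vol (DIM('a)) * 2 ^ DIM('a) * diameter (C n) powr ?s)
          \<le> ennreal ?K * cover_wt ?s (C n)"
        unfolding cover_wt_def eq using K by (simp only: ennreal_mult' less_imp_le order_refl)
    qed auto
    finally show ?thesis by simp
  qed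
  have inv: "ennreal (1 / ?K) * (ennreal ?K * x) = x" "ennreal ?K * (ennreal (1 / ?K) * x) = x" for x
  proof -
    have "ennreal (1 / ?K) * ennreal ?K = 1" "ennreal ?K * ennreal (1 / ?K) = 1"
      using K T cyl_const_pos[where 'a='a]
      by (simp_all only: ennreal_mult[symmetric] less_imp_le zero_le_divide_1_iff) simp_all
    then show "ennreal (1 / ?K) * (ennreal ?K * x) = x" "ennreal ?K * (ennreal (1 / ?K) * x) = x"
      by (simp_all only: mult.assoc[symmetric] mult_1)
  qed
  have "ennreal (1 / ?K) * emeasure lborel S \<le> hausdorff_pre ?s T A"
    unfolding hausdorff_pre_def
    by (rule INF_greatest) (use mult_left_mono[OF le, of _ "ennreal (1 / ?K)"] in \<open>simp add: inv\<close>)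
  also have "\<dots> \<le> hausdorff_outer ?s A" by (rule hausdorff_pre_le_outer[OF T])
  finally have "ennreal ?K * (ennreal (1 / ?K) * emeasure lborel S) \<le> ennreal ?K * hausdorff_outer ?s A"
    by (rule mult_left_mono) simp
  then show ?thesis by (simp only: inv)
qed

text \<open>A \<delta>-net of \<open>A\<close> has at most of order \<open>\<delta>^(1 - d)\<close>
  points, because disjoint balls around them lie in a neighbourhood of volume
  \<open>K * \<delta>\<close>. The \<delta>-balls around the net then cover \<open>A\<close> with
  bounded total weight.\<close>

lemma hausdorff_outer_finite_if_thin:
  fixes A :: "'a::euclidean_space set"
  assumes A: "bounded A" and \<delta>0: "\<delta>0 > 0" and K: "K \<ge> 0"
    and thin: "\<And>\<delta>. 0 < \<delta> \<Longrightarrow> \<delta> < \<delta>0 \<Longrightarrow>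
      \<exists>S\<in>sets borel. (\<Union>a\<in>A. ball a \<delta>) \<subseteq> S \<and> emeasure lborel S \<le> ennreal (K * \<delta>)"
  shows "hausdorff_outer (real DIM('a) - 1) A < top"
proof -
  let ?s = "real DIM('a) - 1" and ?V = "unit_ball_vol (DIM('a))"
  \<comment> \<open>A net has at most \<open>K \<delta> / (V (\<delta>/2)^d)\<close> points, with
    \<open>V\<close> the volume of the unit ball, and each covering ball weighs
    \<open>hausdorff_const\<close> times \<open>(2 \<delta>)^(d-1)\<close>; in the product \<delta>
    cancels.\<close>
  define K1 where "K1 = hausdorff_const ?s * K * 4 ^ DIM('a) / (2 * ?V)"
  have s: "?s \<ge> 0" using DIM_positive[where 'a='a] by linarith
  note hc = hausdorff_const_pos[OF s]
  \<comment> \<open>The scale is \<open>3 * \<delta>\<close> because the covering balls have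
    diameter \<open>2 * \<delta>\<close> and \<open>covers\<close> demands strict
    inequality.\<close>
  have pre: "hausdorff_pre ?s (3 * \<delta>) A \<le> ennreal K1" if \<delta>: "0 < \<delta>" "\<delta> < \<delta>0" for \<delta>
  proof -
    obtain S where S: "S \<in> sets borel" "(\<Union>a\<in>A. ball a \<delta>) \<subseteq> S" "emeasure lborel S \<le> ennreal (K * \<delta>)"
      using thin[OF \<delta>] by blast
    obtain P where P: "P \<subseteq> A" "finite P" "\<And>p q. p \<in> P \<Longrightarrow> q \<in> P \<Longrightarrow> p \<noteq> q \<Longrightarrow> \<delta> \<le> dist p q"
      "\<And>a. a \<in> A \<Longrightarrow> \<exists>p\<in>P. dist a p < \<delta>" using separated_net_exists[OF A \<delta>(1)] by blast
    have fin: "emeasure lborel S < \<infinity>" using S(3) by (rule le_less_trans) simp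
    have "real (card P) * (?V * (\<delta>/2) ^ DIM('a)) \<le> measure lborel S"
    proof (rule packing[OF P(2) \<delta>(1) P(3) S(1) fin])
      fix p assume "p \<in> P"
      then have "ball p \<delta> \<subseteq> S" using S(2) P(1) by blast
      then show "ball p (\<delta>/2) \<subseteq> S" using \<delta>(1) by (auto simp: subset_iff)
    qed
    also have "\<dots> \<le> K * \<delta>" using S(3) fin K \<delta> by (simp add: emeasure_eq_ennreal_measure)
    finally have cP: "real (card P) * (?V * (\<delta>/2) ^ DIM('a)) \<le> K * \<delta>" .
    obtain f where f: "bij_betw f {..<card P} P" using ex_bij_betw_nat_finite[OF P(2)] atLeast0LessThan by metis
    define C where "C n = (if n < card P then cball (f n) \<delta> else {})" for n
    have "C \<in> covers (3 * \<delta>) A"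
    proof -
      have "A \<subseteq> (\<Union>n. C n)"
      proof
        fix a assume "a \<in> A"
        then obtain p where p: "p \<in> P" "dist a p < \<delta>" using P(4) by blast
        then have "p \<in> f ` {..<card P}" using f by (simp add: bij_betw_def)
        then obtain n where "n < card P" "f n = p" by blast
        then have "a \<in> C n" using p by (simp add: C_def dist_commute)
        then show "a \<in> (\<Union>n. C n)" by blast
      qed
      then show ?thesis using \<delta>(1) by (auto simp: covers_def C_def)
    qed
    then have "hausdorff_pre ?s (3 * \<delta>) A \<le> (\<Sum>n. cover_wt ?s (C n))" unfolding hausdorff_pre_def by (rule INF_lower)
    also have "\<dots> = (\<Sum>n<card P. cover_wt ?s (C n))"
      by (rule suminf_finite) (auto simp: C_def cover_wt_empty)
    also have "\<dots> = (\<Sum>n<card P. ennreal (hausdorff_const ?s * (2 * \<delta>) powr ?s))"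
      by (rule sum.cong) (use \<delta>(1) in \<open>auto simp: C_def cover_wt_def\<close>)
    also have "\<dots> = ennreal (real (card P) * (hausdorff_const ?s * (2 * \<delta>) powr ?s))"
      using hc by (simp add: ennreal_mult' flip: ennreal_of_nat_eq_real_of_nat)
    also have "\<dots> \<le> ennreal K1"
    proof (rule ennreal_leI)
      have pw: "(2 * \<delta>) powr ?s = (2 * \<delta>) ^ DIM('a) / (2 * \<delta>)"
        using \<delta>(1) by (simp add: powr_diff powr_realpow)
      have "(2 * \<delta>) ^ DIM('a) = 4 ^ DIM('a) * (\<delta>/2) ^ DIM('a)"
        using power_mult_distrib[of 4 "\<delta> / 2" "DIM('a)"] by simp
      then have "real (card P) * (hausdorff_const ?s * (2 * \<delta>) powr ?s) =
          real (card P) * (hausdorff_const ?s * (4 ^ DIM('a) * (\<delta>/2) ^ DIM('a) / (2 * \<delta>)))"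
        unfolding pw by (simp only:)
      also have "\<dots> = hausdorff_const ?s * 4 ^ DIM('a) / (2 * \<delta> * ?V) * (real (card P) * (?V * (\<delta>/2) ^ DIM('a)))"
      proof -
        have "?V \<noteq> 0" by (rule less_imp_neq[symmetric, OF unit_ball_vol_pos]) simp
        then show ?thesis using \<delta>(1) by (simp add: field_simps)
      qed
      also have "\<dots> \<le> hausdorff_const ?s * 4 ^ DIM('a) / (2 * \<delta> * ?V) * (K * \<delta>)"
        using hc \<delta>(1) by (intro mult_left_mono cP divide_nonneg_nonneg) auto
      also have "\<dots> = K1" using \<delta>(1) by (simp add: K1_def)
      finally show "real (card P) * (hausdorff_const ?s * (2 * \<delta>) powr ?s) \<le> K1" .
    qed
    finally show ?thesis .
  qed
  have "hausdorff_pre ?s \<delta>' A \<le> ennreal K1" if "\<delta>' > 0" for \<delta>'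
  proof -
    let ?\<delta> = "min (\<delta>0 / 2) (\<delta>' / 3)"
    have "hausdorff_pre ?s \<delta>' A \<le> hausdorff_pre ?s (3 * ?\<delta>) A" by (rule hausdorff_pre_antimono) auto
    also have "\<dots> \<le> ennreal K1" by (rule pre) (use that \<delta>0 in auto)
    finally show ?thesis .
  qed
  then have "hausdorff_outer ?s A \<le> ennreal K1" unfolding hausdorff_outer_eq by (intro SUP_least) auto
  then show ?thesis by (rule le_less_trans) simp
qed

section \<open>Boundary layers of Lipschitz domains\<close>

definition strip :: "'a::euclidean_space set \<Rightarrow> real \<Rightarrow> 'a set" where
  "strip D \<delta> = {y \<in> D. infdist y (frontier D) < \<delta>}"

lemma open_strip: "open D \<Longrightarrow> open (strip D \<delta>)"
  unfolding strip_def Collect_conj_eq Collect_mem_eq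
  by (intro open_Int open_Collect_less continuous_intros)

lemma strip_mono: "\<delta> \<le> \<delta>' \<Longrightarrow> strip D \<delta> \<subseteq> strip D \<delta>'"
  by (auto simp: strip_def)

locale lipschitz_chart =
  fixes D :: "'a::euclidean_space set" and x :: 'a and r :: real and e :: 'a and g :: "'a \<Rightarrow> real" and C :: real
  assumes D: "open D" and bdD: "bounded D" and r: "r > 0" and e: "norm e = 1" and lip: "C-lipschitz_on UNIV g"
    and chart: "ball x r \<inter> D = {y \<in> ball x r. y \<bullet> e > g (y - (y \<bullet> e) *\<^sub>R e)}"
begin

definition height :: "'a \<Rightarrow> real" where
  "height y = y \<bullet> e - g (y - (y \<bullet> e) *\<^sub>R e)"

text \<open>A Lipschitz constant of \<open>height\<close>: 1 from the component along
  \<open>e\<close>, and \<open>C\<close> times the bound 2 for the map that removes this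
  component.\<close>

definition \<kappa> :: real where "\<kappa> = 1 + 2 * C"

lemma C_nonneg: "C \<ge> 0"
  using lipschitz_on_nonneg[OF lip] .

lemma \<kappa>_ge: "\<kappa> \<ge> 1"
  using C_nonneg by (simp add: \<kappa>_def)

lemma ee: "e \<bullet> e = 1"
  using e by (simp add: norm_eq_1)

lemma height_shift: "height (y + t *\<^sub>R e) = height y + t"
proof -
  have eq: "(y + t *\<^sub>R e) - ((y + t *\<^sub>R e) \<bullet> e) *\<^sub>R e = y - (y \<bullet> e) *\<^sub>R e"
    using ee by (simp add: inner_add_left algebra_simps)
  show ?thesis unfolding height_def eq using ee by (simp add: inner_add_left)
qed

lemma height_lipschitz: "\<bar>height y - height z\<bar> \<le> \<kappa> * dist y z"
proof -
  have i: "\<bar>(y - z) \<bullet> e\<bar> \<le> dist y z" using Cauchy_Schwarz_ineq2[of "y - z" e] e by (simp add: dist_norm)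
  have "\<bar>g (y - (y \<bullet> e) *\<^sub>R e) - g (z - (z \<bullet> e) *\<^sub>R e)\<bar> \<le> C * dist (y - (y \<bullet> e) *\<^sub>R e) (z - (z \<bullet> e) *\<^sub>R e)"
    using lipschitz_onD[OF lip, of "y - (y \<bullet> e) *\<^sub>R e" "z - (z \<bullet> e) *\<^sub>R e"] by (simp add: dist_real_def)
  also have "\<dots> \<le> C * (2 * dist y z)"
  proof (rule mult_left_mono[OF _ C_nonneg])
    have eq: "(y - (y \<bullet> e) *\<^sub>R e) - (z - (z \<bullet> e) *\<^sub>R e) = (y - z) - ((y - z) \<bullet> e) *\<^sub>R e"
      by (simp add: inner_diff_left algebra_simps)
    have "dist (y - (y \<bullet> e) *\<^sub>R e) (z - (z \<bullet> e) *\<^sub>R e) \<le> norm (y - z) + norm (((y - z) \<bullet> e) *\<^sub>R e)"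
      unfolding dist_norm eq by (rule norm_triangle_ineq4)
    then show "dist (y - (y \<bullet> e) *\<^sub>R e) (z - (z \<bullet> e) *\<^sub>R e) \<le> 2 * dist y z"
      using i e by (simp add: dist_norm)
  qed
  finally have le: "\<bar>g (y - (y \<bullet> e) *\<^sub>R e) - g (z - (z \<bullet> e) *\<^sub>R e)\<bar> \<le> C * (2 * dist y z)" .
  have eq: "height y - height z = (y - z) \<bullet> e - (g (y - (y \<bullet> e) *\<^sub>R e) - g (z - (z \<bullet> e) *\<^sub>R e))"
    by (simp add: height_def inner_diff_left)
  have "\<bar>height y - height z\<bar> \<le> dist y z + C * (2 * dist y z)"
    unfolding eq by (rule order.trans[OF abs_triangle_ineq4 add_mono[OF i le]])
  also have "\<dots> = \<kappa> * dist y z" by (simp add: \<kappa>_def algebra_simps)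
  finally show ?thesis .
qed

lemma height_continuous: "continuous_on UNIV height"
proof -
  have g: "continuous_on UNIV g" by (rule lipschitz_on_continuous_on[OF lip])
  have "continuous_on UNIV (\<lambda>y. y - (y \<bullet> e) *\<^sub>R e)" by (intro continuous_intros)
  then have "continuous_on UNIV (\<lambda>y. g (y - (y \<bullet> e) *\<^sub>R e))"
    by (rule continuous_on_compose2[OF g]) simp
  then show ?thesis unfolding height_def by (intro continuous_intros)
qed

lemma D_iff: "y \<in> ball x r \<Longrightarrow> y \<in> D \<longleftrightarrow> height y > 0"
  using chart unfolding height_def by (auto simp: set_eq_iff)

text \<open>A point of negative height has a neighbourhood that misses \<open>D\<close>, and a point
  of height 0 is approached from \<open>D\<close> by moving it along \<open>e\<close>.\<close>

lemma frontier_iff: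
  assumes y: "y \<in> ball x r"
  shows "y \<in> frontier D \<longleftrightarrow> height y = 0"
proof
  assume f: "y \<in> frontier D"
  then have cl: "y \<in> closure D" "y \<notin> D" using D by (auto simp: frontier_def interior_open)
  then have "height y \<le> 0" using D_iff[OF y] by simp
  moreover have "\<not> height y < 0"
  proof
    assume "height y < 0"
    let ?U = "ball x r \<inter> {z. height z < 0}"
    have "open ?U" by (intro open_Int open_ball open_Collect_less height_continuous continuous_intros)
    moreover have "?U \<inter> D = {}" using D_iff by auto
    ultimately have "?U \<inter> closure D = {}" by (simp add: open_Int_closure_eq_empty)
    then show False using cl y \<open>height y < 0\<close> by auto
  qed
  ultimately show "height y = 0" by simp
next
  assume z: "height y = 0"
  then have "y \<notin> D" using D_iff[OF y] by simp
  moreover have "y \<in> closure D"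
    unfolding closure_approachable
  proof (intro allI impI)
    fix \<epsilon> :: real assume \<epsilon>: "\<epsilon> > 0"
    define t where "t = min \<epsilon> (r - dist x y) / 2"
    have t: "t > 0" "t < \<epsilon>" "t < r - dist x y" using \<epsilon> y by (auto simp: t_def)
    have d: "dist (y + t *\<^sub>R e) y = t" using t e by (simp add: dist_norm)
    have "dist x (y + t *\<^sub>R e) < r" using dist_triangle[of x "y + t *\<^sub>R e" y] d t by (simp add: dist_commute)
    then have inD: "y + t *\<^sub>R e \<in> D" using D_iff[of "y + t *\<^sub>R e"] height_shift[of y t] z t by simp
    have "dist (y + t *\<^sub>R e) y < \<epsilon>" unfolding d by (rule t(2))
    then show "\<exists>z\<in>D. dist z y < \<epsilon>" using inD by blast
  qed
  ultimately show "y \<in> frontier D" using D by (simp add: frontier_def interior_open)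
qed

definition foot :: "'a \<Rightarrow> 'a" where "foot y = y - height y *\<^sub>R e"

lemma foot_continuous: "continuous_on UNIV foot"
  unfolding foot_def by (intro continuous_intros height_continuous)

lemma foot_height: "height (foot y) = 0"
  using height_shift[of y "- height y"] by (simp add: foot_def)

text \<open>The \<delta>-neighbourhood lies in the tube of heights at most
  \<open>\<kappa> * \<delta>\<close> in absolute value. About \<open>1 / \<delta>\<close> translates
  of this tube along \<open>e\<close> are disjoint and stay in a fixed ball, so its volume is of
  order \<delta>.\<close>

lemma thin_tube:
  assumes \<delta>: "0 < \<delta>" "\<delta> < min 1 (r / 2)"
  shows "\<exists>S\<in>sets borel. (\<Union>a\<in>frontier D \<inter> ball x (r/2). ball a \<delta>) \<subseteq> S \<and>
    emeasure lborel S \<le> ennreal (measure lborel (ball x (r + 6 * \<kappa>)) * \<delta>)"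
proof -
  define S where "S = ball x r \<inter> {y. \<bar>height y\<bar> \<le> \<kappa> * \<delta>}"
  have clS: "closed {y. \<bar>height y\<bar> \<le> \<kappa> * \<delta>}"
    by (intro closed_Collect_le continuous_intros height_continuous)
  then have S: "S \<in> sets borel" unfolding S_def by (auto intro: borel_closed borel_open)
  have Sfin: "emeasure lborel S < \<infinity>" by (rule emeasure_bounded_finite) (auto simp: S_def intro: bounded_subset[OF bounded_ball])
  have sub: "(\<Union>a\<in>frontier D \<inter> ball x (r/2). ball a \<delta>) \<subseteq> S"
  proof
    fix y assume "y \<in> (\<Union>a\<in>frontier D \<inter> ball x (r/2). ball a \<delta>)"
    then obtain a where a: "a \<in> frontier D" "dist x a < r/2" "dist a y < \<delta>" by auto
    then have "height a = 0" using frontier_iff[of a] r by simp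
    then have "\<bar>height y\<bar> \<le> \<kappa> * dist a y" using height_lipschitz[of y a] by (simp add: dist_commute)
    also have "\<dots> \<le> \<kappa> * \<delta>" using a \<kappa>_ge by (intro mult_left_mono) auto
    finally show "y \<in> S" using a \<delta> dist_triangle[of x y a] by (auto simp: S_def)
  qed
  \<comment> \<open>With about \<open>1 / \<delta>\<close> shifts of step
    \<open>3 * \<kappa> * \<delta>\<close> the total displacement is at most
    \<open>6 * \<kappa>\<close>, whence the radius of the enclosing ball.\<close>
  define m where "m = nat \<lceil>1 / \<delta>\<rceil>"
  have m: "1 / \<delta> \<le> real m" "real m \<le> 1 / \<delta> + 1"
  proof -
    have "0 < 1 / \<delta>" using \<delta> by simp
    then show "1 / \<delta> \<le> real m" "real m \<le> 1 / \<delta> + 1" unfolding m_def by linarith+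
  qed
  \<comment> \<open>Heights in the tube fill an interval of length
    \<open>2 * \<kappa> * \<delta>\<close>; the larger step 3 makes the height intervals of
    different translates disjoint.\<close>
  let ?h = "\<lambda>j::nat. (3 * \<kappa> * \<delta> * real j) *\<^sub>R e"
  let ?S = "\<lambda>j. (+) (?h j) ` S"
  have disj: "disjoint_family_on ?S {..<m}"
    unfolding disjoint_family_on_def
  proof (intro ballI impI)
    fix i j assume "i \<in> {..<m}" "j \<in> {..<m}" "i \<noteq> j"
    have "\<kappa> * \<delta> > 0" using \<kappa>_ge \<delta> by simp
    have "False" if y: "y \<in> ?S i" "y \<in> ?S j" for y
    proof -
      have "\<bar>height y - 3 * \<kappa> * \<delta> * real k\<bar> \<le> \<kappa> * \<delta>" if "y \<in> ?S k" for k
      proof -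
        obtain z where z: "z \<in> S" "y = ?h k + z" using \<open>y \<in> ?S k\<close> by blast
        then show ?thesis using height_shift[of z "3 * \<kappa> * \<delta> * real k"] by (simp add: S_def add.commute)
      qed
      from this[OF y(1)] this[OF y(2)] have "\<bar>3 * \<kappa> * \<delta> * real i - 3 * \<kappa> * \<delta> * real j\<bar> \<le> 2 * (\<kappa> * \<delta>)"
        by linarith
      moreover have "3 * \<kappa> * \<delta> * real i - 3 * \<kappa> * \<delta> * real j = 3 * (\<kappa> * \<delta>) * (real i - real j)"
        by (simp add: algebra_simps)
      moreover have "1 \<le> \<bar>real i - real j\<bar>" using \<open>i \<noteq> j\<close> by linarith
      then have "3 * (\<kappa> * \<delta>) * 1 \<le> 3 * (\<kappa> * \<delta>) * \<bar>real i - real j\<bar>"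
        using \<open>\<kappa> * \<delta> > 0\<close> by (intro mult_left_mono) auto
      moreover have "\<bar>3 * (\<kappa> * \<delta>) * (real i - real j)\<bar> = \<bar>3 * (\<kappa> * \<delta>)\<bar> * \<bar>real i - real j\<bar>" by (rule abs_mult)
      moreover have "\<bar>3 * (\<kappa> * \<delta>)\<bar> = 3 * (\<kappa> * \<delta>)" using \<open>\<kappa> * \<delta> > 0\<close> by (intro abs_of_pos) linarith
      ultimately show False using \<open>\<kappa> * \<delta> > 0\<close> by (simp only:)
    qed
    then show "?S i \<inter> ?S j = {}" by blast
  qed
  have Sj: "?S j \<in> sets borel \<and> emeasure lborel (?S j) = emeasure lborel S" for j
  proof -
    have eq: "?S j = (+) (- ?h j) -` S \<inter> space borel"
    proof -
      have "y \<in> ?S j \<longleftrightarrow> - ?h j + y \<in> S" for y by (auto simp: image_iff algebra_simps intro!: bexI[of _ "- ?h j + y"])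
      then show ?thesis by auto
    qed
    have "(+) (- ?h j) -` S \<inter> space borel \<in> sets borel"
      using S by (intro measurable_sets[of _ borel borel]) auto
    moreover have "emeasure lborel S = emeasure (distr lborel borel ((+) (- ?h j))) S"
      by (simp only: lborel_distr_plus)
    then have "emeasure lborel S = emeasure lborel (?S j)"
      using S eq by (subst (asm) emeasure_distr) auto
    ultimately show ?thesis using eq by simp
  qed
  have "real m * measure lborel S = (\<Sum>j<m. measure lborel (?S j))" using Sj by (simp add: measure_def)
  also have "\<dots> = measure lborel (\<Union>j<m. ?S j)"
    by (rule measure_finite_Union[symmetric]) (use disj Sj Sfin in auto)
  also have "\<dots> \<le> measure lborel (ball x (r + 6 * \<kappa>))"
  proof (rule measure_mono_fmeasurable)
    show "(\<Union>j<m. ?S j) \<subseteq> ball x (r + 6 * \<kappa>)"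
    proof
      fix y assume "y \<in> (\<Union>j<m. ?S j)"
      then obtain j z where j: "j < m" "z \<in> S" "y = ?h j + z" by blast
      have "3 * \<kappa> * \<delta> * real j \<le> 3 * \<kappa> * (\<delta> * (1 / \<delta> + 1))"
        using j m \<kappa>_ge \<delta> by (simp add: mult.assoc)
      also have "\<delta> * (1 / \<delta> + 1) \<le> 2" using \<delta> by (simp add: algebra_simps)
      finally have "3 * \<kappa> * \<delta> * real j \<le> 6 * \<kappa>" using \<kappa>_ge by simp
      moreover have "dist z y = 3 * \<kappa> * \<delta> * real j" using j(3) e \<kappa>_ge \<delta> by (simp add: dist_norm abs_mult)
      moreover have "dist x z < r" using j(2) by (simp add: S_def)
      ultimately show "y \<in> ball x (r + 6 * \<kappa>)"
        unfolding mem_ball using dist_triangle[of x y z] by linarith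
    qed
  qed (use Sj emeasure_bounded_finite[OF bounded_ball] in \<open>auto simp: fmeasurable_def\<close>)
  finally have "real m * measure lborel S \<le> measure lborel (ball x (r + 6 * \<kappa>))" .
  moreover have "1 / \<delta> * measure lborel S \<le> real m * measure lborel S" using m by (intro mult_right_mono) auto
  ultimately have "1 / \<delta> * measure lborel S \<le> measure lborel (ball x (r + 6 * \<kappa>))" by linarith
  then have "measure lborel S \<le> measure lborel (ball x (r + 6 * \<kappa>)) * \<delta>" using \<delta> by (simp add: field_simps)
  then have "emeasure lborel S \<le> ennreal (measure lborel (ball x (r + 6 * \<kappa>)) * \<delta>)"
    using Sfin by (simp add: emeasure_eq_ennreal_measure ennreal_leI)
  then show ?thesis using S sub by blast
qed

lemma frontier_patch_finite: "hausdorff_outer (real DIM('a) - 1) (frontier D \<inter> ball x (r/2)) < top"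
proof (rule hausdorff_outer_finite_if_thin[of _ "min 1 (r / 2)" "measure lborel (ball x (r + 6 * \<kappa>))"])
  show "bounded (frontier D \<inter> ball x (r/2))" by (rule bounded_subset[OF bounded_ball]) auto
  show "min 1 (r / 2) > 0" using r by simp
qed (use thin_tube in auto)

definition layer :: "real \<Rightarrow> 'a set" where
  "layer T = {y \<in> ball x (r/2). 0 < height y \<and> height y < T}"

lemma layer_borel: "layer T \<in> sets borel"
proof -
  have "open (ball x (r/2) \<inter> {y. 0 < height y} \<inter> {y. height y < T})"
    by (intro open_Int open_ball open_Collect_less height_continuous continuous_intros)
  moreover have "layer T = ball x (r/2) \<inter> {y. 0 < height y} \<inter> {y. height y < T}" by (auto simp: layer_def)
  ultimately show ?thesis by (simp add: borel_open)
qed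

text \<open>Starting in the half ball and descending by less than \<open>r / 2\<close>, one stays
  inside the chart, where \<open>D\<close> and its frontier are read off from the height. The points
  passed are at distance less than \<open>T\<close> from the foot.\<close>

lemma layer_points:
  assumes T: "T < r / 2" and y: "y \<in> layer T"
  shows "foot y \<in> frontier D" "\<And>s. - height y < s \<Longrightarrow> s \<le> 0 \<Longrightarrow> y + s *\<^sub>R e \<in> strip D T"
proof -
  have yb: "dist x y < r / 2" "0 < height y" "height y < T" using y by (auto simp: layer_def)
  have b: "y + s *\<^sub>R e \<in> ball x r" if "\<bar>s\<bar> \<le> height y" for s
    using dist_triangle[of x "y + s *\<^sub>R e" y] that yb e T by (simp add: dist_norm[of y])
  have fb: "foot y \<in> ball x r" using b[of "- height y"] yb by (simp add: foot_def)
  then show f: "foot y \<in> frontier D" using frontier_iff foot_height by blast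
  fix s assume s: "- height y < s" "s \<le> 0"
  have "y + s *\<^sub>R e \<in> D" using D_iff[OF b[of s]] height_shift[of y s] s by simp
  moreover have "infdist (y + s *\<^sub>R e) (frontier D) \<le> dist (y + s *\<^sub>R e) (foot y)" by (rule infdist_le[OF f])
  moreover have "(y + s *\<^sub>R e) - foot y = (s + height y) *\<^sub>R e" by (simp add: foot_def algebra_simps)
  then have "dist (y + s *\<^sub>R e) (foot y) = s + height y" using s e by (simp add: dist_norm)
  ultimately show "y + s *\<^sub>R e \<in> strip D T" using s yb by (simp add: strip_def)
qed

text \<open>The image under \<open>foot\<close> of Lebesgue measure on the layer is dominated by a
  multiple of surface measure: points with foot in \<open>B\<close> lie in the cylinder over
  \<open>B \<inter> frontier D\<close>. Integrating \<open>f\<close> against both measures gives the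
  claim.\<close>

lemma layer_foot_integral:
  assumes dim: "2 \<le> DIM('a)" and T: "0 < T" "T < r / 2" and f: "f \<in> borel_measurable borel"
  shows "(\<integral>\<^sup>+y. f (foot y) * indicator (layer T) y \<partial>lborel)
    \<le> ennreal (cyl_const TYPE('a) * T) * (\<integral>\<^sup>+z. f z \<partial>surf (frontier D))"
proof -
  let ?A = "layer T" and ?K = "ennreal (cyl_const TYPE('a) * T)"
  have fD: "frontier D \<in> sets borel" by (simp add: borel_closed)
  have mf: "foot \<in> borel_measurable borel" by (rule borel_measurable_continuous_onI[OF foot_continuous])
  define M1 where "M1 = distr (density lborel (indicator ?A)) borel foot"
  define M2 where "M2 = scale_measure ?K (distr (surf (frontier D)) borel (\<lambda>x. x))"
  have id: "(\<lambda>x. x) \<in> measurable (surf (frontier D)) borel"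
    by (rule measurableI) (auto simp: sets_surf[OF fD] space_surf)
  have le: "M1 \<le> M2"
  proof (subst le_measure)
    show "sets M1 = sets M2" by (simp add: M1_def M2_def)
    show "\<forall>B\<in>sets M1. emeasure M1 B \<le> emeasure M2 B"
    proof
      fix B assume "B \<in> sets M1"
      then have B: "B \<in> sets borel" by (simp add: M1_def)
      have pre: "foot -` B \<in> sets borel" using measurable_sets[OF mf B] by simp
      have "emeasure M1 B = emeasure lborel (?A \<inter> foot -` B)"
        unfolding M1_def using B mf pre layer_borel
        by (subst emeasure_distr) (auto simp: emeasure_density nn_integral_indicator simp flip: indicator_inter_arith)
      also have "\<dots> \<le> ?K * hausdorff_outer (real DIM('a) - 1) (B \<inter> frontier D)"
      proof (rule cylinder_measure_le[OF dim e T(1)])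
        show "?A \<inter> foot -` B \<in> sets borel" using pre layer_borel by simp
        show "?A \<inter> foot -` B \<subseteq> cylinder e T (B \<inter> frontier D)"
        proof
          fix y assume y: "y \<in> ?A \<inter> foot -` B"
          then have "y = foot y + height y *\<^sub>R e" "foot y \<in> B \<inter> frontier D" "0 \<le> height y" "height y \<le> T"
            using layer_points(1)[OF T(2)] by (auto simp: foot_def layer_def)
          then show "y \<in> cylinder e T (B \<inter> frontier D)" unfolding cylinder_def by blast
        qed
      qed
      also have "hausdorff_outer (real DIM('a) - 1) (B \<inter> frontier D) = emeasure (surf (frontier D)) (B \<inter> frontier D)"
        using emeasure_surf[OF fD, of "B \<inter> frontier D"] B fD by simp
      also have "?K * \<dots> = emeasure M2 B"
        unfolding M2_def using B id by (simp add: emeasure_distr space_surf)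
      finally show "emeasure M1 B \<le> emeasure M2 B" .
    qed
  qed
  have "(\<integral>\<^sup>+y. f (foot y) * indicator ?A y \<partial>lborel) = (\<integral>\<^sup>+y. f (foot y) \<partial>density lborel (indicator ?A))"
    using f mf layer_borel by (subst nn_integral_density) (auto simp: mult.commute)
  also have "\<dots> = (\<integral>\<^sup>+z. f z \<partial>M1)" unfolding M1_def using f mf by (subst nn_integral_distr) auto
  also have "\<dots> \<le> (\<integral>\<^sup>+z. f z \<partial>M2)"
    by (rule nn_integral_mono_measure[OF _ le]) (simp add: M1_def M2_def)
  also have "\<dots> = ?K * (\<integral>\<^sup>+z. f z \<partial>surf (frontier D))"
    unfolding M2_def using f id by (subst nn_integral_scale_measure, simp, subst nn_integral_distr) auto
  finally show ?thesis .
qed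

section \<open>Integration along the graph direction\<close>

lemma C1_line_derivative:
  assumes "C1 w gw"
  shows "((\<lambda>s. w (y + s *\<^sub>R e)) has_real_derivative gw (y + s *\<^sub>R e) \<bullet> e) (at s)"
proof -
  have 1: "(w has_derivative (\<lambda>h. gw (y + s *\<^sub>R e) \<bullet> h)) (at (y + s *\<^sub>R e))" using assms by (simp add: C1_def)
  have 2: "((\<lambda>t. y + t *\<^sub>R e) has_derivative (\<lambda>t. t *\<^sub>R e)) (at s)" by (auto intro!: derivative_eq_intros)
  have "(\<lambda>t. gw (y + s *\<^sub>R e) \<bullet> (t *\<^sub>R e)) = (*) (gw (y + s *\<^sub>R e) \<bullet> e)" by (auto simp: fun_eq_iff)
  then show ?thesis using has_derivative_compose[OF 2 1] by (simp only: has_field_derivative_def)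
qed

text \<open>The fundamental theorem of calculus on the segment from the foot to \<open>y\<close>,
  followed by Cauchy-Schwarz. The segment, whose length depends on \<open>y\<close>, is enlarged to
  \<open>{- T..0}\<close> with the strip as indicator, which prepares Fubini and translation in
  \<open>layer_integral\<close>.\<close>

lemma layer_pointwise:
  assumes T: "T < r / 2" and w: "C1c w gw" and y: "y \<in> layer T"
  shows "ennreal ((w y)\<^sup>2) \<le> 2 * ennreal ((w (foot y))\<^sup>2) +
    2 * ennreal T * (\<integral>\<^sup>+s. indicator {- T..0} s * (ennreal ((norm (gw (y + s *\<^sub>R e)))\<^sup>2) * indicator (strip D T) (y + s *\<^sub>R e)) \<partial>lborel)"
proof -
  have C1: "C1 w gw" using w by (simp add: C1c_iff)
  have h: "0 < height y" "height y < T" using y by (auto simp: layer_def)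
  let ?\<tau> = "height y"
  let ?I = "indicator {- ?\<tau>..0} :: real \<Rightarrow> real"
  define f where "f s = gw (y + s *\<^sub>R e) \<bullet> e" for s
  have cgw: "continuous_on UNIV (\<lambda>s. gw (y + s *\<^sub>R e))"
    by (intro continuous_on_compose2[OF C1_continuous(2)[OF C1]] continuous_intros) auto
  then have cf: "continuous_on UNIV f" unfolding f_def by (intro continuous_intros)
  have mf: "f \<in> borel_measurable lborel" using cf by (simp add: borel_measurable_continuous_onI)
  obtain B where B: "B > 0" "\<And>x. norm (gw x) \<le> B" using C1c_bounded[OF w] by blast
  have fle: "\<bar>f s\<bar> \<le> norm (gw (y + s *\<^sub>R e))" for s
    unfolding f_def using Cauchy_Schwarz_ineq2[of "gw (y + s *\<^sub>R e)" e] e by simp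
  have ftc: "(\<integral>s. f s * ?I s \<partial>lborel) = w (y + 0 *\<^sub>R e) - w (y + (- ?\<tau>) *\<^sub>R e)"
  proof (rule integral_FTC_Icc_real)
    show "DERIV (\<lambda>s. w (y + s *\<^sub>R e)) s :> f s" for s unfolding f_def by (rule C1_line_derivative[OF C1])
    show "isCont f s" for s using cf by (simp add: continuous_on_eq_continuous_at)
  qed (use h in simp)
  have I2: "(\<lambda>s. (norm (?I s))\<^sup>2) = ?I" by (auto simp: indicator_def)
  have sI: "sqint lborel ?I" unfolding sqint_def I2 using h by (auto simp: integrable_indicator_iff)
  have NI: "N2 lborel ?I = ?\<tau>" unfolding N2_def I2 using h by simp
  have sf: "sqint lborel (\<lambda>s. f s * ?I s)"
  proof (rule sqint_bound(1)[OF sI, of _ B])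
    have "\<bar>f s\<bar> \<le> B" for s using fle[of s] B(2)[of "y + s *\<^sub>R e"] by linarith
    then show "norm (f s * ?I s) \<le> B * norm (?I s)" for s by (auto simp: indicator_def)
  qed (use mf in measurable)
  have "(\<integral>s. f s * ?I s \<partial>lborel) = (\<integral>s. (f s * ?I s) \<bullet> ?I s \<partial>lborel)"
    by (rule Bochner_Integration.integral_cong) (auto simp: indicator_def)
  then have "\<bar>\<integral>s. f s * ?I s \<partial>lborel\<bar> \<le> sqrt (N2 lborel (\<lambda>s. f s * ?I s)) * sqrt ?\<tau>"
    using L2_Cauchy_Schwarz[OF sf sI] NI by simp
  then have "(\<integral>s. f s * ?I s \<partial>lborel)\<^sup>2 \<le> (sqrt (N2 lborel (\<lambda>s. f s * ?I s)) * sqrt ?\<tau>)\<^sup>2"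
    by (metis abs_ge_zero power2_abs power_mono)
  also have "\<dots> = N2 lborel (\<lambda>s. f s * ?I s) * ?\<tau>" using h N2_nonneg by (simp add: power_mult_distrib)
  finally have diff: "(w y - w (foot y))\<^sup>2 \<le> ?\<tau> * N2 lborel (\<lambda>s. f s * ?I s)"
    using ftc by (simp add: foot_def mult.commute)
  have N: "ennreal (N2 lborel (\<lambda>s. f s * ?I s)) \<le>
    (\<integral>\<^sup>+s. indicator {- T..0} s * (ennreal ((norm (gw (y + s *\<^sub>R e)))\<^sup>2) * indicator (strip D T) (y + s *\<^sub>R e)) \<partial>lborel)"
    unfolding sqint_nn_integral[OF sf, symmetric]
  \<comment> \<open>The lower end of the segment is the foot itself, which lies on the frontier and
    not in the strip; it is a single value of \<open>s\<close>.\<close>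
  proof (rule nn_integral_mono_AE, rule AE_mp[OF AE_lborel_singleton[of "- ?\<tau>"]], intro AE_I2 impI)
    fix s assume s: "s \<noteq> - ?\<tau>"
    show "ennreal ((norm (f s * ?I s))\<^sup>2) \<le> indicator {- T..0} s *
        (ennreal ((norm (gw (y + s *\<^sub>R e)))\<^sup>2) * indicator (strip D T) (y + s *\<^sub>R e))"
    proof (cases "s \<in> {- ?\<tau>..0}")
      case True
      then have "y + s *\<^sub>R e \<in> strip D T" using s by (intro layer_points(2)[OF T y]) auto
      moreover have "s \<in> {- T..0}" using True h by auto
      moreover have "(f s)\<^sup>2 \<le> (norm (gw (y + s *\<^sub>R e)))\<^sup>2" using power_mono[OF fle[of s], of 2] by simp
      ultimately show ?thesis using True by (simp add: ennreal_leI)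
    qed simp
  qed
  have "(w y)\<^sup>2 \<le> 2 * (w (foot y))\<^sup>2 + 2 * (w y - w (foot y))\<^sup>2"
    using zero_le_power2[of "w y - 2 * w (foot y)"] by (simp add: power2_eq_square algebra_simps)
  also have "\<dots> \<le> 2 * (w (foot y))\<^sup>2 + 2 * (T * N2 lborel (\<lambda>s. f s * ?I s))"
    using diff h mult_right_mono[OF less_imp_le[OF h(2)] N2_nonneg[of lborel "\<lambda>s. f s * ?I s"]] by simp
  finally have "ennreal ((w y)\<^sup>2) \<le> ennreal (2 * (w (foot y))\<^sup>2 + 2 * (T * N2 lborel (\<lambda>s. f s * ?I s)))"
    by (rule ennreal_leI)
  also have "\<dots> = 2 * ennreal ((w (foot y))\<^sup>2) + 2 * ennreal T * ennreal (N2 lborel (\<lambda>s. f s * ?I s))"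
    using h N2_nonneg[of lborel "\<lambda>s. f s * ?I s"] by (simp add: ennreal_mult mult.assoc)
  also have "\<dots> \<le> 2 * ennreal ((w (foot y))\<^sup>2) + 2 * ennreal T *
    (\<integral>\<^sup>+s. indicator {- T..0} s * (ennreal ((norm (gw (y + s *\<^sub>R e)))\<^sup>2) * indicator (strip D T) (y + s *\<^sub>R e)) \<partial>lborel)"
    by (intro add_left_mono mult_left_mono N) auto
  finally show ?thesis .
qed

text \<open>Integrating over \<open>s\<close> yields a second factor \<open>T\<close> in front of
  the gradient term. The resulting \<open>T\<^sup>2\<close> is what later compensates the squared
  gradient of a cutoff of width comparable to \<open>T\<close>.\<close>

lemma layer_integral:
  assumes dim: "2 \<le> DIM('a)" and T: "0 < T" "T < r / 2" and w: "C1c w gw"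
  shows "(\<integral>\<^sup>+y. ennreal ((w y)\<^sup>2) * indicator (layer T) y \<partial>lborel)
    \<le> ennreal (2 * cyl_const TYPE('a) * T) * (\<integral>\<^sup>+z. ennreal ((w z)\<^sup>2) \<partial>surf (frontier D))
      + ennreal (2 * T\<^sup>2) * (\<integral>\<^sup>+y. ennreal ((norm (gw y))\<^sup>2) * indicator (strip D T) y \<partial>lborel)"
proof -
  have C1: "C1 w gw" using w by (simp add: C1c_iff)
  have mw: "w \<in> borel_measurable borel" and mg: "gw \<in> borel_measurable borel"
    using C1_continuous[OF C1] by (auto intro: borel_measurable_continuous_onI)
  have mfoot: "foot \<in> borel_measurable borel" by (rule borel_measurable_continuous_onI[OF foot_continuous])
  have mS: "strip D T \<in> sets borel" using open_strip[OF D] by (simp add: borel_open)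
  let ?F = "\<lambda>y. ennreal ((norm (gw y))\<^sup>2) * indicator (strip D T) y"
  let ?G = "\<lambda>y. \<integral>\<^sup>+s. indicator {- T..0} s * ?F (y + s *\<^sub>R e) \<partial>lborel"
  have mF: "?F \<in> borel_measurable borel" using mg mS by measurable
  have mshift: "(\<lambda>(y, s). y + s *\<^sub>R e) \<in> borel_measurable (lborel \<Otimes>\<^sub>M lborel)"
    by measurable
  have mFG: "(\<lambda>(y, s). indicator {- T..0} s * ?F (y + s *\<^sub>R e)) \<in> borel_measurable (lborel \<Otimes>\<^sub>M lborel)"
  proof -
    have "(\<lambda>p. ?F (case p of (y, s) \<Rightarrow> y + s *\<^sub>R e)) \<in> borel_measurable (lborel \<Otimes>\<^sub>M lborel)"
      by (rule measurable_compose[OF mshift mF])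
    then have "(\<lambda>p. indicator {- T..0} (snd p) * ?F (case p of (y, s) \<Rightarrow> y + s *\<^sub>R e)) \<in> borel_measurable (lborel \<Otimes>\<^sub>M lborel)"
      by measurable
    then show ?thesis by (simp add: split_beta')
  qed
  have mG: "?G \<in> borel_measurable lborel"
    using lborel.borel_measurable_nn_integral_fst[OF mFG] by simp
  \<comment> \<open>After exchanging the integrals, translation invariance removes \<open>s\<close>
    from the inner one, so the outer integration only contributes the length
    \<open>T\<close>.\<close>
  have transl: "(\<integral>\<^sup>+y. ?F (y + v) \<partial>lborel) = (\<integral>\<^sup>+y. ?F y \<partial>lborel)" for v
  proof -
    have "(\<integral>\<^sup>+y. ?F y \<partial>lborel) = (\<integral>\<^sup>+y. ?F y \<partial>distr lborel borel ((+) v))" by (simp only: lborel_distr_plus)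
    also have "\<dots> = (\<integral>\<^sup>+y. ?F (v + y) \<partial>lborel)" using mF by (subst nn_integral_distr) auto
    finally show ?thesis by (simp add: add.commute)
  qed
  have Gint: "(\<integral>\<^sup>+y. ?G y \<partial>lborel) = ennreal T * (\<integral>\<^sup>+y. ?F y \<partial>lborel)"
  proof -
    have "(\<integral>\<^sup>+y. ?G y \<partial>lborel) = (\<integral>\<^sup>+s. (\<integral>\<^sup>+y. indicator {- T..0} s * ?F (y + s *\<^sub>R e) \<partial>lborel) \<partial>lborel)"
      using lborel_pair.Fubini'[OF mFG] by simp
    also have "\<dots> = (\<integral>\<^sup>+s. indicator {- T..0} s * (\<integral>\<^sup>+y. ?F y \<partial>lborel) \<partial>lborel)"
    proof (rule nn_integral_cong)
      fix s
      have "(\<lambda>y. ?F (y + s *\<^sub>R e)) \<in> borel_measurable lborel"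
        using measurable_compose[OF _ mF, of "\<lambda>y. y + s *\<^sub>R e" lborel] by simp
      then show "(\<integral>\<^sup>+y. indicator {- T..0} s * ?F (y + s *\<^sub>R e) \<partial>lborel) = indicator {- T..0} s * (\<integral>\<^sup>+y. ?F y \<partial>lborel)"
        by (simp add: nn_integral_cmult transl)
    qed
    also have "\<dots> = ennreal T * (\<integral>\<^sup>+y. ?F y \<partial>lborel)" using T by (simp add: nn_integral_multc)
    finally show ?thesis .
  qed
  have "(\<integral>\<^sup>+y. ennreal ((w y)\<^sup>2) * indicator (layer T) y \<partial>lborel)
    \<le> (\<integral>\<^sup>+y. 2 * (ennreal ((w (foot y))\<^sup>2) * indicator (layer T) y) + 2 * ennreal T * ?G y \<partial>lborel)"
  proof (rule nn_integral_mono)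
    fix y
    show "ennreal ((w y)\<^sup>2) * indicator (layer T) y \<le> 2 * (ennreal ((w (foot y))\<^sup>2) * indicator (layer T) y) + 2 * ennreal T * ?G y"
      using layer_pointwise[OF T(2) w, of y] by (cases "y \<in> layer T") auto
  qed
  also have "\<dots> = (\<integral>\<^sup>+y. 2 * (ennreal ((w (foot y))\<^sup>2) * indicator (layer T) y) \<partial>lborel) + (\<integral>\<^sup>+y. 2 * ennreal T * ?G y \<partial>lborel)"
  proof (rule nn_integral_add)
    have "(\<lambda>y. w (foot y)) \<in> borel_measurable borel" by (rule measurable_compose[OF mfoot mw])
    then show "(\<lambda>y. 2 * (ennreal ((w (foot y))\<^sup>2) * indicator (layer T) y)) \<in> borel_measurable lborel"
      using layer_borel by measurable
    show "(\<lambda>y. 2 * ennreal T * ?G y) \<in> borel_measurable lborel" using mG by measurable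
  qed
  also have "(\<integral>\<^sup>+y. 2 * ennreal T * ?G y \<partial>lborel) = 2 * ennreal T * (ennreal T * (\<integral>\<^sup>+y. ?F y \<partial>lborel))"
    using mG Gint by (subst nn_integral_cmult) auto
  also have "(\<integral>\<^sup>+y. 2 * (ennreal ((w (foot y))\<^sup>2) * indicator (layer T) y) \<partial>lborel)
      = 2 * (\<integral>\<^sup>+y. ennreal ((w (foot y))\<^sup>2) * indicator (layer T) y \<partial>lborel)"
  proof (rule nn_integral_cmult)
    have "(\<lambda>y. w (foot y)) \<in> borel_measurable borel" by (rule measurable_compose[OF mfoot mw])
    then show "(\<lambda>y. ennreal ((w (foot y))\<^sup>2) * indicator (layer T) y) \<in> borel_measurable lborel"
      using layer_borel by measurable
  qed
  also have "\<dots> \<le> 2 * (ennreal (cyl_const TYPE('a) * T) * (\<integral>\<^sup>+z. ennreal ((w z)\<^sup>2) \<partial>surf (frontier D)))"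
    by (intro mult_left_mono layer_foot_integral[OF dim T, of "\<lambda>z. ennreal ((w z)\<^sup>2)"]) (use mw in auto)
  finally show ?thesis
    using T cyl_const_pos[where 'a='a]
    by (simp add: mult.assoc[symmetric] power2_eq_square ennreal_mult add_right_mono)
qed

text \<open>A frontier point within \<delta> of \<open>y\<close> still lies in the chart and has
  height 0, so the Lipschitz bound puts the height of \<open>y\<close> below
  \<open>\<kappa> * \<delta>\<close>. The radius \<open>r / 4\<close> leaves room for that frontier
  point.\<close>

lemma strip_patch:
  assumes \<delta>: "0 < \<delta>" "\<delta> < r / (4 * \<kappa>)"
  shows "strip D \<delta> \<inter> ball x (r/4) \<subseteq> layer (\<kappa> * \<delta>)"
proof
  fix y assume y: "y \<in> strip D \<delta> \<inter> ball x (r/4)"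
  then have yD: "y \<in> D" "infdist y (frontier D) < \<delta>" "dist x y < r / 4" by (auto simp: strip_def)
  have \<delta>r: "\<kappa> * \<delta> < r / 4" using \<delta> \<kappa>_ge by (simp add: field_simps)
  have "\<delta> \<le> \<kappa> * \<delta>" using \<delta> \<kappa>_ge by simp
  then have \<delta>r': "\<delta> < r / 4" using \<delta>r by linarith
  have yb: "y \<in> ball x r" using yD r by simp
  have hy: "height y > 0" using D_iff[OF yb] yD by simp
  have "frontier D \<noteq> {}"
  proof
    assume "frontier D = {}"
    then have "D = {} \<or> D = UNIV" using frontier_not_empty by blast
    then show False using yD bdD not_bounded_UNIV by blast
  qed
  then have "frontier D \<noteq> {}" "Inf (dist y ` frontier D) < \<delta>" using yD(2) by (simp_all add: infdist_def)
  then obtain z where z: "z \<in> frontier D" "dist y z < \<delta>"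
    using cInf_lessD[of "dist y ` frontier D" \<delta>] by blast
  have "z \<in> ball x r" using dist_triangle[of x z y] z yD \<delta>r' r by simp
  then have "height z = 0" using z frontier_iff by blast
  then have "height y \<le> \<kappa> * dist y z" using height_lipschitz[of y z] by simp
  also have "\<dots> < \<kappa> * \<delta>" using z \<kappa>_ge by simp
  finally show "y \<in> layer (\<kappa> * \<delta>)" using hy yD r by (simp add: layer_def)
qed

end

section \<open>Vanishing traces\<close>

lemma lipschitz_domainD:
  assumes "lipschitz_domain D"
  shows "open D" "bounded D" "D \<noteq> {}" "frontier D \<noteq> {}" "compact (frontier D)" "frontier D \<inter> D = {}"
proof -
  show D: "open D" "bounded D" "D \<noteq> {}" using assms by (auto simp: lipschitz_domain_def)
  show "frontier D \<noteq> {}" using D not_bounded_UNIV frontier_not_empty by metis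
  show "compact (frontier D)" using D by (simp add: compact_frontier_bounded)
  show "frontier D \<inter> D = {}" using D by (auto simp: frontier_def interior_open)
qed

lemma lipschitz_chart_exists:
  assumes "lipschitz_domain D" "x \<in> frontier D"
  shows "\<exists>r e g C. lipschitz_chart D x r e g C"
proof -
  obtain r e g C where "r > 0" "norm e = 1" "C-lipschitz_on UNIV g"
    "ball x r \<inter> D = {y \<in> ball x r. y \<bullet> e > g (y - (y \<bullet> e) *\<^sub>R e)}"
    using assms unfolding lipschitz_domain_def by blast
  then show ?thesis using lipschitz_domainD[OF assms(1)] unfolding lipschitz_chart_def by blast
qed

lemma infdist_lessD: "infdist y S < \<delta> \<Longrightarrow> S \<noteq> {} \<Longrightarrow> \<exists>z\<in>S. dist y z < \<delta>"
  using cInf_lessD[of "dist y ` S" \<delta>] by (auto simp: infdist_def)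

text \<open>It makes squares of test functions integrable on the frontier, so that the Bochner
  integrals in \<open>trace_on\<close> with boundary value 0 are genuine and not the default 0 of a
  non-integrable function.\<close>

lemma surf_frontier_finite:
  fixes D :: "'a::euclidean_space set"
  assumes D: "lipschitz_domain D"
  shows "finite_measure (surf (frontier D))"
proof
  let ?H = "hausdorff_outer (real DIM('a) - 1) :: 'a set \<Rightarrow> ennreal"
  have "\<forall>x\<in>frontier D. \<exists>\<rho>>0. ?H (frontier D \<inter> ball x \<rho>) < top"
  proof
    fix x assume "x \<in> frontier D"
    then obtain r e g C where "lipschitz_chart D x r e g C" using lipschitz_chart_exists[OF D] by blast
    then interpret lipschitz_chart D x r e g C .
    show "\<exists>\<rho>>0. ?H (frontier D \<inter> ball x \<rho>) < top" using frontier_patch_finite r by (intro exI[of _ "r/2"]) simp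
  qed
  then obtain \<rho> where \<rho>: "\<And>x. x \<in> frontier D \<Longrightarrow> \<rho> x > 0 \<and> ?H (frontier D \<inter> ball x (\<rho> x)) < top" by metis
  then have "frontier D \<subseteq> (\<Union>x\<in>frontier D. ball x (\<rho> x))" by force
  then obtain F where F: "F \<subseteq> frontier D" "finite F" "frontier D \<subseteq> (\<Union>x\<in>F. ball x (\<rho> x))"
    using compactE_image[OF lipschitz_domainD(5)[OF D], of "frontier D" "\<lambda>x. ball x (\<rho> x)"] by blast
  have "?H (frontier D \<inter> (\<Union>x\<in>F. ball x (\<rho> x))) < top"
    using F(2,1)
  proof (induction F rule: finite_induct)
    case empty then show ?case by (simp add: hausdorff_outer_empty)
  next
    case (insert x F)
    have "frontier D \<inter> (\<Union>x\<in>insert x F. ball x (\<rho> x)) = (frontier D \<inter> ball x (\<rho> x)) \<union> (frontier D \<inter> (\<Union>x\<in>F. ball x (\<rho> x)))" by auto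
    then have "?H (frontier D \<inter> (\<Union>x\<in>insert x F. ball x (\<rho> x))) \<le> ?H (frontier D \<inter> ball x (\<rho> x)) + ?H (frontier D \<inter> (\<Union>x\<in>F. ball x (\<rho> x)))"
      using hausdorff_outer_subadd by metis
    also have "\<dots> < top" using insert \<rho>[of x] by auto
    finally show ?case .
  qed
  moreover have "frontier D \<inter> (\<Union>x\<in>F. ball x (\<rho> x)) = frontier D" using F by auto
  moreover have "emeasure (surf (frontier D)) (frontier D) = ?H (frontier D)"
    by (rule emeasure_surf) (auto simp: borel_closed)
  ultimately show "emeasure (surf (frontier D)) (space (surf (frontier D))) \<noteq> \<infinity>" by (simp add: space_surf)
qed

text \<open>The set \<open>S\<close> localises the inequality to a chart, so that finitely many
  charts can be combined. The factor \<open>L\<close> is present because the segments used for a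
  point of the \<delta>-strip may run through a wider strip.\<close>

definition strip_ineq :: "'a::euclidean_space set \<Rightarrow> 'a set \<Rightarrow> bool" where
  "strip_ineq D S \<longleftrightarrow> (\<exists>\<delta>0>0. \<exists>K\<ge>0. \<exists>L\<ge>1. \<forall>\<delta> w gw. 0 < \<delta> \<longrightarrow> \<delta> < \<delta>0 \<longrightarrow> C1c w gw \<longrightarrow>
     (\<integral>\<^sup>+y. ennreal ((w y)\<^sup>2) * indicator (strip D \<delta> \<inter> S) y \<partial>lborel)
       \<le> ennreal (K * \<delta>) * (\<integral>\<^sup>+z. ennreal ((w z)\<^sup>2) \<partial>surf (frontier D))
        + ennreal (K * \<delta>\<^sup>2) * (\<integral>\<^sup>+y. ennreal ((norm (gw y))\<^sup>2) * indicator (strip D (L * \<delta>)) y \<partial>lborel))"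

lemma (in lipschitz_chart) strip_ineq_patch:
  assumes dim: "2 \<le> DIM('a)"
  shows "strip_ineq D (ball x (r/4))"
  unfolding strip_ineq_def
proof (intro exI conjI allI impI)
  let ?c = "cyl_const TYPE('a)"
  let ?K = "2 * ?c * \<kappa> + 2 * \<kappa>\<^sup>2"
  have c: "?c > 0" by (rule cyl_const_pos)
  show "r / (4 * \<kappa>) > 0" using r \<kappa>_ge by simp
  show "?K \<ge> 0" using c \<kappa>_ge by simp
  show "\<kappa> \<ge> 1" by (rule \<kappa>_ge)
  fix \<delta> and w :: "'a \<Rightarrow> real" and gw assume \<delta>: "0 < \<delta>" "\<delta> < r / (4 * \<kappa>)" and w: "C1c w gw"
  have T: "0 < \<kappa> * \<delta>" "\<kappa> * \<delta> < r / 2" using \<delta> \<kappa>_ge r by (auto simp: field_simps)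
  have "(\<integral>\<^sup>+y. ennreal ((w y)\<^sup>2) * indicator (strip D \<delta> \<inter> ball x (r/4)) y \<partial>lborel)
      \<le> (\<integral>\<^sup>+y. ennreal ((w y)\<^sup>2) * indicator (layer (\<kappa> * \<delta>)) y \<partial>lborel)"
    using strip_patch[OF \<delta>] by (intro nn_integral_mono mult_left_mono) (auto simp: indicator_def)
  also have "\<dots> \<le> ennreal (2 * ?c * (\<kappa> * \<delta>)) * (\<integral>\<^sup>+z. ennreal ((w z)\<^sup>2) \<partial>surf (frontier D))
      + ennreal (2 * (\<kappa> * \<delta>)\<^sup>2) * (\<integral>\<^sup>+y. ennreal ((norm (gw y))\<^sup>2) * indicator (strip D (\<kappa> * \<delta>)) y \<partial>lborel)"
    by (rule layer_integral[OF dim T w])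
  also have "\<dots> \<le> ennreal (?K * \<delta>) * (\<integral>\<^sup>+z. ennreal ((w z)\<^sup>2) \<partial>surf (frontier D))
      + ennreal (?K * \<delta>\<^sup>2) * (\<integral>\<^sup>+y. ennreal ((norm (gw y))\<^sup>2) * indicator (strip D (\<kappa> * \<delta>)) y \<partial>lborel)"
    using c \<kappa>_ge \<delta> by (intro add_mono mult_right_mono ennreal_leI) (auto simp: power_mult_distrib algebra_simps)
  finally show "(\<integral>\<^sup>+y. ennreal ((w y)\<^sup>2) * indicator (strip D \<delta> \<inter> ball x (r/4)) y \<partial>lborel)
      \<le> ennreal (?K * \<delta>) * (\<integral>\<^sup>+z. ennreal ((w z)\<^sup>2) \<partial>surf (frontier D))
      + ennreal (?K * \<delta>\<^sup>2) * (\<integral>\<^sup>+y. ennreal ((norm (gw y))\<^sup>2) * indicator (strip D (\<kappa> * \<delta>)) y \<partial>lborel)" .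
qed

lemma strip_ineq_Un:
  assumes D: "open D" and S: "strip_ineq D S" "strip_ineq D S'" and o: "open S" "open S'"
  shows "strip_ineq D (S \<union> S')"
proof -
  obtain \<delta>1 K1 L1 where 1: "\<delta>1 > 0" "K1 \<ge> 0" "L1 \<ge> 1" "\<And>\<delta> w gw. 0 < \<delta> \<Longrightarrow> \<delta> < \<delta>1 \<Longrightarrow> C1c w gw \<Longrightarrow>
     (\<integral>\<^sup>+y. ennreal ((w y)\<^sup>2) * indicator (strip D \<delta> \<inter> S) y \<partial>lborel)
       \<le> ennreal (K1 * \<delta>) * (\<integral>\<^sup>+z. ennreal ((w z)\<^sup>2) \<partial>surf (frontier D))
        + ennreal (K1 * \<delta>\<^sup>2) * (\<integral>\<^sup>+y. ennreal ((norm (gw y))\<^sup>2) * indicator (strip D (L1 * \<delta>)) y \<partial>lborel)"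
    using S(1) unfolding strip_ineq_def by blast
  obtain \<delta>2 K2 L2 where 2: "\<delta>2 > 0" "K2 \<ge> 0" "L2 \<ge> 1" "\<And>\<delta> w gw. 0 < \<delta> \<Longrightarrow> \<delta> < \<delta>2 \<Longrightarrow> C1c w gw \<Longrightarrow>
     (\<integral>\<^sup>+y. ennreal ((w y)\<^sup>2) * indicator (strip D \<delta> \<inter> S') y \<partial>lborel)
       \<le> ennreal (K2 * \<delta>) * (\<integral>\<^sup>+z. ennreal ((w z)\<^sup>2) \<partial>surf (frontier D))
        + ennreal (K2 * \<delta>\<^sup>2) * (\<integral>\<^sup>+y. ennreal ((norm (gw y))\<^sup>2) * indicator (strip D (L2 * \<delta>)) y \<partial>lborel)"
    using S(2) unfolding strip_ineq_def by blast
  show ?thesis unfolding strip_ineq_def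
  proof (intro exI conjI allI impI)
    show "min \<delta>1 \<delta>2 > 0" "K1 + K2 \<ge> 0" "max L1 L2 \<ge> 1" using 1 2 by auto
    fix \<delta> w gw assume \<delta>: "0 < \<delta>" "\<delta> < min \<delta>1 \<delta>2" and w: "C1c w (gw :: 'a \<Rightarrow> 'a)"
    let ?I = "\<integral>\<^sup>+z. ennreal ((w z)\<^sup>2) \<partial>surf (frontier D)"
    let ?G = "\<lambda>L. \<integral>\<^sup>+y. ennreal ((norm (gw y))\<^sup>2) * indicator (strip D (L * \<delta>)) y \<partial>lborel"
    have mw: "w \<in> borel_measurable borel"
      using C1_continuous(1)[of w gw] w by (auto simp: C1c_iff intro: borel_measurable_continuous_onI)
    have mS: "strip D \<delta> \<inter> S \<in> sets borel" "strip D \<delta> \<inter> S' \<in> sets borel"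
      using open_strip[OF D] o by (auto intro: borel_open)
    have G: "?G L \<le> ?G (max L1 L2)" if "L \<le> max L1 L2" for L
    proof (intro nn_integral_mono mult_left_mono)
      fix y
      have "strip D (L * \<delta>) \<subseteq> strip D (max L1 L2 * \<delta>)"
        using that \<delta> by (intro strip_mono mult_right_mono) auto
      then show "(indicator (strip D (L * \<delta>)) y :: ennreal) \<le> indicator (strip D (max L1 L2 * \<delta>)) y"
        by (auto simp: indicator_def)
    qed simp
    have "(\<integral>\<^sup>+y. ennreal ((w y)\<^sup>2) * indicator (strip D \<delta> \<inter> (S \<union> S')) y \<partial>lborel)
      \<le> (\<integral>\<^sup>+y. ennreal ((w y)\<^sup>2) * indicator (strip D \<delta> \<inter> S) y + ennreal ((w y)\<^sup>2) * indicator (strip D \<delta> \<inter> S') y \<partial>lborel)"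
      by (intro nn_integral_mono) (auto simp: indicator_def)
    also have "\<dots> = (\<integral>\<^sup>+y. ennreal ((w y)\<^sup>2) * indicator (strip D \<delta> \<inter> S) y \<partial>lborel) + (\<integral>\<^sup>+y. ennreal ((w y)\<^sup>2) * indicator (strip D \<delta> \<inter> S') y \<partial>lborel)"
      using mw mS by (intro nn_integral_add) (auto intro!: borel_measurable_times_ennreal)
    also have "\<dots> \<le> (ennreal (K1 * \<delta>) * ?I + ennreal (K1 * \<delta>\<^sup>2) * ?G L1) + (ennreal (K2 * \<delta>) * ?I + ennreal (K2 * \<delta>\<^sup>2) * ?G L2)"
      using 1(4)[OF \<delta>(1) _ w] 2(4)[OF \<delta>(1) _ w] \<delta>(2) by (intro add_mono) auto
    also have "\<dots> \<le> (ennreal (K1 * \<delta>) * ?I + ennreal (K1 * \<delta>\<^sup>2) * ?G (max L1 L2)) + (ennreal (K2 * \<delta>) * ?I + ennreal (K2 * \<delta>\<^sup>2) * ?G (max L1 L2))"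
      by (intro add_mono mult_left_mono G order_refl) auto
    also have "\<dots> = ennreal ((K1 + K2) * \<delta>) * ?I + ennreal ((K1 + K2) * \<delta>\<^sup>2) * ?G (max L1 L2)"
      using 1 2 \<delta> by (simp add: distrib_right ennreal_plus algebra_simps)
    finally show "(\<integral>\<^sup>+y. ennreal ((w y)\<^sup>2) * indicator (strip D \<delta> \<inter> (S \<union> S')) y \<partial>lborel)
      \<le> ennreal ((K1 + K2) * \<delta>) * ?I + ennreal ((K1 + K2) * \<delta>\<^sup>2) * ?G (max L1 L2)" .
  qed
qed

text \<open>Finitely many chart balls cover the compact frontier and hence a uniform neighbourhood
  of it, which contains all sufficiently thin strips.\<close>

lemma strip_inequality:
  fixes D :: "'a::euclidean_space set"
  assumes dim: "2 \<le> DIM('a)" and D: "lipschitz_domain D"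
  shows "strip_ineq D UNIV"
proof -
  have "\<forall>x\<in>frontier D. \<exists>\<rho>>0. strip_ineq D (ball x \<rho>)"
  proof
    fix x assume "x \<in> frontier D"
    then obtain r e g C where "lipschitz_chart D x r e g C" using lipschitz_chart_exists[OF D] by blast
    then interpret lipschitz_chart D x r e g C .
    show "\<exists>\<rho>>0. strip_ineq D (ball x \<rho>)" using strip_ineq_patch[OF dim] r by (intro exI[of _ "r/4"]) simp
  qed
  then obtain \<rho> where \<rho>: "\<And>x. x \<in> frontier D \<Longrightarrow> \<rho> x > 0 \<and> strip_ineq D (ball x (\<rho> x))" by metis
  then have "frontier D \<subseteq> (\<Union>x\<in>frontier D. ball x (\<rho> x))" by force
  then obtain F where F: "F \<subseteq> frontier D" "finite F" "frontier D \<subseteq> (\<Union>x\<in>F. ball x (\<rho> x))"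
    using compactE_image[OF lipschitz_domainD(5)[OF D], of "frontier D" "\<lambda>x. ball x (\<rho> x)"] by blast
  let ?U = "\<Union>x\<in>F. ball x (\<rho> x)"
  have U: "strip_ineq D ?U"
    using F(2,1)
  proof (induction F rule: finite_induct)
    case empty
    show ?case unfolding strip_ineq_def by (intro exI[of _ "1::real"] conjI) simp_all
  next
    case (insert x F)
    then show ?case using strip_ineq_Un[OF lipschitz_domainD(1)[OF D], of "ball x (\<rho> x)" "\<Union>x\<in>F. ball x (\<rho> x)"] \<rho>[of x] by auto
  qed
  obtain \<epsilon> where \<epsilon>: "\<epsilon> > 0" "(\<Union>x\<in>frontier D. ball x \<epsilon>) \<subseteq> ?U"
    using compact_subset_open_imp_ball_epsilon_subset[OF lipschitz_domainD(5)[OF D] _ F(3)] by blast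
  have sub: "strip D \<delta> \<inter> ?U = strip D \<delta>" if "\<delta> < \<epsilon>" for \<delta>
  proof -
    have "y \<in> ?U" if "y \<in> strip D \<delta>" for y
    proof -
      have "infdist y (frontier D) < \<epsilon>" using that \<open>\<delta> < \<epsilon>\<close> by (simp add: strip_def)
      then obtain z where "z \<in> frontier D" "dist y z < \<epsilon>" using infdist_lessD lipschitz_domainD(4)[OF D] by blast
      then have "y \<in> (\<Union>x\<in>frontier D. ball x \<epsilon>)" by (auto simp: dist_commute)
      then show ?thesis using \<epsilon>(2) by blast
    qed
    then show ?thesis by blast
  qed
  obtain \<delta>0 K L where *: "\<delta>0 > 0" "K \<ge> 0" "L \<ge> 1" "\<And>\<delta> w gw. 0 < \<delta> \<Longrightarrow> \<delta> < \<delta>0 \<Longrightarrow> C1c w gw \<Longrightarrow>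
     (\<integral>\<^sup>+y. ennreal ((w y)\<^sup>2) * indicator (strip D \<delta> \<inter> ?U) y \<partial>lborel)
       \<le> ennreal (K * \<delta>) * (\<integral>\<^sup>+z. ennreal ((w z)\<^sup>2) \<partial>surf (frontier D))
        + ennreal (K * \<delta>\<^sup>2) * (\<integral>\<^sup>+y. ennreal ((norm (gw y))\<^sup>2) * indicator (strip D (L * \<delta>)) y \<partial>lborel)"
    using U unfolding strip_ineq_def by blast
  show ?thesis unfolding strip_ineq_def
  proof (intro exI conjI allI impI)
    show "min \<delta>0 \<epsilon> > 0" "K \<ge> 0" "L \<ge> 1" using * \<epsilon> by auto
    fix \<delta> w gw assume a: "0 < \<delta>" "\<delta> < min \<delta>0 \<epsilon>" and w: "C1c w (gw :: 'a \<Rightarrow> 'a)"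
    have eq: "strip D \<delta> \<inter> ?U = strip D \<delta>" by (rule sub) (use a in simp)
    have l: "\<delta> < \<delta>0" using a by simp
    show "(\<integral>\<^sup>+y. ennreal ((w y)\<^sup>2) * indicator (strip D \<delta> \<inter> UNIV) y \<partial>lborel)
       \<le> ennreal (K * \<delta>) * (\<integral>\<^sup>+z. ennreal ((w z)\<^sup>2) \<partial>surf (frontier D))
        + ennreal (K * \<delta>\<^sup>2) * (\<integral>\<^sup>+y. ennreal ((norm (gw y))\<^sup>2) * indicator (strip D (L * \<delta>)) y \<partial>lborel)"
      using *(4)[OF a(1) l w] unfolding eq by simp
  qed
qed

section \<open>Restriction to subsets, and cutoffs near the boundary\<close>

lemma sqint_subset:
  assumes f: "sqint (lebesgue_on W) f" and S: "S \<subseteq> W" "S \<in> sets lebesgue" and W: "W \<in> sets lebesgue"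
  shows "sqint (lebesgue_on S) f"
proof -
  have m: "f \<in> borel_measurable (lebesgue_on S)"
    using measurable_restrict_mono[OF sqint_measurable[OF f] S(1)] .
  have "integrable lebesgue (\<lambda>x. indicator W x *\<^sub>R (norm (f x))\<^sup>2)"
    using sqint_integrable[OF f] W by (simp add: integrable_restrict_space)
  note i = integrable_mult_indicator[OF S(2) this]
  have "(\<lambda>x. indicator S x *\<^sub>R indicator W x *\<^sub>R (norm (f x))\<^sup>2) = (\<lambda>x. indicator S x *\<^sub>R (norm (f x))\<^sup>2)"
    using S(1) by (auto simp: indicator_def fun_eq_iff)
  then have "integrable lebesgue (\<lambda>x. indicator S x *\<^sub>R (norm (f x))\<^sup>2)" using i by (simp only:)
  then show ?thesis using m S(2) by (simp add: sqint_def integrable_restrict_space)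
qed

lemma N2_subset:
  assumes f: "sqint (lebesgue_on W) f" and S: "S \<subseteq> W" "S \<in> sets lebesgue" and W: "W \<in> sets lebesgue"
  shows "N2 (lebesgue_on S) f \<le> N2 (lebesgue_on W) f"
  using N2_transfer[OF sqint_subset[OF f S W] f S(2) W, of 1] S(1) by auto

lemma L2lim_subset:
  assumes q: "L2lim (lebesgue_on W) q P" and S: "S \<subseteq> W" "S \<in> sets lebesgue" and W: "W \<in> sets lebesgue"
  shows "L2lim (lebesgue_on S) q P"
  by (rule L2limI_le[OF _ _ _ L2limD(3)[OF q]])
    (use L2limD(1,2)[OF q] in \<open>auto intro!: sqint_subset[OF _ S W] N2_subset[OF _ S W] sqint_diff\<close>)

lemma L2lim_fst_snd:
  fixes q :: "nat \<Rightarrow> 'x \<Rightarrow> real \<times> 'b::euclidean_space"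
  assumes q: "L2lim M q P"
  shows "L2lim M (\<lambda>n x. fst (q n x)) (\<lambda>x. fst (P x))" "L2lim M (\<lambda>n x. snd (q n x)) (\<lambda>x. snd (P x))"
proof -
  note s = sqint_fst_snd[OF L2limD(1)[OF q]] sqint_fst_snd[OF L2limD(2)[OF q]]
  have n: "norm (fst v - fst w) \<le> norm (v - w)" "norm (snd v - snd w) \<le> norm (v - w)" for v w :: "real \<times> 'b"
    using norm_fst_snd_le[of "v - w"] by auto
  show "L2lim M (\<lambda>n x. fst (q n x)) (\<lambda>x. fst (P x))"
    by (rule L2lim_bound[OF q, of _ _ 1]) (simp_all only: mult_1 n norm_fst_snd_le s sqint_measurable)
  show "L2lim M (\<lambda>n x. snd (q n x)) (\<lambda>x. snd (P x))"
    by (rule L2lim_bound[OF q, of _ _ 1]) (simp_all only: mult_1 n norm_fst_snd_le s sqint_measurable)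
qed

lemma nn_integral_indicator_N2:
  fixes f :: "'a::euclidean_space \<Rightarrow> 'b::euclidean_space"
  assumes f: "f \<in> borel_measurable borel" and S: "S \<in> sets borel" and s: "sqint (lebesgue_on S) f"
  shows "(\<integral>\<^sup>+y. ennreal ((norm (f y))\<^sup>2) * indicator S y \<partial>lborel) = ennreal (N2 (lebesgue_on S) f)"
proof -
  have "ennreal (N2 (lebesgue_on S) f) = (\<integral>\<^sup>+y. ennreal ((norm (f y))\<^sup>2) * indicator S y \<partial>lebesgue)"
    using S unfolding sqint_nn_integral[OF s, symmetric] by (simp add: nn_integral_restrict_space)
  also have "\<dots> = (\<integral>\<^sup>+y. ennreal ((norm (f y))\<^sup>2) * indicator S y \<partial>lborel)"
    by (rule nn_integral_completion) (use f S in measurable)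
  finally show ?thesis by simp
qed

lemma H1_cl_closed:
  assumes P: "sqint (lebesgue_on W) P"
    and ex: "\<And>e. e > 0 \<Longrightarrow> \<exists>R. H1_cl W S R \<and> N2 (lebesgue_on W) (\<lambda>x. R x - P x) < e"
  shows "H1_cl W S P"
  unfolding H1_cl_def
proof (rule L2_diagonal[OF P])
  fix e :: real assume e: "e > 0"
  obtain R where R: "H1_cl W S R" "N2 (lebesgue_on W) (\<lambda>x. R x - P x) < e / 4" using ex[of "e / 4"] e by auto
  obtain q where q: "\<And>n. q n \<in> tests S" "L2lim (lebesgue_on W) q R" using R(1) unfolding H1_cl_def by blast
  have "\<forall>\<^sub>F n in sequentially. N2 (lebesgue_on W) (\<lambda>x. q n x - R x) < e / 4"
    using order_tendstoD(2)[OF L2limD(3)[OF q(2)], of "e / 4"] e by simp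
  then obtain n where n: "N2 (lebesgue_on W) (\<lambda>x. q n x - R x) < e / 4" by (auto simp: eventually_sequentially)
  have "N2 (lebesgue_on W) (\<lambda>x. (q n x - R x) + (R x - P x)) \<le>
      2 * N2 (lebesgue_on W) (\<lambda>x. q n x - R x) + 2 * N2 (lebesgue_on W) (\<lambda>x. R x - P x)"
    by (rule sqint_add(2)) (use L2limD(1,2)[OF q(2)] P in \<open>auto intro: sqint_diff\<close>)
  then have "N2 (lebesgue_on W) (\<lambda>x. q n x - P x) < e" using R(2) n by simp
  then show "\<exists>f. f \<in> tests S \<and> sqint (lebesgue_on W) f \<and> N2 (lebesgue_on W) (\<lambda>x. f x - P x) < e"
    using q(1) L2limD(1)[OF q(2)] by blast
qed

text \<open>Bumps of radius \<delta> on a net of the frontier with spacing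
  \<open>\<delta> / 2\<close>: their plateaus of radius \<open>\<delta> / 2\<close> cover the
  frontier, and \<open>separated_overlap\<close> bounds the overlap. Points of \<open>D\<close>
  reached by a bump lie within \<delta> of the frontier, that is in the strip.\<close>

lemma frontier_cutoff:
  fixes D :: "'a::euclidean_space set"
  assumes D: "lipschitz_domain D" and \<delta>: "\<delta> > 0"
  shows "\<exists>\<zeta> h V. C1c \<zeta> h \<and> (\<forall>x. 0 \<le> \<zeta> x \<and> \<zeta> x \<le> 1) \<and> (\<forall>x. norm (h x) \<le> 16 * 5 ^ DIM('a) / \<delta>) \<and>
    open V \<and> frontier D \<subseteq> V \<and> (\<forall>x\<in>V. \<zeta> x = 1) \<and> (\<forall>x\<in>D. x \<notin> strip D \<delta> \<longrightarrow> \<zeta> x = 0 \<and> h x = 0)"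
proof -
  have b: "bounded (frontier D)" using lipschitz_domainD(5)[OF D] compact_imp_bounded by blast
  have \<delta>2: "\<delta> / 2 > 0" using \<delta> by simp
  obtain P where P: "P \<subseteq> frontier D" "finite P" "\<And>p q. p \<in> P \<Longrightarrow> q \<in> P \<Longrightarrow> p \<noteq> q \<Longrightarrow> \<delta> / 2 \<le> dist p q"
      "\<And>a. a \<in> frontier D \<Longrightarrow> \<exists>p\<in>P. dist a p < \<delta> / 2" using separated_net_exists[OF b \<delta>2] by blast
  have ov: "card {p \<in> P. norm (x - p) < \<delta>} \<le> 5 ^ DIM('a)" for x
    using separated_overlap[OF P(2) \<delta>2 P(3), of x] by simp
  obtain \<zeta> h where *: "C1c \<zeta> h" "\<forall>x. 0 \<le> \<zeta> x \<and> \<zeta> x \<le> 1" "\<forall>x. norm (h x) \<le> 16 * real (5 ^ DIM('a)) / \<delta>"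
    "\<forall>x\<in>(\<Union>p\<in>P. ball p (\<delta>/2)). \<zeta> x = 1" "\<forall>x. x \<notin> (\<Union>p\<in>P. ball p \<delta>) \<longrightarrow> \<zeta> x = 0 \<and> h x = 0"
    using cutoff_near_finite_set[OF P(2) \<delta> ov] by blast
  have "frontier D \<subseteq> (\<Union>p\<in>P. ball p (\<delta>/2))" using P(4) by (fastforce simp: dist_commute)
  moreover have "\<zeta> x = 0 \<and> h x = 0" if x: "x \<in> D" "x \<notin> strip D \<delta>" for x
  proof -
    have "x \<notin> ball p \<delta>" if "p \<in> P" for p
    proof
      assume "x \<in> ball p \<delta>"
      then have "dist x p < \<delta>" by (simp add: dist_commute)
      moreover have "infdist x (frontier D) \<le> dist x p" using infdist_le P(1) that by blast
      ultimately show False using x by (simp add: strip_def)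
    qed
    then show ?thesis using *(5) by blast
  qed
  ultimately show ?thesis using * by (intro exI[of _ \<zeta>] exI[of _ h] exI[of _ "\<Union>p\<in>P. ball p (\<delta>/2)"]) auto
qed

text \<open>Each point of \<open>D\<close> has positive distance from the frontier, so the strips
  shrink to the empty set and dominated convergence applies.\<close>

lemma strip_N2_tendsto_0:
  fixes D :: "'a::euclidean_space set"
  assumes D: "lipschitz_domain D" and W: "W \<subseteq> D" "W \<in> sets lebesgue" and f: "sqint (lebesgue_on W) f" and e: "e > 0"
  shows "\<exists>\<delta>>0. \<forall>\<delta>'. strip D \<delta>' \<subseteq> W \<longrightarrow> \<delta>' \<le> \<delta> \<longrightarrow> N2 (lebesgue_on (strip D \<delta>')) f < e"
proof -
  have oD: "open D" using lipschitz_domainD[OF D] by blast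
  have S: "strip D \<delta> \<in> sets lebesgue" for \<delta> using open_strip[OF oD, of \<delta>] by simp
  let ?i = "\<lambda>n. inverse (real (Suc n))"
  let ?g = "\<lambda>x. indicator W x *\<^sub>R (norm (f x))\<^sup>2"
  have g: "integrable lebesgue ?g" using sqint_integrable[OF f] W by (simp add: integrable_restrict_space)
  have "(\<lambda>n. \<integral>x. indicator (strip D (?i n)) x *\<^sub>R ?g x \<partial>lebesgue) \<longlonglongrightarrow> (\<integral>x. 0 \<partial>(lebesgue :: 'a measure))"
  proof (rule integral_dominated_convergence[OF _ _ g])
    show "(\<lambda>x. indicator (strip D (?i n)) x *\<^sub>R ?g x) \<in> borel_measurable lebesgue" for n
      using integrable_mult_indicator[OF S g] by (rule borel_measurable_integrable)
    show "AE x in lebesgue. norm (indicator (strip D (?i n)) x *\<^sub>R ?g x) \<le> ?g x" for n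
      by (auto intro!: AE_I2 simp: indicator_def)
    show "AE x in lebesgue. (\<lambda>n. indicator (strip D (?i n)) x *\<^sub>R ?g x) \<longlonglongrightarrow> 0"
    proof (rule AE_I2)
      fix x
      show "(\<lambda>n. indicator (strip D (?i n)) x *\<^sub>R ?g x) \<longlonglongrightarrow> 0"
      proof (cases "x \<in> D")
        case True
        then have "x \<notin> frontier D" using lipschitz_domainD(6)[OF D] by blast
        then have "infdist x (frontier D) > 0"
          using infdist_pos_not_in_closed[OF frontier_closed lipschitz_domainD(4)[OF D]] by blast
        then have "\<forall>\<^sub>F n in sequentially. ?i n < infdist x (frontier D)"
          using order_tendstoD(2)[OF LIMSEQ_inverse_real_of_nat] by blast
        then have "\<forall>\<^sub>F n in sequentially. indicator (strip D (?i n)) x *\<^sub>R ?g x = 0"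
          by eventually_elim (simp add: strip_def)
        then show ?thesis by (rule tendsto_eventually)
      qed (simp add: strip_def)
    qed
  qed simp
  then have "(\<lambda>n. \<integral>x. indicator (strip D (?i n)) x *\<^sub>R ?g x \<partial>lebesgue) \<longlonglongrightarrow> 0" by simp
  then have "\<forall>\<^sub>F n in sequentially. (\<integral>x. indicator (strip D (?i n)) x *\<^sub>R ?g x \<partial>lebesgue) < e"
    using order_tendstoD(2) e by blast
  then obtain n where n: "(\<integral>x. indicator (strip D (?i n)) x *\<^sub>R ?g x \<partial>lebesgue) < e" by (auto simp: eventually_sequentially)
  have "N2 (lebesgue_on (strip D \<delta>')) f < e" if \<delta>': "strip D \<delta>' \<subseteq> W" "\<delta>' \<le> ?i n" for \<delta>'
  proof -
    have "N2 (lebesgue_on (strip D \<delta>')) f = (\<integral>x. indicator (strip D \<delta>') x *\<^sub>R (norm (f x))\<^sup>2 \<partial>lebesgue)"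
      unfolding N2_def by (rule integral_restrict_space) (use S in simp)
    also have "\<dots> = (\<integral>x. indicator (strip D \<delta>') x *\<^sub>R ?g x \<partial>lebesgue)"
      by (rule Bochner_Integration.integral_cong) (use \<delta>' in \<open>auto simp: indicator_def\<close>)
    also have "\<dots> \<le> (\<integral>x. indicator (strip D (?i n)) x *\<^sub>R ?g x \<partial>lebesgue)"
      by (rule integral_mono[OF integrable_mult_indicator[OF S g] integrable_mult_indicator[OF S g]])
        (use strip_mono[OF \<delta>'(2), of D] in \<open>auto simp: indicator_def\<close>)
    finally show ?thesis using n by simp
  qed
  then show ?thesis by (intro exI[of _ "?i n"]) auto
qed

text \<open>A Hardy type argument: the inequality on boundary strips bounds \<open>|u| / \<delta>\<close> on the \<open>\<delta>\<close>-strip by the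
  gradient, so that multiplying by a cutoff of width \<open>\<delta>\<close> changes \<open>u\<close> little in \<open>H1\<close>.\<close>
theorem H1_cl_of_trace_zero:
  fixes D K :: "'a::euclidean_space set"
  assumes dim: "2 \<le> DIM('a)" and D: "lipschitz_domain D" and K: "compact K" "K \<subseteq> D"
    and P: "H1_jet (D - K) P" and tr: "trace_on (D - K) (frontier D) (\<lambda>x. fst (P x)) (\<lambda>_. 0)"
  shows "H1_cl (D - K) (frontier D) P"
proof -
  let ?W = "D - K"
  note Dd = lipschitz_domainD[OF D]
  have W: "open ?W" "bounded ?W" using Dd K by (auto intro: open_Diff compact_imp_closed bounded_subset)
  have Wl: "?W \<in> lmeasurable" using W by (simp add: lmeasurable_open)
  have Ws: "?W \<in> sets lebesgue" using Wl by (simp add: fmeasurableD)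
  obtain w gw where w: "\<And>n. C1c (w n) (gw n)" "L2lim (lebesgue_on ?W) (\<lambda>n. jet (w n) (gw n)) P"
    "(\<lambda>n. integral\<^sup>L (surf (frontier D)) (\<lambda>x. (w n x - 0)\<^sup>2)) \<longlonglongrightarrow> 0"
    using trace_onD[OF W tr P] by blast
  have sP: "sqint (lebesgue_on ?W) P" using P by (simp add: H1_jet_def)
  note sP' = sqint_fst_snd[OF sP]
  interpret S: finite_measure "surf (frontier D)" by (rule surf_frontier_finite[OF D])
  have fD: "frontier D \<in> sets borel" by (simp add: borel_closed)
  have id: "(\<lambda>x. x) \<in> measurable (surf (frontier D)) borel"
    by (rule measurableI) (auto simp: sets_surf[OF fD] space_surf)
  have nn_surf: "(\<integral>\<^sup>+z. ennreal ((w n z)\<^sup>2) \<partial>surf (frontier D)) = ennreal (\<integral>z. (w n z)\<^sup>2 \<partial>surf (frontier D))" for n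
  proof (rule nn_integral_eq_integral)
    obtain B where B: "B > 0" "\<And>x. \<bar>w n x\<bar> \<le> B" using C1c_bounded[OF w(1)] by blast
    have "w n \<in> borel_measurable borel"
      using C1_continuous(1) w(1)[of n] by (auto simp: C1c_iff intro: borel_measurable_continuous_onI)
    then have m: "w n \<in> borel_measurable (surf (frontier D))" using measurable_compose[OF id] by blast
    show "integrable (surf (frontier D)) (\<lambda>z. (w n z)\<^sup>2)"
      by (rule S.integrable_const_bound[of _ "B\<^sup>2"]) (use m B in \<open>auto simp: abs_le_square_iff[symmetric]\<close>)
  qed simp
  obtain \<delta>0 C L where st: "\<delta>0 > 0" "C \<ge> 0" "L \<ge> 1" "\<And>\<delta> w gw. 0 < \<delta> \<Longrightarrow> \<delta> < \<delta>0 \<Longrightarrow> C1c w gw \<Longrightarrow>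
     (\<integral>\<^sup>+y. ennreal ((w y)\<^sup>2) * indicator (strip D \<delta>) y \<partial>lborel)
       \<le> ennreal (C * \<delta>) * (\<integral>\<^sup>+z. ennreal ((w z)\<^sup>2) \<partial>surf (frontier D))
        + ennreal (C * \<delta>\<^sup>2) * (\<integral>\<^sup>+y. ennreal ((norm (gw y))\<^sup>2) * indicator (strip D (L * \<delta>)) y \<partial>lborel)"
    using strip_inequality[OF dim D] unfolding strip_ineq_def by auto
  \<comment> \<open>The distance from the hole to the outer boundary: strips of width at most
    \<open>d\<close> avoid \<open>K\<close>.\<close>
  obtain d where d: "d > 0" "\<And>x y. x \<in> K \<Longrightarrow> y \<in> frontier D \<Longrightarrow> d \<le> dist x y"
    using separate_compact_closed[OF K(1) frontier_closed, of D] K(2) Dd(6) by blast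
  have stW: "strip D \<delta> \<subseteq> ?W" if "\<delta> \<le> d" for \<delta>
  proof
    fix y assume y: "y \<in> strip D \<delta>"
    then have "infdist y (frontier D) < d" using that by (simp add: strip_def)
    then obtain z where "z \<in> frontier D" "dist y z < d" using infdist_lessD Dd(4) by blast
    then have "y \<notin> K" using d(2)[of y z] by auto
    then show "y \<in> ?W" using y by (simp add: strip_def)
  qed
  have Ss: "strip D \<delta> \<in> sets borel" "strip D \<delta> \<in> sets lebesgue" for \<delta>
    using open_strip[OF Dd(1), of \<delta>] by (auto intro: borel_open)
  \<comment> \<open>The strip inequality is applied to the approximating C1 functions; in the limit
    the boundary term disappears because the trace is zero.\<close>
  have hardy: "N2 (lebesgue_on (strip D \<delta>)) (\<lambda>x. fst (P x)) \<le> C * \<delta>\<^sup>2 * N2 (lebesgue_on (strip D (L * \<delta>))) (\<lambda>x. snd (P x))"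
    if \<delta>: "0 < \<delta>" "\<delta> < \<delta>0" "L * \<delta> \<le> d" for \<delta>
  proof -
    have "\<delta> \<le> L * \<delta>" using \<delta> st(3) by simp
    then have sub: "strip D \<delta> \<subseteq> ?W" "strip D (L * \<delta>) \<subseteq> ?W" using \<delta>(3) by (auto intro!: stW)
    have l1: "L2lim (lebesgue_on (strip D \<delta>)) (\<lambda>n x. w n x) (\<lambda>x. fst (P x))"
      using L2lim_fst_snd(1)[OF L2lim_subset[OF w(2) sub(1) Ss(2) Ws]] by (simp add: jet_def)
    have l2: "L2lim (lebesgue_on (strip D (L * \<delta>))) (\<lambda>n x. gw n x) (\<lambda>x. snd (P x))"
      using L2lim_fst_snd(2)[OF L2lim_subset[OF w(2) sub(2) Ss(2) Ws]] by (simp add: jet_def)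
    have "N2 (lebesgue_on (strip D \<delta>)) (w n) \<le> C * \<delta> * (\<integral>z. (w n z - 0)\<^sup>2 \<partial>surf (frontier D))
        + C * \<delta>\<^sup>2 * N2 (lebesgue_on (strip D (L * \<delta>))) (gw n)" for n
    proof -
      have C1: "C1 (w n) (gw n)" using w(1) by (simp add: C1c_iff)
      have m: "w n \<in> borel_measurable borel" "gw n \<in> borel_measurable borel"
        using C1_continuous[OF C1] by (auto intro: borel_measurable_continuous_onI)
      have s: "sqint (lebesgue_on (strip D \<delta>)) (w n)" "sqint (lebesgue_on (strip D (L * \<delta>))) (gw n)"
        using L2limD(1)[OF l1] L2limD(1)[OF l2] by auto
      have "ennreal (N2 (lebesgue_on (strip D \<delta>)) (w n)) \<le> ennreal (C * \<delta>) * ennreal (\<integral>z. (w n z)\<^sup>2 \<partial>surf (frontier D))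
        + ennreal (C * \<delta>\<^sup>2) * ennreal (N2 (lebesgue_on (strip D (L * \<delta>))) (gw n))"
        using st(4)[OF \<delta>(1,2) w(1)[of n]] nn_integral_indicator_N2[OF m(1) Ss(1) s(1)]
          nn_integral_indicator_N2[OF m(2) Ss(1) s(2)] nn_surf[of n] by simp
      also have "\<dots> = ennreal (C * \<delta> * (\<integral>z. (w n z)\<^sup>2 \<partial>surf (frontier D))
        + C * \<delta>\<^sup>2 * N2 (lebesgue_on (strip D (L * \<delta>))) (gw n))"
        using st(2) \<delta>(1) by (simp add: ennreal_mult' N2_nonneg)
      finally have "ennreal (N2 (lebesgue_on (strip D \<delta>)) (w n)) \<le> ennreal (C * \<delta> * (\<integral>z. (w n z)\<^sup>2 \<partial>surf (frontier D))
        + C * \<delta>\<^sup>2 * N2 (lebesgue_on (strip D (L * \<delta>))) (gw n))" .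
      moreover have "0 \<le> C * \<delta> * (\<integral>z. (w n z)\<^sup>2 \<partial>surf (frontier D)) + C * \<delta>\<^sup>2 * N2 (lebesgue_on (strip D (L * \<delta>))) (gw n)"
        using st(2) \<delta>(1) N2_nonneg by (intro add_nonneg_nonneg mult_nonneg_nonneg) auto
      ultimately show ?thesis by (simp only: ennreal_le_iff diff_zero)
    qed
    then have le: "\<And>n. N2 (lebesgue_on (strip D \<delta>)) (w n) \<le> C * \<delta> * (\<integral>z. (w n z - 0)\<^sup>2 \<partial>surf (frontier D))
        + C * \<delta>\<^sup>2 * N2 (lebesgue_on (strip D (L * \<delta>))) (gw n)" .
    have "(\<lambda>n. C * \<delta> * (\<integral>z. (w n z - 0)\<^sup>2 \<partial>surf (frontier D)) + C * \<delta>\<^sup>2 * N2 (lebesgue_on (strip D (L * \<delta>))) (gw n))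
      \<longlonglongrightarrow> C * \<delta> * 0 + C * \<delta>\<^sup>2 * N2 (lebesgue_on (strip D (L * \<delta>))) (\<lambda>x. snd (P x))"
      by (intro tendsto_add tendsto_mult_left w(3) L2lim_N2[OF l2])
    from LIMSEQ_le[OF L2lim_N2[OF l1] this] le show ?thesis by simp
  qed
  let ?k = "16 * 5 ^ DIM('a) :: real"
  show ?thesis
  proof (rule H1_cl_closed[OF sP])
    fix \<epsilon> :: real assume \<epsilon>: "\<epsilon> > 0"
    let ?A = "4 + 2 * (?k\<^sup>2 * C)"
    have A: "?A > 0" using st(2) by (intro add_pos_nonneg mult_nonneg_nonneg) auto
    obtain \<delta>1 where \<delta>1: "\<delta>1 > 0" "\<And>\<delta>'. strip D \<delta>' \<subseteq> ?W \<Longrightarrow> \<delta>' \<le> \<delta>1 \<Longrightarrow> N2 (lebesgue_on (strip D \<delta>')) P < \<epsilon> / ?A"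
      using strip_N2_tendsto_0[OF D _ Ws sP, of "\<epsilon> / ?A"] \<epsilon> A by auto
    \<comment> \<open>The bound by \<open>\<delta>0\<close> admits the strip inequality, and the
      division by \<open>L\<close> keeps the wider strip \<open>L * \<delta>\<close> both off the
      hole and thin enough for \<open>\<delta>1\<close>.\<close>
    define \<delta> where "\<delta> = min (\<delta>0 / 2) (min d \<delta>1 / L)"
    have \<delta>: "0 < \<delta>" "\<delta> < \<delta>0" using st d \<delta>1 by (auto simp: \<delta>_def)
    have L\<delta>: "L * \<delta> \<le> d" "L * \<delta> \<le> \<delta>1"
    proof -
      have "\<delta> \<le> min d \<delta>1 / L" by (simp add: \<delta>_def)
      then have "L * \<delta> \<le> min d \<delta>1" using st(3) by (simp add: pos_le_divide_eq mult.commute)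
      then show "L * \<delta> \<le> d" "L * \<delta> \<le> \<delta>1" by auto
    qed
    have "\<delta> \<le> L * \<delta>" using \<delta> st(3) by simp
    then have sub: "strip D \<delta> \<subseteq> ?W" "strip D (L * \<delta>) \<subseteq> ?W" "strip D \<delta> \<subseteq> strip D (L * \<delta>)"
      using L\<delta> by (auto intro!: stW strip_mono)
    obtain \<zeta> h V where \<zeta>: "C1c \<zeta> h" "\<And>x. 0 \<le> \<zeta> x \<and> \<zeta> x \<le> 1" "\<And>x. norm (h x) \<le> ?k / \<delta>"
      "open V" "frontier D \<subseteq> V" "\<And>x. x \<in> V \<Longrightarrow> \<zeta> x = 1" "\<And>x. x \<in> D \<Longrightarrow> x \<notin> strip D \<delta> \<Longrightarrow> \<zeta> x = 0 \<and> h x = 0"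
      using frontier_cutoff[OF D \<delta>(1)] by blast
    have C\<zeta>: "C1 \<zeta> h" using \<zeta>(1) by (simp add: C1c_iff)
    define R where "R x = P x - jet_mul \<zeta> h P x" for x
    have zero: "(\<lambda>_. 0) \<in> tests (frontier D)" by (rule tests_zero)
    have "H1_cl ?W (frontier D) R"
      unfolding H1_cl_def
    proof (intro exI conjI allI)
      \<comment> \<open>Gluing with the zero jet: the approximants are multiplied by
        \<open>1 - \<zeta>\<close>, hence vanish near \<open>frontier D\<close>.\<close>
      let ?q = "\<lambda>n. glue \<zeta> h (\<lambda>_. 0) (jet (w n) (gw n))"
      show "?q n \<in> tests (frontier D)" for n
        by (rule glue_tests[OF \<zeta>(1,4,6) zero testsI[OF w(1), of _ "{}"]]) (use \<zeta>(5) in auto)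
      have z: "jet_mul \<zeta> h (\<lambda>_. 0) x = 0" for x by (simp add: jet_mul_def zero_prod_def)
      show "L2lim (lebesgue_on ?W) ?q R"
        using L2lim_diff[OF w(2) L2lim_jet_mul[OF \<zeta>(1) w(2)]] by (simp add: glue_def[abs_def] R_def[abs_def] z)
    qed
    moreover have "N2 (lebesgue_on ?W) (\<lambda>x. R x - P x) < \<epsilon>"
    proof -
      have sj: "sqint (lebesgue_on ?W) (jet_mul \<zeta> h P)" using L2limD(2)[OF L2lim_jet_mul[OF \<zeta>(1) w(2)]] .
      have sS: "sqint (lebesgue_on (strip D \<delta>)) P" "sqint (lebesgue_on (strip D \<delta>)) (jet_mul \<zeta> h P)"
        using sP sj by (auto intro: sqint_subset[OF _ sub(1) Ss(2) Ws])
      let ?u = "\<lambda>x. (?k / \<delta>) * fst (P x)"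
      have "N2 (lebesgue_on ?W) (\<lambda>x. R x - P x) = N2 (lebesgue_on ?W) (jet_mul \<zeta> h P)"
        by (simp add: R_def N2_def)
      also have "\<dots> \<le> 1\<^sup>2 * N2 (lebesgue_on (strip D \<delta>)) (jet_mul \<zeta> h P)"
      proof (rule N2_transfer[OF sj sS(2) Ws Ss(2)])
        show "jet_mul \<zeta> h P x = 0" if "x \<in> ?W" "x \<notin> strip D \<delta>" for x
          using \<zeta>(7)[of x] that by (simp add: jet_mul_def zero_prod_def)
      qed simp
      also have "\<dots> \<le> 4 * N2 (lebesgue_on (strip D \<delta>)) P + 2 * N2 (lebesgue_on (strip D \<delta>)) ?u"
      proof -
        have su: "sqint (lebesgue_on (strip D \<delta>)) ?u"
          using sqint_scaleR(1)[OF sqint_fst_snd(1)[OF sS(1)], of "?k / \<delta>"] by simp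
        have pt: "(norm (jet_mul \<zeta> h P x))\<^sup>2 \<le> 2 * (norm (P x))\<^sup>2 + 2 * (norm (?u x))\<^sup>2" for x
        proof -
          have e: "jet_mul \<zeta> h P x = \<zeta> x *\<^sub>R P x + (0, fst (P x) *\<^sub>R h x)"
            by (simp add: jet_mul_def prod_eq_iff)
          have "(norm (\<zeta> x *\<^sub>R P x))\<^sup>2 \<le> (norm (P x))\<^sup>2"
            using \<zeta>(2)[of x] by (intro power_mono) (auto intro: mult_left_le_one_le)
          moreover have "(norm ((0::real, fst (P x) *\<^sub>R h x)))\<^sup>2 \<le> (norm (?u x))\<^sup>2"
          proof (rule power_mono)
            have "norm ((0::real, fst (P x) *\<^sub>R h x)) = \<bar>fst (P x)\<bar> * norm (h x)" by (simp add: norm_Pair)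
            also have "\<dots> \<le> \<bar>fst (P x)\<bar> * (?k / \<delta>)" using \<zeta>(3) by (intro mult_left_mono) auto
            also have "\<dots> = norm (?u x)" using \<delta>(1) by (simp add: abs_mult)
            finally show "norm ((0::real, fst (P x) *\<^sub>R h x)) \<le> norm (?u x)" .
          qed simp
          ultimately show ?thesis unfolding e
            using norm_add_sq_le[of "\<zeta> x *\<^sub>R P x" "(0, fst (P x) *\<^sub>R h x)"] by linarith
        qed
        have "N2 (lebesgue_on (strip D \<delta>)) (jet_mul \<zeta> h P)
            \<le> (\<integral>x. 2 * (norm (P x))\<^sup>2 + 2 * (norm (?u x))\<^sup>2 \<partial>lebesgue_on (strip D \<delta>))"
          unfolding N2_def
          by (rule integral_mono[OF sqint_integrable[OF sS(2)] _ pt])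
            (intro Bochner_Integration.integrable_add integrable_mult_right sqint_integrable sS su)
        also have "\<dots> = 2 * N2 (lebesgue_on (strip D \<delta>)) P + 2 * N2 (lebesgue_on (strip D \<delta>)) ?u"
          using sqint_integrable[OF sS(1)] sqint_integrable[OF su] unfolding N2_def
          by (subst Bochner_Integration.integral_add) auto
        finally show ?thesis using N2_nonneg[of "lebesgue_on (strip D \<delta>)" P] by simp
      qed
      also have "N2 (lebesgue_on (strip D \<delta>)) ?u = (?k / \<delta>)\<^sup>2 * N2 (lebesgue_on (strip D \<delta>)) (\<lambda>x. fst (P x))"
        using sqint_scaleR(2)[OF sqint_fst_snd(1)[OF sS(1)], of "?k / \<delta>"] by simp
      also have "\<dots> \<le> (?k / \<delta>)\<^sup>2 * (C * \<delta>\<^sup>2 * N2 (lebesgue_on (strip D (L * \<delta>))) (\<lambda>x. snd (P x)))"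
        by (rule mult_left_mono[OF hardy[OF \<delta> L\<delta>(1)]]) simp
      also have "\<dots> = ?k\<^sup>2 * C * N2 (lebesgue_on (strip D (L * \<delta>))) (\<lambda>x. snd (P x))"
        using \<delta>(1) by (simp add: power_divide)
      also have "\<dots> \<le> ?k\<^sup>2 * C * N2 (lebesgue_on (strip D (L * \<delta>))) P"
      proof (rule mult_left_mono)
        have sL: "sqint (lebesgue_on (strip D (L * \<delta>))) P" by (rule sqint_subset[OF sP sub(2) Ss(2) Ws])
        have "(\<lambda>x. snd (P x)) \<in> borel_measurable (lebesgue_on (strip D (L * \<delta>)))"
          by (rule sqint_measurable[OF sqint_fst_snd(2)[OF sL]])
        from sqint_bound(2)[OF sL this, of 1]
        show "N2 (lebesgue_on (strip D (L * \<delta>))) (\<lambda>x. snd (P x)) \<le> N2 (lebesgue_on (strip D (L * \<delta>))) P"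
          by (simp only: mult_1 norm_fst_snd_le(2) power_one)
      qed (use st(2) in simp)
      finally have "N2 (lebesgue_on ?W) (\<lambda>x. R x - P x) \<le> 4 * N2 (lebesgue_on (strip D \<delta>)) P
          + 2 * (?k\<^sup>2 * C * N2 (lebesgue_on (strip D (L * \<delta>))) P)" by simp
      also have "\<dots> \<le> ?A * N2 (lebesgue_on (strip D (L * \<delta>))) P"
        using N2_subset[OF sqint_subset[OF sP sub(2) Ss(2) Ws] sub(3) Ss(2) Ss(2)] by (simp add: algebra_simps)
      also have "\<dots> < ?A * (\<epsilon> / ?A)" using \<delta>1(2)[OF sub(2) L\<delta>(2)] A by (intro mult_strict_left_mono)
      also have "\<dots> = \<epsilon>" using A by simp
      finally show ?thesis .
    qed
    ultimately show "\<exists>R. H1_cl ?W (frontier D) R \<and> N2 (lebesgue_on ?W) (\<lambda>x. R x - P x) < \<epsilon>" by blast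
  qed
qed

section \<open>Domain monotonicity\<close>

lemma energy_form_self:
  assumes "sqint (lebesgue_on W) P"
  shows "energy_form W \<Lambda> P P = N2 (lebesgue_on W) (\<lambda>x. snd (P x)) - \<Lambda> * N2 (lebesgue_on W) (\<lambda>x. fst (P x))"
proof -
  note s = sqint_fst_snd[OF assms]
  have "energy_form W \<Lambda> P P = (\<integral>x. (norm (snd (P x)))\<^sup>2 - \<Lambda> * (norm (fst (P x)))\<^sup>2 \<partial>lebesgue_on W)"
    unfolding energy_form_def energy_map_def
    by (rule Bochner_Integration.integral_cong) (auto simp: inner_prod_def dot_square_norm power2_eq_square algebra_simps)
  then show ?thesis unfolding N2_def using s by (simp add: sqint_def)
qed

lemma N2_jet_split:
  fixes P :: "'x \<Rightarrow> real \<times> 'b::euclidean_space"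
  assumes "sqint M P"
  shows "N2 M P = N2 M (\<lambda>x. fst (P x)) + N2 M (\<lambda>x. snd (P x))"
proof -
  have "jet (\<lambda>x. fst (P x)) (\<lambda>x. snd (P x)) = P" by (simp add: jet_def fun_eq_iff)
  then show ?thesis using sqint_Pair(2)[OF sqint_fst_snd[OF assms]] by simp
qed

lemma energy_form_coercive_neg:
  assumes "\<Lambda> < 0" and s: "sqint (lebesgue_on W) P"
  shows "min 1 (- \<Lambda>) * N2 (lebesgue_on W) P \<le> energy_form W \<Lambda> P P"
proof -
  let ?u = "N2 (lebesgue_on W) (\<lambda>x. fst (P x))" and ?g = "N2 (lebesgue_on W) (\<lambda>x. snd (P x))"
  have "min 1 (- \<Lambda>) * ?u \<le> - \<Lambda> * ?u" "min 1 (- \<Lambda>) * ?g \<le> 1 * ?g"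
    by (intro mult_right_mono N2_nonneg; simp)+
  then show ?thesis unfolding energy_form_self[OF s] N2_jet_split[OF s] by (simp add: distrib_left)
qed

lemma dirichlet_energy_nonneg: "0 \<le> dirichlet_energy W u"
  by (simp add: dirichlet_energy_def)

lemma dir_eig1_le:
  assumes u: "H10 W u"
  shows "dir_eig1 W * L2norm2 W u \<le> dirichlet_energy W u"
proof -
  have s: "sqint (lebesgue_on W) u" using u by (auto simp: H10_def H1_def L2_dom_def sqint_def)
  have N: "L2norm2 W u = N2 (lebesgue_on W) u" by (simp add: L2norm2_def N2_def)
  show ?thesis
  proof (cases "AE x in lebesgue_on W. u x = 0")
    case True
    then have "L2norm2 W u = 0" using N2_eq_0_iff[OF s] N by simp
    then show ?thesis by (simp add: dirichlet_energy_nonneg)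
  next
    case False
    then have pos: "L2norm2 W u > 0" using N2_eq_0_iff[OF s] N N2_nonneg[of "lebesgue_on W" u] by linarith
    have "dir_eig1 W \<le> dirichlet_energy W u / L2norm2 W u"
      unfolding dir_eig1_def
    proof (rule cInf_lower)
      show "dirichlet_energy W u / L2norm2 W u \<in> {dirichlet_energy W u / L2norm2 W u | u. H10 W u \<and> \<not> (AE x in lebesgue_on W. u x = 0)}"
        using u False by blast
      show "bdd_below {dirichlet_energy W u / L2norm2 W u | u. H10 W u \<and> \<not> (AE x in lebesgue_on W. u x = 0)}"
        by (rule bdd_belowI[of _ 0]) (auto simp: dirichlet_energy_nonneg L2norm2_def)
    qed
    then show ?thesis using pos by (simp add: pos_le_divide_eq)
  qed
qed

text \<open>The constant sequence exhibits \<open>\<phi>\<close> as an element of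
  \<open>H10\<close>.\<close>

lemma dir_eig1_le_C1c:
  assumes W: "open W" "bounded W" and \<phi>: "C1c \<phi> g" "tsupp \<phi> \<subseteq> W"
  shows "dir_eig1 W * N2 (lebesgue_on W) \<phi> \<le> N2 (lebesgue_on W) g"
proof -
  have Wl: "W \<in> lmeasurable" using W by (simp add: lmeasurable_open)
  have J: "H1_jet W (jet \<phi> g)" by (rule C1c_H1_jet[OF Wl \<phi>(1)])
  have "H1dist2 W \<phi> \<phi> = 0" using H1dist2_jet[OF W J \<phi>(1)] by (simp add: jet_def sqint_zero)
  then have "H10 W \<phi>"
    using H1_jet_imp_H1[OF J] \<phi> unfolding H10_def
    by (auto simp: jet_def intro!: exI[of _ "\<lambda>_. \<phi>"] exI[of _ "\<lambda>_. g"])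
  from dir_eig1_le[OF this] show ?thesis
    using dirichlet_energy_jet[OF W J] by (simp add: jet_def L2norm2_def N2_def)
qed

lemma sqint_extend:
  fixes P :: "'a::euclidean_space \<Rightarrow> 'b::euclidean_space"
  assumes P: "sqint (lebesgue_on Wb) P" and W: "Wb \<subseteq> Wa" "Wa \<in> sets lebesgue" "Wb \<in> sets lebesgue"
  shows "sqint (lebesgue_on Wa) (\<lambda>x. if x \<in> Wb then P x else 0)"
    "N2 (lebesgue_on Wa) (\<lambda>x. if x \<in> Wb then P x else 0) = N2 (lebesgue_on Wb) P"
proof -
  let ?E = "\<lambda>x. if x \<in> Wb then P x else 0"
  have "?E \<in> borel_measurable lebesgue" using borel_measurable_if[OF W(3), of P] sqint_measurable[OF P] by simp
  then have m: "?E \<in> borel_measurable (lebesgue_on Wa)" by (rule measurable_restrict_space1)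
  have eq: "(\<lambda>x. indicator Wa x *\<^sub>R (norm (?E x))\<^sup>2) = (\<lambda>x. indicator Wb x *\<^sub>R (norm (P x))\<^sup>2)"
    using W(1) by (auto simp: indicator_def fun_eq_iff)
  have "integrable lebesgue (\<lambda>x. indicator Wb x *\<^sub>R (norm (P x))\<^sup>2)"
    using sqint_integrable[OF P] W(3) by (simp add: integrable_restrict_space)
  then have "integrable (lebesgue_on Wa) (\<lambda>x. (norm (?E x))\<^sup>2)"
    by (subst integrable_restrict_space) (use W(2) in simp, simp only: eq)
  then show "sqint (lebesgue_on Wa) ?E" using m by (simp only: sqint_def simp_thms)
  have "N2 (lebesgue_on Wa) ?E = (\<integral>x. indicator Wa x *\<^sub>R (norm (?E x))\<^sup>2 \<partial>lebesgue)"
    unfolding N2_def by (rule integral_restrict_space) (use W in simp)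
  also have "\<dots> = N2 (lebesgue_on Wb) P"
    unfolding N2_def eq by (rule integral_restrict_space[symmetric]) (use W in simp)
  finally show "N2 (lebesgue_on Wa) ?E = N2 (lebesgue_on Wb) P" .
qed

lemma shell_facts:
  fixes D D0 :: "'a::euclidean_space set"
  assumes "lipschitz_domain D" "closure D0 \<subseteq> D"
  shows "open (D - closure D0)" "bounded (D - closure D0)"
    "frontier (D - closure D0) \<subseteq> frontier D0 \<union> frontier D" "compact (closure D0)"
proof -
  note Dd = lipschitz_domainD[OF assms(1)]
  show "open (D - closure D0)" using Dd by auto
  show "bounded (D - closure D0)" using Dd bounded_subset by blast
  have "frontier (D \<inter> - closure D0) \<subseteq> frontier D \<union> frontier (- closure D0)" by (rule frontier_Int_subset)
  moreover have "frontier (closure D0) \<subseteq> frontier D0"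
    using interior_mono[OF closure_subset[of D0]] by (auto simp: frontier_def)
  ultimately show "frontier (D - closure D0) \<subseteq> frontier D0 \<union> frontier D"
    unfolding Diff_eq frontier_complement by blast
  have "bounded (closure D0)" using assms(2) Dd(2) bounded_subset by blast
  then show "compact (closure D0)" by (simp add: compact_eq_bounded_closed)
qed

text \<open>Tests avoiding \<open>frontier W'\<close> can be cut off to \<open>W'\<close> and
  extended by zero to \<open>W\<close>, where \<open>dir_eig1 W\<close> bounds their Rayleigh
  quotient from below. Thus the bound on \<Lambda> for the larger domain yields coercivity on both
  domains.\<close>

lemma energy_form_coercive_dirichlet:
  fixes W W' :: "'a::euclidean_space set"
  assumes W: "open W" "bounded W" and W': "open W'" "W' \<subseteq> W" and \<Lambda>: "\<Lambda> < dir_eig1 W"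
  shows "\<exists>c>0. \<forall>S. frontier W' \<subseteq> S \<longrightarrow> (\<forall>t\<in>tests S. c * N2 (lebesgue_on W') t \<le> energy_form W' \<Lambda> t t)"
proof -
  \<comment> \<open>Still a lower bound for the Rayleigh quotients, as the gradient energy is
    nonnegative; it ensures \<open>1 + \<mu> > 0\<close>.\<close>
  let ?\<mu> = "max 0 (dir_eig1 W)"
  \<comment> \<open>A share \<open>c\<close> of the gradient energy is kept and the rest is
    estimated from below by \<open>(1 - c) \<mu>\<close> times the squared norm. This leaves at
    least \<open>c\<close> in front of that norm iff
    \<open>c * (1 + \<mu>) \<le> \<mu> - \<Lambda>\<close>; the cap \<open>1/2\<close> keeps
    \<open>1 - c\<close> positive.\<close>
  define c where "c = min (1/2) ((?\<mu> - \<Lambda>) / (1 + ?\<mu>))"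
  have c: "c > 0" "c < 1" "c * (1 + ?\<mu>) \<le> ?\<mu> - \<Lambda>"
  proof -
    have p: "1 + ?\<mu> > 0" by simp
    show "c > 0" unfolding c_def using \<Lambda> p by auto
    show "c < 1" by (simp add: c_def)
    have "c \<le> (?\<mu> - \<Lambda>) / (1 + ?\<mu>)" by (simp add: c_def)
    then show "c * (1 + ?\<mu>) \<le> ?\<mu> - \<Lambda>" using p by (simp only: pos_le_divide_eq)
  qed
  have W'b: "bounded W'" using W W' bounded_subset by blast
  have sets: "W \<in> sets lebesgue" "W' \<in> sets lebesgue" using W W' by auto
  have "c * N2 (lebesgue_on W') t \<le> energy_form W' \<Lambda> t t" if S: "frontier W' \<subseteq> S" "t \<in> tests S" for S t
  proof -
    obtain \<phi> g where t: "t = jet \<phi> g" "C1c \<phi> g" "tsupp \<phi> \<inter> S = {}" using S(2) by (auto simp: tests_def)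
    have st: "sqint (lebesgue_on W') t" unfolding t(1) by (rule sqint_jet[OF t(2)]) (use W'(1) W'b in \<open>simp add: lmeasurable_open\<close>)
    have s\<phi>: "sqint (lebesgue_on W') \<phi>" "sqint (lebesgue_on W') g"
      using sqint_fst_snd[OF st] by (auto simp: t(1) jet_def)
    have d: "tsupp \<phi> \<inter> frontier W' = {}" using t(3) S(1) by blast
    note cut = C1c_cut[OF t(2) W'(1) d]
    have "dir_eig1 W * N2 (lebesgue_on W') \<phi> \<le> N2 (lebesgue_on W') g"
      using dir_eig1_le_C1c[OF W cut(1)] cut(2) W'(2)
      unfolding sqint_extend(2)[OF s\<phi>(1) W'(2) sets] sqint_extend(2)[OF s\<phi>(2) W'(2) sets] by blast
    moreover have "0 \<le> N2 (lebesgue_on W') g" by (rule N2_nonneg)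
    ultimately have g: "?\<mu> * N2 (lebesgue_on W') \<phi> \<le> N2 (lebesgue_on W') g" by (simp add: max_def)
    have "(c * (1 + ?\<mu>)) * N2 (lebesgue_on W') \<phi> \<le> (?\<mu> - \<Lambda>) * N2 (lebesgue_on W') \<phi>"
      by (rule mult_right_mono[OF c(3) N2_nonneg])
    moreover have "(1 - c) * (?\<mu> * N2 (lebesgue_on W') \<phi>) \<le> (1 - c) * N2 (lebesgue_on W') g"
      using c(2) by (intro mult_left_mono g) simp
    ultimately have "c * (N2 (lebesgue_on W') \<phi> + N2 (lebesgue_on W') g) \<le> N2 (lebesgue_on W') g - \<Lambda> * N2 (lebesgue_on W') \<phi>"
      by (simp add: algebra_simps)
    then show ?thesis using energy_form_self[OF st, of \<Lambda>] N2_jet_split[OF st] by (simp add: t(1) jet_def)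
  qed
  then show ?thesis using c(1) by blast
qed

lemma L2lim_cong:
  assumes "L2lim (lebesgue_on W) q P" "\<And>x. x \<in> W \<Longrightarrow> P x = Q x"
  shows "L2lim (lebesgue_on W) q Q"
proof -
  have "Q \<in> borel_measurable (lebesgue_on W) \<longleftrightarrow> P \<in> borel_measurable (lebesgue_on W)"
    by (rule measurable_cong) (use assms(2) in auto)
  moreover have "integrable (lebesgue_on W) (\<lambda>x. (norm (Q x))\<^sup>2) \<longleftrightarrow> integrable (lebesgue_on W) (\<lambda>x. (norm (P x))\<^sup>2)"
    by (rule Bochner_Integration.integrable_cong) (use assms(2) in auto)
  ultimately have "sqint (lebesgue_on W) Q \<longleftrightarrow> sqint (lebesgue_on W) P" unfolding sqint_def by simp
  moreover have "N2 (lebesgue_on W) (\<lambda>x. q n x - Q x) = N2 (lebesgue_on W) (\<lambda>x. q n x - P x)" for n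
    unfolding N2_def by (rule Bochner_Integration.integral_cong) (use assms(2) in auto)
  ultimately show ?thesis using assms(1) by (simp add: L2lim_def)
qed

theorem mainTheorem13:
  fixes D0 D1 D2 :: "'a::euclidean_space set"
  assumes dim: "DIM('a) \<ge> 2"
    and lip0: "lipschitz_domain D0" and lip1: "lipschitz_domain D1" and lip2: "lipschitz_domain D2"
    and sc0: "simply_connected D0" and sc1: "simply_connected D1" and sc2: "simply_connected D2"
    and incl01: "closure D0 \<subseteq> D1" and incl12: "closure D1 \<subseteq> D2"
  shows "(\<forall>\<Lambda>::real. \<Lambda> < dir_eig1 (D2 - closure D0) \<longrightarrow>
            (\<forall>k\<ge>1. dtn_eig (D1 - closure D0) (frontier D0) (frontier D1) \<Lambda> k
                    \<ge> dtn_eig (D2 - closure D0) (frontier D0) (frontier D2) \<Lambda> k))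
       \<and> (\<forall>\<Lambda>::real. \<Lambda> < 0 \<longrightarrow>
            (\<forall>k\<ge>1. dtn_eig (D1 - closure D0) (frontier D0) {} \<Lambda> k
                    \<le> dtn_eig (D2 - closure D0) (frontier D0) {} \<Lambda> k))"
proof -
  let ?W1 = "D1 - closure D0" and ?W2 = "D2 - closure D0" and ?\<Gamma> = "frontier D0"
  note d1 = lipschitz_domainD[OF lip1] and d2 = lipschitz_domainD[OF lip2]
  have D12: "D1 \<subseteq> D2" using incl12 closure_subset by blast
  then have incl02: "closure D0 \<subseteq> D2" using incl01 by blast
  note s1 = shell_facts[OF lip1 incl01] and s2 = shell_facts[OF lip2 incl02]
  have sub: "?W1 \<subseteq> ?W2" using D12 by blast
  have lm: "?W1 \<in> lmeasurable" "?W2 \<in> lmeasurable" using s1 s2 by (auto intro: lmeasurable_open)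
  have sets: "?W1 \<in> sets lebesgue" "?W2 \<in> sets lebesgue" using lm by (auto simp: fmeasurableD)
  have fr2: "frontier D2 \<inter> D1 = {}" using d2(6) D12 by blast
  \<comment> \<open>The gluing function of the comparison: it is 1 near the hole and supported in
    \<open>D1\<close>, where the two shells coincide and no outer boundary is met.\<close>
  obtain \<eta> h N where \<eta>: "C1c \<eta> h" "tsupp \<eta> \<subseteq> D1" "open N" "closure D0 \<subseteq> N" "\<And>x. x \<in> N \<Longrightarrow> \<eta> x = 1"
    using cutoff_compact_open[OF s1(4) d1(1) incl01] by blast
  have \<Gamma>N: "?\<Gamma> \<subseteq> N" using \<eta>(4) by (auto simp: frontier_def)
  let ?E = "\<lambda>P x. if x \<in> ?W1 then P x else 0 :: real \<times> 'a"
  have Dir: "dtn_eig ?W2 ?\<Gamma> (frontier D2) \<Lambda> k \<le> dtn_eig ?W1 ?\<Gamma> (frontier D1) \<Lambda> k"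
    if \<Lambda>: "\<Lambda> < dir_eig1 ?W2" for \<Lambda> k
  proof -
    obtain ca where ca: "ca > 0" "\<And>t. t \<in> tests (?\<Gamma> \<union> frontier D2) \<Longrightarrow> ca * N2 (lebesgue_on ?W2) t \<le> energy_form ?W2 \<Lambda> t t"
      using energy_form_coercive_dirichlet[OF s2(1,2) s2(1) order_refl \<Lambda>] s2(3) by blast
    obtain cb where cb: "cb > 0" "\<And>t. t \<in> tests (?\<Gamma> \<union> frontier D1) \<Longrightarrow> cb * N2 (lebesgue_on ?W1) t \<le> energy_form ?W1 \<Lambda> t t"
      using energy_form_coercive_dirichlet[OF s2(1,2) s1(1) sub \<Lambda>] s1(3) by blast
    have ext: "H1_cl ?W2 (frontier D2) (?E P) \<and> energy_form ?W2 \<Lambda> (?E P) (?E P) \<le> energy_form ?W1 \<Lambda> P P"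
      if P: "H1_cl ?W1 (frontier D1) P" for P
    proof
      have sP: "sqint (lebesgue_on ?W1) P" by (rule H1_cl_sqint[OF P])
      note e = sqint_extend[OF _ sub sets(2,1)]
      have sE: "sqint (lebesgue_on ?W2) (?E P)" by (rule e(1)[OF sP])
      obtain q where q: "\<And>n. q n \<in> tests (frontier D1)" "L2lim (lebesgue_on ?W1) q P"
        using P unfolding H1_cl_def by blast
      \<comment> \<open>Truncation takes place at \<open>D1\<close> and not at the shell: the tests
        avoid \<open>frontier D1\<close> but need not vanish near \<Gamma>.\<close>
      define q' where "q' n x = (if x \<in> D1 then q n x else 0)" for n x
      have q': "q' n \<in> tests (frontier D2)" for n
      proof -
        obtain \<phi> g where t: "q n = jet \<phi> g" "C1c \<phi> g" "tsupp \<phi> \<inter> frontier D1 = {}" using q(1)[of n] by (auto simp: tests_def)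
        note cut = C1c_cut[OF t(2) d1(1) t(3)]
        have "q' n = jet (\<lambda>x. if x \<in> D1 then \<phi> x else 0) (\<lambda>x. if x \<in> D1 then g x else 0)"
          by (auto simp: q'_def t(1) jet_def zero_prod_def fun_eq_iff)
        moreover have "tsupp (\<lambda>x. if x \<in> D1 then \<phi> x else 0) \<inter> frontier D2 = {}" using cut(2) fr2 by blast
        ultimately show ?thesis using testsI[OF cut(1)] by simp
      qed
      have "L2lim (lebesgue_on ?W2) q' (?E P)"
      proof (rule L2limI_le[OF sqint_tests[OF q' lm(2)] sE _ L2limD(3)[OF q(2)]])
        fix n
        show "N2 (lebesgue_on ?W2) (\<lambda>x. q' n x - ?E P x) \<le> N2 (lebesgue_on ?W1) (\<lambda>x. q n x - P x)"
          using N2_transfer[OF sqint_diff(1)[OF sqint_tests[OF q' lm(2)] sE] sqint_diff(1)[OF L2limD(1,2)[OF q(2)]] sets(2,1), of n 1 n]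
          by (auto simp: q'_def)
      qed
      then show "H1_cl ?W2 (frontier D2) (?E P)" unfolding H1_cl_def using q' by blast
      have "(\<lambda>x. fst (?E P x)) = (\<lambda>x. if x \<in> ?W1 then fst (P x) else 0)"
        "(\<lambda>x. snd (?E P x)) = (\<lambda>x. if x \<in> ?W1 then snd (P x) else 0)" by auto
      then show "energy_form ?W2 \<Lambda> (?E P) (?E P) \<le> energy_form ?W1 \<Lambda> P P"
        unfolding energy_form_self[OF sE] energy_form_self[OF sP]
        using e(2)[OF sqint_fst_snd(1)[OF sP]] e(2)[OF sqint_fst_snd(2)[OF sP]] by simp
    qed
    \<comment> \<open>The larger shell has the smaller Dirichlet eigenvalues, so it is
      \<open>Wa\<close>, and \<open>E\<close> extends by zero.\<close>
    interpret dtn_comparison ?W2 ?W1 ?\<Gamma> "frontier D2" "frontier D1" ?W1 N \<Lambda> \<eta> h ca cb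
    proof
      show "tsupp \<eta> \<inter> (frontier D2 \<union> frontier D1) = {}" using \<eta>(2) fr2 d1(6) by blast
      show "H1_cl ?W1 (frontier D1) P" if "H1_jet ?W1 P" "trace_on ?W1 (frontier D1) (\<lambda>x. fst (P x)) (\<lambda>_. 0)" for P
        by (rule H1_cl_of_trace_zero[OF dim lip1 s1(4) incl01 that])
    qed (use s1 s2 \<eta> \<Gamma>N D12 ca cb ext in auto)
    show ?thesis by (rule dtn_eig_le)
  qed
  have Neu: "dtn_eig ?W1 ?\<Gamma> {} \<Lambda> k \<le> dtn_eig ?W2 ?\<Gamma> {} \<Lambda> k" if \<Lambda>: "\<Lambda> < 0" for \<Lambda> k
  proof -
    let ?c = "min 1 (- \<Lambda>)"
    have ext: "H1_cl ?W1 {} (?E P) \<and> energy_form ?W1 \<Lambda> (?E P) (?E P) \<le> energy_form ?W2 \<Lambda> P P"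
      if P: "H1_cl ?W2 {} P" for P
    proof
      obtain q where q: "\<And>n. q n \<in> tests {}" "L2lim (lebesgue_on ?W2) q P"
        using P unfolding H1_cl_def by blast
      have lim: "L2lim (lebesgue_on ?W1) q (?E P)"
        by (rule L2lim_cong[OF L2lim_subset[OF q(2) sub sets]]) simp
      then show "H1_cl ?W1 {} (?E P)" unfolding H1_cl_def using q by blast
      have sP: "sqint (lebesgue_on ?W2) P" by (rule H1_cl_sqint[OF P])
      note sf = sqint_fst_snd[OF sP]
      have sE: "sqint (lebesgue_on ?W1) (?E P)" by (rule L2limD(2)[OF lim])
      have "N2 (lebesgue_on ?W1) (\<lambda>x. fst (?E P x)) = N2 (lebesgue_on ?W1) (\<lambda>x. fst (P x))"
        "N2 (lebesgue_on ?W1) (\<lambda>x. snd (?E P x)) = N2 (lebesgue_on ?W1) (\<lambda>x. snd (P x))"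
        unfolding N2_def by (intro Bochner_Integration.integral_cong; simp)+
      \<comment> \<open>Since \<open>- \<Lambda>\<close> is positive, both terms of the energy are
        nonnegative integrals that decrease under restriction.\<close>
      moreover have "- \<Lambda> * N2 (lebesgue_on ?W1) (\<lambda>x. fst (P x)) \<le> - \<Lambda> * N2 (lebesgue_on ?W2) (\<lambda>x. fst (P x))"
        using \<Lambda> by (intro mult_left_mono N2_subset[OF sf(1) sub sets]) simp
      moreover have "N2 (lebesgue_on ?W1) (\<lambda>x. snd (P x)) \<le> N2 (lebesgue_on ?W2) (\<lambda>x. snd (P x))"
        by (rule N2_subset[OF sf(2) sub sets])
      ultimately show "energy_form ?W1 \<Lambda> (?E P) (?E P) \<le> energy_form ?W2 \<Lambda> P P"
        unfolding energy_form_self[OF sE] energy_form_self[OF sP] by simp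
    qed
    \<comment> \<open>The roles are exchanged: the smaller shell is \<open>Wa\<close>, and
      \<open>E\<close> restricts to it.\<close>
    interpret dtn_comparison ?W1 ?W2 ?\<Gamma> "{}" "{}" ?W1 N \<Lambda> \<eta> h ?c ?c
    proof
      show "?c > 0" using \<Lambda> by simp
      show "?c * N2 (lebesgue_on ?W1) t \<le> energy_form ?W1 \<Lambda> t t" if "t \<in> tests (?\<Gamma> \<union> {})" for t
        by (rule energy_form_coercive_neg[OF \<Lambda> sqint_tests[OF that lm(1)]])
      show "?c * N2 (lebesgue_on ?W2) t \<le> energy_form ?W2 \<Lambda> t t" if "t \<in> tests (?\<Gamma> \<union> {})" for t
        by (rule energy_form_coercive_neg[OF \<Lambda> sqint_tests[OF that lm(2)]])
      \<comment> \<open>A trace on the empty set carries no boundary condition, but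
        \<open>trace_on\<close> still provides approximation by C1 functions, which is
        \<open>H1_cl\<close> for the empty set.\<close>
      show "H1_cl ?W2 {} P" if "H1_jet ?W2 P" "trace_on ?W2 {} (\<lambda>x. fst (P x)) (\<lambda>_. 0)" for P
        using that(2) unfolding trace_on_tests_iff[OF s2(1,2) that(1)] H1_cl_def by blast
    qed (use s1 s2 \<eta> \<Gamma>N D12 ext in auto)
    show ?thesis by (rule dtn_eig_le)
  qed
  show ?thesis using Dir Neu by blast
qed

end
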